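(* Let $s,d\ge 1$, $b\ge2$ and $t\ge 0$ be fixed integers. For $j=1,\dots,s$ let $\mathcal{X}^{(j)}\subset\mathbb{R}^d$ be bounded with $\mathrm{vol}(\mathcal{X}^{(j)})=1$, and let $\mathbb{X}_j$ be a convergent recursive split of $\mathcal{X}^{(j)}$ in base $b$ satisfying the sphericity condition, with transformation $\phi_j:[0,1)\to\mathcal{X}^{(j)}$. Put $\mathcal{X}^{1:s}=\prod_{j=1}^s\mathcal{X}^{(j)}\subset\mathbb{R}^{ds}$. For $n=b^m$, $m\ge t$, let $\boldsymbol{u}_1,\dots,\boldsymbol{u}_n$ be a nested uniform scramble of a $(t,m,s)$-net $\boldsymbol{a}_1,\dots,\boldsymbol{a}_n$ in base $b$, let $\boldsymbol{x}_i=\phi(\boldsymbol{u}_i)=(\phi_1(u_{i1}),\dots,\phi_s(u_{is}))$, and let $\hat\mu=\frac1n\sum_{i=1}^n f(\boldsymbol{x}_i)$. Suppose that, as $n\to\infty$ with $t$ fixed, all gain coefficients of the nets satisfy $\Gamma_{u,\kappa}\le G$ for some constant $G<\infty$. (i) If $\mathcal{X}^{1:s}$ is Sobol' extensible and $f:\mathcal{X}^{1:s}\to\mathbb{R}$ is smooth, then $$\mathrm{Var}(\hat\mu)=O\left(\frac{(\log n)^{s-1}}{n^{1+2/d}}\right)\quad\text{as } n\to\infty.$$ (ii) If $f\in C^{ds}(\mathcal{X}^{1:s})$, where each $\mathcal{X}^{(j)}$ is a bounded closed set with non-empty interior and a boundary of ($d$-dimensional) measure zero, then the same bound holds regardless of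 whether $\mathcal{X}^{1:s}$ is Sobol' extensible.
   Context: Notation: $\mathbb{N}=\{0,1,2,\dots\}$, $\mathbb{Z}_b=\{0,\dots,b-1\}$, $1{:}s=\{1,\dots,s\}$, $\mathrm{vol}$ is Lebesgue measure. Nets. A $b$-adic box is $\prod_{j=1}^s[c_jb^{-k_j},(c_j+1)b^{-k_j})$ with $k_j\in\mathbb{N}$, $c_j\in\mathbb{Z}_{b^{k_j}}$. For $m\ge t\ge0$, points $\boldsymbol{a}_1,\dots,\boldsymbol{a}_{b^m}\in[0,1)^s$ form a $(t,m,s)$-net in base $b$ if every $b$-adic box of volume $b^{t-m}$ contains exactly $b^t$ of them. Nested uniform scramble. Write $a\in[0,1)$ in base $b$ as $a=\sum_{k\ge1}a_kb^{-k}$ (choosing the expansion with trailing zeros if there are two). Its nested uniform scramble is $x=\sum_{k\ge1}x_kb^{-k}$, with $x_1=\pi_{\bullet}(a_1)$ and $x_{k+1}=\pi_{\bullet a_1\cdots a_k}(a_{k+1})$, where all the permutations $\pi_{\bullet a_1\cdots a_k}$ of $\mathbb{Z}_b$ are independent and uniformly distributed over the $b!$ permutations. For points in $[0,1)^s$, independent scrambles are applied to the $s$ components, and the same set of permutations is used for all $n$ points. Gain coefficients. For $\emptyset\neq u\subseteq1{:}s$ and $\kappa=(k_j)_{j\in u}\in\mathbb{N}^{|u|}$, with $\boldsymbol{a}_i=(a_{i1},\dots,a_{is})$, $$\Gamma_{u,\kappa}=\frac1n\sum_{i=1}^n\sum_{i'=1}^n\prod_{j\in u}\Upsilon_{i,i',j,k_j},\qquad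 \Upsilon_{i,i',j,k}=\frac1{b-1}\bigl(b\,1_{\lfloor b^{k+1}a_{ij}\rfloor=\lfloor b^{k+1}a_{i'j}\rfloor}-1_{\lfloor b^ka_{ij}\rfloor=\lfloor b^ka_{i'j}\rfloor}\bigr).$$ Splits. For $\mathcal{X}\subset\mathbb{R}^d$ of finite positive volume, a $b$-fold split of $\mathcal{X}$ is a collection of Borel sets $\mathcal{X}_a$, $a\in\mathbb{Z}_b$, with $\mathcal{X}=\bigcup_a\mathcal{X}_a$, $\mathrm{vol}(\mathcal{X}_a)=\mathrm{vol}(\mathcal{X})/b$ and $\mathrm{vol}(\mathcal{X}_a\cap\mathcal{X}_{a'})=0$ for $a\ne a'$. A recursive split $\mathbb{X}$ in base $b$ consists of $\mathcal{X}$ and exactly one $b$-fold split of every set in the collection; its members are called cells. The level-$k$ cells are $\mathcal{X}_{a_1,\dots,a_k}$, where $\mathcal{X}_{a_1,\dots,a_k,a}$, $a\in\mathbb{Z}_b$, is the split of $\mathcal{X}_{a_1,\dots,a_k}$. Borel sets $\mathcal{S}_k\subset\mathbb{R}^d$ converge nicely to $\boldsymbol{x}$ if there are $\alpha<\infty$ and $d$-dimensional cubes $\mathcal{C}_k$ with $\boldsymbol{x}\in\mathcal{C}_k$, $\mathcal{S}_k\subseteq\mathcal{C}_k$, $0<\mathrm{vol}(\mathcal{C}_k)\le\alpha\,\mathrm{vol}(\mathcal{S}_k)$ and $\lim_k\mathrm{diam}(\mathcal{S}_k)=0$. $\mathbb{X}$ is convergent if for every infinite sequence $a_1,a_2,\dots\in\mathbb{Z}_b$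 the cells $\mathcal{X}_{a_1,\dots,a_K}$ converge nicely to a point as $K\to\infty$, denoted $\lim_K\mathcal{X}_{a_1,\dots,a_K}$. Its transformation is $\phi:[0,1)\to\mathcal{X}$, $\phi(x)=\lim_{K}\mathcal{X}_{x_1,\dots,x_K}$, where $x=0.x_1x_2\dots$ in base $b$ (using the expansion with trailing zeros if there are two). $\mathbb{X}$ satisfies the sphericity condition if there is $C<\infty$ with $\mathrm{diam}(\mathcal{X}_{a_1,\dots,a_k})\le Cb^{-k/d}$ for all cells. Smoothness. For $\mathcal{X}\subseteq\mathbb{R}^M$ and $v\subseteq1{:}M$, $\partial^vf$ is the mixed partial derivative of $f$ taken once with respect to each $x_j$, $j\in v$ (and $\partial^\emptyset f=f$). $f$ is smooth on $\mathcal{X}$ if $\partial^{1:M}f$ is continuous on $\mathcal{X}$; it is understood that $\partial^vf$ exists and is continuous on $\mathcal{X}$ for all $v\subseteq1{:}M$. $f\in C^M(\mathcal{X})$ means all partial derivatives of $f$ of total order at most $M$ are continuous on $\mathcal{X}$. For $\boldsymbol{a},\boldsymbol{z}\in\mathbb{R}^M$, $\mathrm{rect}[\boldsymbol{a},\boldsymbol{z}]=\prod_j[\min(a_j,z_j),\max(a_j,z_j)]$. A closed set $\mathcal{X}\subseteq\mathbb{R}^M$ with non-empty interior is Sobol' extensible if there is $\boldsymbol{c}\in\mathcal{X}$ (an anchor) such that $\boldsymbol{z}\in\mathcal{X}$ implies $\mathrm{rect}[\boldsymbol{c},\boldsymbol{z}]\subseteq\mathcal{X}$.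
   Formalization: In (ii), f ∈ C^{ds} on the closed set is taken in Whitney's sense: besides continuous partial derivatives up to order ds, Taylor expansions at nearby points of the set must be compatible. With continuous partial derivatives alone (ii) fails, e.g. on intervals separated by tiny accumulating gaps. *)

theory Defs
  imports "HOL-Probability.Probability" "HOL-Combinatorics.Permutations"
    "HOL-Library.Landau_Symbols"
begin

section \<open>Digital nets and gain coefficients\<close>

definition adic_box :: "nat \<Rightarrow> ('s \<Rightarrow> nat) \<Rightarrow> ('s \<Rightarrow> nat) \<Rightarrow> (real^'s::finite) set" where
  "adic_box b k c =
     {x. \<forall>j. real (c j) / real b ^ k j \<le> x $ j \<and> x $ j < (real (c j) + 1) / real b ^ k j}"

text \<open>Points are indexed by \<open>{1..n}\<close>; repeated points are counted with multiplicity.\<close>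

definition tms_net :: "nat \<Rightarrow> nat \<Rightarrow> nat \<Rightarrow> (nat \<Rightarrow> real^'s::finite) \<Rightarrow> bool" where
  "tms_net b t m a \<longleftrightarrow>
     t \<le> m \<and>
     (\<forall>i\<in>{1..b ^ m}. \<forall>j. 0 \<le> a i $ j \<and> a i $ j < 1) \<and>
     (\<forall>k c. (\<forall>j. c j < b ^ k j) \<longrightarrow>
        measure lborel (adic_box b k c) = real b powi (int t - int m) \<longrightarrow>
        card {i\<in>{1..b ^ m}. a i \<in> adic_box b k c} = b ^ t)"

definition Upsilon :: "nat \<Rightarrow> real \<Rightarrow> real \<Rightarrow> nat \<Rightarrow> real" where
  "Upsilon b x y k =
     (real b * of_bool (\<lfloor>real b ^ (k + 1) * x\<rfloor> = \<lfloor>real b ^ (k + 1) * y\<rfloor>)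
        - of_bool (\<lfloor>real b ^ k * x\<rfloor> = \<lfloor>real b ^ k * y\<rfloor>)) / (real b - 1)"

text \<open>Only the values of \<open>\<kappa>\<close> on \<open>u\<close> matter.\<close>

definition gain :: "nat \<Rightarrow> nat \<Rightarrow> (nat \<Rightarrow> real^'s::finite) \<Rightarrow> 's set \<Rightarrow> ('s \<Rightarrow> nat) \<Rightarrow> real" where
  "gain b n a u \<kappa> =
     (1 / real n) * (\<Sum>i=1..n. \<Sum>i'=1..n. \<Prod>j\<in>u. Upsilon b (a i $ j) (a i' $ j) (\<kappa> j))"


section \<open>Nested uniform scrambling\<close>

text \<open>For \<open>x \<in> [0,1)\<close> and \<open>k \<ge> 1\<close>, the \<open>k\<close>-th digit of the base \<open>b\<close> expansion of \<open>x\<close>;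
  the floor selects the expansion with trailing zeros.\<close>

definition digit :: "nat \<Rightarrow> nat \<Rightarrow> real \<Rightarrow> nat" where
  "digit b k x = nat \<lfloor>real b ^ k * x\<rfloor> mod b"

definition digits :: "nat \<Rightarrow> nat \<Rightarrow> real \<Rightarrow> nat list" where
  "digits b K x = map (\<lambda>k. digit b (Suc k) x) [0..<K]"

definition scramble :: "nat \<Rightarrow> (nat list \<Rightarrow> nat \<Rightarrow> nat) \<Rightarrow> real \<Rightarrow> real" where
  "scramble b \<pi> x = (\<Sum>k. real (\<pi> (digits b k x) (digit b (Suc k) x)) / real b ^ Suc k)"

text \<open>The permutation used for component \<open>j\<close> after the digits \<open>w\<close> is \<open>\<pi> (j, w)\<close>; it is shared by
  all \<open>n\<close> points.\<close>

definition nested_uniform_scramble ::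
  "'w measure \<Rightarrow> nat \<Rightarrow> nat \<Rightarrow> (nat \<Rightarrow> real^'s::finite) \<Rightarrow> (nat \<Rightarrow> 'w \<Rightarrow> real^'s) \<Rightarrow> bool" where
  "nested_uniform_scramble M b n a u \<longleftrightarrow>
     prob_space M \<and>
     (\<exists>\<pi> :: 's \<times> nat list \<Rightarrow> 'w \<Rightarrow> nat \<Rightarrow> nat.
        prob_space.indep_vars M (\<lambda>_. count_space {p. p permutes {..<b}}) \<pi>
          (UNIV \<times> lists {..<b}) \<and>
        (\<forall>q\<in>UNIV \<times> lists {..<b}.
           distr M (count_space {p. p permutes {..<b}}) (\<pi> q)
             = uniform_count_measure {p. p permutes {..<b}}) \<and>
        (\<forall>\<omega>\<in>space M. \<forall>i\<in>{1..n}. \<forall>j. u i \<omega> $ j = scramble b (\<lambda>w. \<pi> (j, w) \<omega>) (a i $ j)))"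


section \<open>Recursive splits\<close>

definition fold_split :: "nat \<Rightarrow> 'a::euclidean_space set \<Rightarrow> (nat \<Rightarrow> 'a set) \<Rightarrow> bool" where
  "fold_split b X Y \<longleftrightarrow>
     X \<in> fmeasurable lborel \<and> 0 < measure lborel X \<and>
     (\<forall>a<b. Y a \<in> sets borel) \<and>
     X = (\<Union>a<b. Y a) \<and>
     (\<forall>a<b. measure lborel (Y a) = measure lborel X / real b) \<and>
     (\<forall>a<b. \<forall>a'<b. a \<noteq> a' \<longrightarrow> measure lborel (Y a \<inter> Y a') = 0)"

text \<open>Cells are addressed by digit strings. Distinct strings give distinct cells, because cells on
  one level have positive volume and null intersections and volumes differ between levels.\<close>

definition recursive_split :: "nat \<Rightarrow> 'a::euclidean_space set \<Rightarrow> (nat list \<Rightarrow> 'a set) \<Rightarrow> bool" where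
  "recursive_split b X cell \<longleftrightarrow>
     cell [] = X \<and> (\<forall>w\<in>lists {..<b}. fold_split b (cell w) (\<lambda>a. cell (w @ [a])))"

definition converges_nicely :: "(nat \<Rightarrow> 'a::euclidean_space set) \<Rightarrow> 'a \<Rightarrow> bool" where
  "converges_nicely S x \<longleftrightarrow>
     (\<forall>k. S k \<in> sets borel) \<and>
     (\<exists>\<alpha> C. \<forall>k. (\<exists>c r. C k = cbox c (c + r *\<^sub>R One)) \<and> x \<in> C k \<and> S k \<subseteq> C k \<and>
        0 < measure lborel (C k) \<and> measure lborel (C k) \<le> \<alpha> * measure lborel (S k)) \<and>
     (\<lambda>k. diameter (S k)) \<longlonglongrightarrow> 0"

definition convergent_split :: "nat \<Rightarrow> (nat list \<Rightarrow> 'a::euclidean_space set) \<Rightarrow> bool" where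
  "convergent_split b cell \<longleftrightarrow>
     (\<forall>a :: nat \<Rightarrow> nat. (\<forall>k. a k < b) \<longrightarrow>
        (\<exists>x. converges_nicely (\<lambda>K. cell (map a [0..<K])) x))"

definition split_map :: "nat \<Rightarrow> (nat list \<Rightarrow> 'a::euclidean_space set) \<Rightarrow> real \<Rightarrow> 'a" where
  "split_map b cell x = (THE p. converges_nicely (\<lambda>K. cell (digits b K x)) p)"

definition spherical_split :: "nat \<Rightarrow> (nat list \<Rightarrow> 'a::euclidean_space set) \<Rightarrow> bool" where
  "spherical_split b cell \<longleftrightarrow>
     (\<exists>C. \<forall>w\<in>lists {..<b}.
        diameter (cell w) \<le> C * real b powr (- real (length w) / real DIM('a)))"


section \<open>Smoothness on sets that need not be open\<close>

definition rect :: "'a::euclidean_space \<Rightarrow> 'a \<Rightarrow> 'a set" where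
  "rect a z = {x. \<forall>e\<in>Basis. min (a \<bullet> e) (z \<bullet> e) \<le> x \<bullet> e \<and> x \<bullet> e \<le> max (a \<bullet> e) (z \<bullet> e)}"

definition sobol_extensible :: "'a::euclidean_space set \<Rightarrow> bool" where
  "sobol_extensible X \<longleftrightarrow>
     closed X \<and> interior X \<noteq> {} \<and> (\<exists>c\<in>X. \<forall>z\<in>X. rect c z \<subseteq> X)"

text \<open>\<open>g'\<close> is a partial derivative of \<open>g\<close> on \<open>X\<close> in the coordinate direction \<open>e\<close>. Difference
  quotients use points of \<open>X\<close> only, so the derivative is one-sided at boundary points where \<open>X\<close>
  extends to one side; where \<open>X\<close> does not extend in direction \<open>e\<close> at all, \<open>g' x\<close> is
  unconstrained.\<close>

definition has_partial_on ::
  "('a::euclidean_space \<Rightarrow> real) \<Rightarrow> ('a \<Rightarrow> real) \<Rightarrow> 'a \<Rightarrow> 'a set \<Rightarrow> bool" where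
  "has_partial_on g g' e X \<longleftrightarrow>
     (\<forall>x\<in>X. ((\<lambda>h. g (x + h *\<^sub>R e)) has_real_derivative g' x) (at 0 within {h. x + h *\<^sub>R e \<in> X}))"

text \<open>\<open>D v\<close> is \<open>\<partial>\<^sup>v f\<close>, one derivative in each coordinate direction of \<open>v \<subseteq> Basis\<close>.\<close>

definition smooth :: "'a::euclidean_space set \<Rightarrow> ('a \<Rightarrow> real) \<Rightarrow> bool" where
  "smooth X f \<longleftrightarrow>
     (\<exists>D :: 'a set \<Rightarrow> 'a \<Rightarrow> real.
        (\<forall>x\<in>X. D {} x = f x) \<and>
        (\<forall>v\<subseteq>Basis. continuous_on X (D v)) \<and>
        (\<forall>v\<subseteq>Basis. \<forall>e\<in>Basis - v. has_partial_on (D v) (D (insert e v)) e X))"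

definition multi_indices :: "nat \<Rightarrow> ('a::euclidean_space \<Rightarrow> nat) set" where
  "multi_indices r = {\<alpha>. (\<forall>e. e \<notin> Basis \<longrightarrow> \<alpha> e = 0) \<and> (\<Sum>e\<in>Basis. \<alpha> e) \<le> r}"

text \<open>The class \<open>C\<^sup>N(X)\<close>, with \<open>D \<alpha>\<close> the partial derivative of \<open>f\<close> of multi-index \<open>\<alpha>\<close>. The first
  three clauses say that all partial derivatives of order at most \<open>N\<close> exist and are continuous
  on \<open>X\<close>. On a general closed set this does not control how \<open>f\<close> varies across thin gaps of \<open>X\<close>; the
  last clause is Whitney's condition from ``Analytic extensions of differentiable functions defined
  in closed sets'' (1934) that the Taylor expansions at nearby points of \<open>X\<close> agree, which is what
  being of class \<open>C\<^sup>N\<close> on a closed set means there. It implies the second and third clauses, and it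
  holds whenever \<open>f\<close> is the restriction of a function that is \<open>C\<^sup>N\<close> on an open set containing \<open>X\<close>.\<close>

definition C_class_on :: "nat \<Rightarrow> 'a::euclidean_space set \<Rightarrow> ('a \<Rightarrow> real) \<Rightarrow> bool" where
  "C_class_on N X f \<longleftrightarrow>
     (\<exists>D :: ('a \<Rightarrow> nat) \<Rightarrow> 'a \<Rightarrow> real.
        (\<forall>x\<in>X. D (\<lambda>_. 0) x = f x) \<and>
        (\<forall>\<alpha>\<in>multi_indices N. continuous_on X (D \<alpha>)) \<and>
        (\<forall>\<alpha>\<in>multi_indices N. \<forall>e\<in>Basis. (\<Sum>i\<in>Basis. \<alpha> i) < N \<longrightarrow>
           has_partial_on (D \<alpha>) (D (\<alpha>(e := Suc (\<alpha> e)))) e X) \<and>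
        (\<forall>\<alpha>\<in>multi_indices N. \<forall>z\<in>X. \<forall>\<epsilon>>0. \<exists>\<delta>>0. \<forall>x\<in>X \<inter> ball z \<delta>. \<forall>y\<in>X \<inter> ball z \<delta>.
           \<bar>D \<alpha> y - (\<Sum>\<beta>\<in>multi_indices (N - (\<Sum>i\<in>Basis. \<alpha> i)).
               D (\<lambda>i. \<alpha> i + \<beta> i) x * (\<Prod>i\<in>Basis. ((y - x) \<bullet> i) ^ \<beta> i / fact (\<beta> i)))\<bar>
             \<le> \<epsilon> * norm (y - x) ^ (N - (\<Sum>i\<in>Basis. \<alpha> i))))"


section \<open>Scrambled net quadrature on product spaces\<close>

definition prod_region :: "('s \<Rightarrow> (real^'d::finite) set) \<Rightarrow> (real^'d^'s::finite) set" where
  "prod_region X = {x. \<forall>j. x $ j \<in> X j}"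

definition prod_map ::
  "nat \<Rightarrow> ('s \<Rightarrow> nat list \<Rightarrow> (real^'d::finite) set) \<Rightarrow> real^'s::finite \<Rightarrow> real^'d^'s" where
  "prod_map b cell u = (\<chi> j. split_map b (cell j) (u $ j))"

definition mu_hat ::
  "nat \<Rightarrow> ('s \<Rightarrow> nat list \<Rightarrow> (real^'d::finite) set) \<Rightarrow> (real^'d^'s::finite \<Rightarrow> real) \<Rightarrow>
   nat \<Rightarrow> (nat \<Rightarrow> 'w \<Rightarrow> real^'s) \<Rightarrow> 'w \<Rightarrow> real" where
  "mu_hat b cell f n u \<omega> = (1 / real n) * (\<Sum>i=1..n. f (prod_map b cell (u i \<omega>)))"

end

theory Submission
  imports Defs
begin

text \<open>
  Both smoothness classes enter only through one consequence: \<open>f\<close> is Lipschitz in the mixed sense, that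
  is, its mixed difference over any set \<open>u\<close> of components is at most \<open>L \<cdot> \<Prod>\<^sub>j\<^sub>\<in>\<^sub>u \<parallel>p\<^sub>j - q\<^sub>j\<parallel>\<close>. No extension of
  \<open>f\<close> beyond the region is needed for this.

  Replace every point by a representative of its product cell of level \<open>K\<close>, so that the integrand becomes
  a function \<open>g\<close> of \<open>s\<close> words of length \<open>K\<close>. The joint law of the scrambles of two points is a
  combination of tensor products of orthogonal projections \<open>T\<^sub>l\<close>, with the factors \<open>\<Upsilon>\<close> as coefficients,
  and summing over all pairs of points gives
  \<open>Var = n\<^sup>-\<^sup>1 \<Sum>\<^sub>l\<^sub>\<noteq>\<^sub>0 \<Gamma>\<^sub>l \<parallel>T\<^sub>l g\<parallel>\<^sup>2\<close>. The net property makes \<open>\<Gamma>\<^sub>l\<close> vanish for \<open>\<bar>l\<bar> \<le> m - t\<close>; the mixed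
  Lipschitz property and sphericity give \<open>\<parallel>T\<^sub>l g\<parallel>\<^sup>2 = O(b\<^bsup>-2\<bar>l\<bar>/d\<^esup>)\<close>. There are \<open>O(r\<^bsup>s-1\<^esup>)\<close> levels with \<open>\<bar>l\<bar> = r\<close>,
  so the sum over \<open>\<bar>l\<bar> > m - t\<close> is \<open>O(m\<^bsup>s-1\<^esup> b\<^bsup>-2m/d\<^esup>)\<close>, uniformly in \<open>K\<close>, and \<open>K\<close> tends to infinity.
\<close>


section \<open>Mixed differences\<close>


text \<open>A scrambled point involves infinitely many permutations, and its image is a limit of
  cells. At a finite level \<open>K\<close> only finitely many permutations matter and every
  expectation is a finite sum; the price is that no constant may depend on \<open>K\<close>.
  \<open>T\<^sub>l\<close> annihilates functions that ignore some component \<open>j\<close> with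
  \<open>l j > 0\<close>, so it sees only the mixed difference of \<open>g\<close> over those
  components. Its kernel couples words that share \<open>l j - 1\<close> letters, hence points of
  one cell of diameter O(b^(-(l j - 1)/d)). One difference per active component yields b^(-|l|/d),
  and squaring gives the 2/d of the rate. A level \<open>l\<close> encodes a pair of
  \<open>u\<close> and \<open>\<kappa>\<close>: \<open>l j = \<kappa> j + 1\<close> for j in
  \<open>u\<close>, and \<open>l j = 0\<close> otherwise. Second moments are taken about the mean
  over all word tuples, which bounds the variance whatever the expectation is.\<close>

definition mixed_diff :: "'i set \<Rightarrow> ('i \<Rightarrow> 'a) \<Rightarrow> ('i \<Rightarrow> 'a) \<Rightarrow> (('i \<Rightarrow> 'a) \<Rightarrow> real) \<Rightarrow> real" where
  "mixed_diff u p q g = (\<Sum>v\<in>Pow u. (-1) ^ card v * g (\<lambda>j. if j \<in> v then q j else p j))"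

lemma mixed_diff_empty [simp]: "mixed_diff {} p q g = g p"
  by (simp add: mixed_diff_def)

text \<open>Sorts the vertices of the box spanned by \<open>p\<close> and \<open>q\<close> by
  whether they use \<open>q j\<close>. This recursion drives the inductions on \<open>u\<close>
  below.\<close>

lemma mixed_diff_insert:
  assumes "finite u" "j \<notin> u"
  shows "mixed_diff (insert j u) p q g = mixed_diff u p q g - mixed_diff u (p(j := q j)) q g"
proof -
  have *: "(\<lambda>i. if i \<in> insert j v then q i else p i) = (\<lambda>i. if i \<in> v then q i else (p(j := q j)) i)" for v
    by auto
  have "mixed_diff (insert j u) p q g =
      (\<Sum>v\<in>Pow u. (-1) ^ card v * g (\<lambda>j. if j \<in> v then q j else p j))
      + (\<Sum>v\<in>insert j ` Pow u. (-1) ^ card v * g (\<lambda>j. if j \<in> v then q j else p j))"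
    unfolding mixed_diff_def Pow_insert
    by (rule sum.union_disjoint) (use assms in auto)
  also have "(\<Sum>v\<in>insert j ` Pow u. (-1) ^ card v * g (\<lambda>j. if j \<in> v then q j else p j))
      = (\<Sum>v\<in>Pow u. (-1) ^ card (insert j v) * g (\<lambda>i. if i \<in> insert j v then q i else p i))"
  proof -
    have "inj_on (insert j) (Pow u)" using assms by (auto simp: inj_on_def)
    then show ?thesis by (simp add: sum.reindex)
  qed
  also have "\<dots> = (\<Sum>v\<in>Pow u. - ((-1) ^ card v * g (\<lambda>i. if i \<in> v then q i else (p(j := q j)) i)))"
  proof (rule sum.cong[OF refl])
    fix v assume v: "v \<in> Pow u"
    then have "card (insert j v) = Suc (card v)"
      using assms by (metis PowD card_insert_disjoint finite_subset subsetD)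
    then show "(-1) ^ card (insert j v) * g (\<lambda>i. if i \<in> insert j v then q i else p i)
       = - ((-1) ^ card v * g (\<lambda>i. if i \<in> v then q i else (p(j := q j)) i))"
      by (simp only: *) simp
  qed
  finally show ?thesis by (simp add: mixed_diff_def sum_negf)
qed

lemma mixed_diff_cong:
  assumes "\<And>v. v \<subseteq> u \<Longrightarrow> g (\<lambda>j. if j \<in> v then q j else p j) = h (\<lambda>j. if j \<in> v then q' j else p' j)"
  shows "mixed_diff u p q g = mixed_diff u p' q' h"
  unfolding mixed_diff_def using assms by (intro sum.cong) auto

lemma mixed_diff_add: "mixed_diff u p q (\<lambda>z. g z + h z) = mixed_diff u p q g + mixed_diff u p q h"
  by (simp add: mixed_diff_def algebra_simps sum.distrib)

lemma mixed_diff_sum_mult: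
  "mixed_diff u p q (\<lambda>z. \<Sum>i\<in>I. g i z * c i) = (\<Sum>i\<in>I. mixed_diff u p q (g i) * c i)"
  unfolding mixed_diff_def sum_distrib_left sum_distrib_right
  by (subst sum.swap) (simp add: mult.assoc)

text \<open>A difference in a single component already annihilates constants. It allows the
  integrand to be centred without changing its mixed differences.\<close>

lemma mixed_diff_minus_const:
  assumes "finite u" "u \<noteq> {}"
  shows "mixed_diff u p q (\<lambda>z. g z - c) = mixed_diff u p q g"
proof -
  from assms obtain j u' where "u = insert j u'" "j \<notin> u'" "finite u'"
    by (metis all_not_in_conv finite_insert mk_disjoint_insert)
  moreover have "mixed_diff u p q (\<lambda>z. g z - c) = mixed_diff u p q g - mixed_diff u p q (\<lambda>z. c)" for u p q
    by (simp add: mixed_diff_def algebra_simps sum_subtractf)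
  moreover have "mixed_diff u' (p(j := q j)) q (\<lambda>z. c) = mixed_diff u' p q (\<lambda>z. c)"
    by (simp add: mixed_diff_def)
  ultimately show ?thesis by (simp add: mixed_diff_insert)
qed

text \<open>Expanding a difference in a component of \<open>u - w\<close> doubles the number of
  terms and leaves differences over \<open>w\<close> based at vertices of the box, hence the varying
  base point \<open>p'\<close>. It serves when only a part of \<open>u\<close> can still be
  differenced with profit.\<close>

lemma mixed_diff_le_pow:
  assumes "finite u" "w \<subseteq> u" "\<And>p'. (\<And>j. p' j \<in> {p j, q j}) \<Longrightarrow> \<bar>mixed_diff w p' q g\<bar> \<le> B"
  shows "\<bar>mixed_diff u p q g\<bar> \<le> 2 ^ card (u - w) * B"
proof -
  have "finite x \<Longrightarrow> x \<inter> w = {} \<Longrightarrow> (\<And>j. p' j \<in> {p j, q j}) \<Longrightarrow> \<bar>mixed_diff (x \<union> w) p' q g\<bar> \<le> 2 ^ card x * B" for x p'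
  proof (induction x arbitrary: p' rule: finite_induct)
    case empty
    then show ?case using assms(3) by simp
  next
    case (insert j x)
    have fin: "finite (x \<union> w)" using assms insert finite_subset by auto
    have j: "j \<notin> x \<union> w" using insert by auto
    have 1: "\<bar>mixed_diff (x \<union> w) p' q g\<bar> \<le> 2 ^ card x * B"
      using insert by auto
    have "(p'(j := q j)) i \<in> {p i, q i}" for i using insert.prems(2)[of i] by auto
    then have 2: "\<bar>mixed_diff (x \<union> w) (p'(j := q j)) q g\<bar> \<le> 2 ^ card x * B"
      using insert.prems by (intro insert.IH) blast+
    show ?case using 1 2 mixed_diff_insert[OF fin j, of p' q g] insert.hyps by simp
  qed
  from this[of "u - w" p] assms show ?thesis
    by (simp add: Diff_disjoint Int_commute Un_absorb2)
qed

lemma mixed_diff_bound: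
  assumes "finite u" "\<And>v. v \<subseteq> u \<Longrightarrow> \<bar>g (\<lambda>j. if j \<in> v then q j else p j)\<bar> \<le> B"
  shows "\<bar>mixed_diff u p q g\<bar> \<le> 2 ^ card u * B"
proof -
  have "\<bar>mixed_diff u p q g\<bar> \<le> (\<Sum>v\<in>Pow u. B)"
    unfolding mixed_diff_def
    by (rule order_trans[OF sum_abs], rule sum_mono) (use assms in \<open>auto simp: abs_mult power_abs\<close>)
  then show ?thesis using assms by (simp add: card_Pow)
qed

text \<open>For \<open>u = {}\<close> the product is empty and the bound says that \<open>f\<close>
  is at most \<open>L\<close> in absolute value. Points are functions of the component so that
  \<open>p(i := z)\<close> can vary one of them.\<close>

definition mixed_lipschitz :: "('s \<Rightarrow> (real^'d::finite) set) \<Rightarrow> (real^'d^'s::finite \<Rightarrow> real) \<Rightarrow> bool" where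
  "mixed_lipschitz X f \<longleftrightarrow> (\<exists>L\<ge>0. \<forall>u p q. (\<forall>j. p j \<in> X j) \<longrightarrow> (\<forall>j. q j \<in> X j) \<longrightarrow>
     \<bar>mixed_diff u p q (\<lambda>z. f (\<chi> j. z j))\<bar> \<le> L * (\<Prod>j\<in>u. dist (p j) (q j)))"


section \<open>Mixed Lipschitz bounds on Sobol' extensible regions\<close>

text \<open>\<open>has_partial_on\<close> only sees difference quotients between points of
  \<open>X\<close>, so the mean value inequality needs the whole segment in \<open>X\<close>.
  \<open>closed_segment 0 h\<close> covers both signs of \<open>h\<close>.\<close>

lemma partial_on_segment_bound:
  fixes x :: "'a::euclidean_space"
  assumes "has_partial_on \<psi> \<psi>' e X"
    and seg: "\<And>s. s \<in> closed_segment 0 h \<Longrightarrow> x + s *\<^sub>R e \<in> X"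
    and B: "\<And>z. z \<in> X \<Longrightarrow> \<bar>\<psi>' z\<bar> \<le> B"
  shows "\<bar>\<psi> (x + h *\<^sub>R e) - \<psi> x\<bar> \<le> B * \<bar>h\<bar>"
proof -
  have der: "((\<lambda>s. \<psi> (x + s *\<^sub>R e)) has_field_derivative \<psi>' (x + s *\<^sub>R e)) (at s within closed_segment 0 h)"
    if s: "s \<in> closed_segment 0 h" for s
  proof -
    let ?T = "{t. (x + s *\<^sub>R e) + t *\<^sub>R e \<in> X}"
    \<comment> \<open>The derivative is given at increment 0 from the point x + s e; composing with
      the shift \<open>r - s\<close> moves it to the parameter \<open>s\<close> of the
      segment.\<close>
    have 1: "((\<lambda>t. \<psi> ((x + s *\<^sub>R e) + t *\<^sub>R e)) has_field_derivative \<psi>' (x + s *\<^sub>R e)) (at ((\<lambda>r. r - s) s) within ?T)"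
      using assms(1) seg[OF s] unfolding has_partial_on_def by simp
    have sub: "(\<lambda>r. r - s) ` closed_segment 0 h \<subseteq> ?T"
    proof
      fix t assume "t \<in> (\<lambda>r. r - s) ` closed_segment 0 h"
      then obtain r where r: "r \<in> closed_segment 0 h" "t = r - s" by auto
      show "t \<in> ?T" using seg[OF r(1)] by (simp add: r(2) algebra_simps)
    qed
    have 2: "((\<lambda>r. r - s) has_field_derivative 1) (at s within closed_segment 0 h)"
      by (auto intro!: derivative_eq_intros)
    have "((\<lambda>t. \<psi> ((x + s *\<^sub>R e) + t *\<^sub>R e)) \<circ> (\<lambda>r. r - s) has_field_derivative \<psi>' (x + s *\<^sub>R e) * 1) (at s within closed_segment 0 h)"
      by (rule DERIV_image_chain[OF has_field_derivative_subset[OF 1 sub] 2])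
    moreover have "(\<lambda>t. \<psi> ((x + s *\<^sub>R e) + t *\<^sub>R e)) \<circ> (\<lambda>r. r - s) = (\<lambda>s. \<psi> (x + s *\<^sub>R e))"
      by (auto simp: fun_eq_iff algebra_simps)
    ultimately show ?thesis by simp
  qed
  have "norm (\<psi> (x + h *\<^sub>R e) - \<psi> (x + 0 *\<^sub>R e)) \<le> B * norm (h - 0)"
    by (rule field_differentiable_bound[of "closed_segment 0 h" "\<lambda>s. \<psi> (x + s *\<^sub>R e)", OF _ der])
       (use seg B in auto)
  then show ?thesis by simp
qed

text \<open>Walk from \<open>m\<close> to \<open>p\<close> along the axes. \<open>z A\<close> is the
  corner at which the coordinates in \<open>A\<close> have been moved, and every edge of the walk
  stays in \<open>rect m p\<close>.\<close>

lemma rect_bound: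
  fixes p m :: "'a::euclidean_space"
  assumes par: "\<And>e. e \<in> Basis \<Longrightarrow> has_partial_on \<psi> (\<psi>' e) e X"
    and sub: "rect m p \<subseteq> X"
    and B: "\<And>e z. e \<in> Basis \<Longrightarrow> z \<in> X \<Longrightarrow> \<bar>\<psi>' e z\<bar> \<le> B"
  shows "\<bar>\<psi> p - \<psi> m\<bar> \<le> B * (\<Sum>e\<in>Basis. \<bar>p \<bullet> e - m \<bullet> e\<bar>)"
proof -
  define z where "z A = (\<Sum>e\<in>Basis. (if e \<in> A then p \<bullet> e else m \<bullet> e) *\<^sub>R e)" for A :: "'a set"
  have zi: "z A \<bullet> e = (if e \<in> A then p \<bullet> e else m \<bullet> e)" if "e \<in> Basis" for A e
    using that unfolding z_def by simp
  have "finite A \<Longrightarrow> A \<subseteq> Basis \<Longrightarrow> \<bar>\<psi> (z A) - \<psi> m\<bar> \<le> B * (\<Sum>e\<in>A. \<bar>p \<bullet> e - m \<bullet> e\<bar>)" for A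
  proof (induction A rule: finite_induct)
    case empty
    have "z {} = m" by (rule euclidean_eqI) (simp add: zi)
    then show ?case by simp
  next
    case (insert e A)
    define h where "h = p \<bullet> e - m \<bullet> e"
    have e: "e \<in> Basis" using insert by auto
    have eq: "z (insert e A) = z A + h *\<^sub>R e"
      by (rule euclidean_eqI) (use e insert.hyps in \<open>auto simp: zi inner_simps inner_Basis h_def\<close>)
    have "z A + s *\<^sub>R e \<in> rect m p" if "s \<in> closed_segment 0 h" for s
    proof -
      have "(0 \<le> s \<and> s \<le> h) \<or> (h \<le> s \<and> s \<le> 0)"
        using that by (auto simp: closed_segment_eq_real_ivl split: if_splits)
      then have "min (m \<bullet> e) (p \<bullet> e) \<le> m \<bullet> e + s \<and> m \<bullet> e + s \<le> max (m \<bullet> e) (p \<bullet> e)"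
        unfolding h_def by (auto simp: min_def max_def)
      then show ?thesis
        unfolding rect_def using e insert.hyps by (auto simp: zi inner_simps inner_Basis)
    qed
    then have "\<bar>\<psi> (z (insert e A)) - \<psi> (z A)\<bar> \<le> B * \<bar>h\<bar>"
      unfolding eq using sub by (intro partial_on_segment_bound[OF par[OF e]]) (use B[OF e] in auto)
    then show ?case using insert by (simp add: h_def algebra_simps)
  qed
  from this[of Basis] have "\<bar>\<psi> (z Basis) - \<psi> m\<bar> \<le> B * (\<Sum>e\<in>Basis. \<bar>p \<bullet> e - m \<bullet> e\<bar>)" by simp
  moreover have "z Basis = p" by (rule euclidean_eqI) (simp add: zi)
  ultimately show ?thesis by simp
qed

text \<open>Two points \<open>p\<close>, \<open>q\<close> are joined inside \<open>X\<close> through their coordinatewise median with the anchor,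
  along a path of \<open>\<ell>\<^sup>1\<close>-length \<open>\<parallel>p - q\<parallel>\<^sub>1\<close>.\<close>

lemma anchored_lipschitz:
  fixes p q c :: "'a::euclidean_space"
  assumes par: "\<And>e. e \<in> Basis \<Longrightarrow> has_partial_on \<psi> (\<psi>' e) e X"
    and anchor: "\<And>z. z \<in> X \<Longrightarrow> rect c z \<subseteq> X"
    and B: "\<And>e z. e \<in> Basis \<Longrightarrow> z \<in> X \<Longrightarrow> \<bar>\<psi>' e z\<bar> \<le> B" "B \<ge> 0"
    and pq: "p \<in> X" "q \<in> X"
  shows "\<bar>\<psi> p - \<psi> q\<bar> \<le> B * (real DIM('a) * dist p q)"
proof -
  \<comment> \<open>The median of three numbers lies between any two of them: between
    \<open>c\<close> and \<open>p\<close> and between \<open>c\<close> and \<open>q\<close>, which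
    keeps both legs in \<open>X\<close>, and between \<open>p\<close> and \<open>q\<close>, which
    makes their lengths add up exactly.\<close>
  define med where "med e = max (min (p \<bullet> e) (q \<bullet> e)) (min (max (p \<bullet> e) (q \<bullet> e)) (c \<bullet> e))" for e
  define m where "m = (\<Sum>e\<in>Basis. med e *\<^sub>R e)"
  have mi: "m \<bullet> e = med e" if "e \<in> Basis" for e using that by (simp add: m_def)
  have sub: "rect m y \<subseteq> rect c y"
    if "\<And>e. e \<in> Basis \<Longrightarrow> min (c \<bullet> e) (y \<bullet> e) \<le> m \<bullet> e \<and> m \<bullet> e \<le> max (c \<bullet> e) (y \<bullet> e)" for y
  proof
    fix x assume "x \<in> rect m y"
    then show "x \<in> rect c y"
      unfolding rect_def using that by (fastforce simp: min_le_iff_disj le_max_iff_disj)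
  qed
  have "rect m p \<subseteq> rect c p" "rect m q \<subseteq> rect c q"
    by (rule sub; simp add: mi med_def; linarith)+
  then have "\<bar>\<psi> p - \<psi> m\<bar> \<le> B * (\<Sum>e\<in>Basis. \<bar>p \<bullet> e - m \<bullet> e\<bar>)" "\<bar>\<psi> q - \<psi> m\<bar> \<le> B * (\<Sum>e\<in>Basis. \<bar>q \<bullet> e - m \<bullet> e\<bar>)"
    using anchor pq B(1) by (intro rect_bound[OF par]; blast)+
  then have "\<bar>\<psi> p - \<psi> q\<bar> \<le> B * (\<Sum>e\<in>Basis. \<bar>p \<bullet> e - m \<bullet> e\<bar> + \<bar>q \<bullet> e - m \<bullet> e\<bar>)"
    by (simp add: sum.distrib distrib_left)
  also have "(\<Sum>e\<in>Basis. \<bar>p \<bullet> e - m \<bullet> e\<bar> + \<bar>q \<bullet> e - m \<bullet> e\<bar>) = (\<Sum>e\<in>Basis. \<bar>(p - q) \<bullet> e\<bar>)"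
  proof (rule sum.cong[OF refl])
    fix e :: 'a assume e: "e \<in> Basis"
    have "\<bar>x - max (min x y) (min (max x y) z)\<bar> + \<bar>y - max (min x y) (min (max x y) z)\<bar> = \<bar>x - y\<bar>" for x y z :: real
      by linarith
    then show "\<bar>p \<bullet> e - m \<bullet> e\<bar> + \<bar>q \<bullet> e - m \<bullet> e\<bar> = \<bar>(p - q) \<bullet> e\<bar>"
      unfolding mi[OF e] med_def inner_diff_left .
  qed
  also have "\<dots> \<le> (\<Sum>e\<in>(Basis::'a set). dist p q)"
    by (intro sum_mono) (auto simp: dist_norm Basis_le_norm)
  finally show ?thesis using B(2) by (simp add: mult_left_mono)
qed

lemma axis_in_Basis: "e \<in> Basis \<Longrightarrow> axis j e \<in> (Basis :: ('a::euclidean_space^'n::finite) set)"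
  by (auto simp: Basis_vec_def)

lemma in_prod_region [simp]: "(\<chi> j. z j) \<in> prod_region X \<longleftrightarrow> (\<forall>j. z j \<in> X j)"
  by (simp add: prod_region_def)

text \<open>Each difference is traded for one derivative in the same component. Since a component is
  differenced at most once, only the derivatives controlled by \<open>smooth\<close> occur, and
  these are bounded on the compact region.\<close>

lemma sobol_mixed_lipschitz:
  fixes X :: "'s::finite \<Rightarrow> (real^'d::finite) set"
  assumes sob: "sobol_extensible (prod_region X)" and sm: "smooth (prod_region X) f"
    and cpt: "compact (prod_region X)"
  shows "mixed_lipschitz X f"
proof -
  let ?R = "prod_region X"
  from sm obtain D where D: "\<forall>x\<in>?R. D {} x = f x" "\<forall>v\<subseteq>Basis. continuous_on ?R (D v)"
    "\<forall>v\<subseteq>Basis. \<forall>e\<in>Basis - v. has_partial_on (D v) (D (insert e v)) e ?R"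
    unfolding smooth_def by (elim exE conjE)
  have D0: "D {} x = f x" if "x \<in> ?R" for x using D(1) that by simp
  have cont: "continuous_on ?R (D v)" if "v \<subseteq> Basis" for v using D(2) that by simp
  have par: "has_partial_on (D v) (D (insert e v)) e ?R" if "v \<subseteq> Basis" "e \<in> Basis - v" for v e
    using D(3) that by simp
  from sob obtain c where c: "c \<in> ?R" "\<And>z. z \<in> ?R \<Longrightarrow> rect c z \<subseteq> ?R"
    unfolding sobol_extensible_def by blast
  \<comment> \<open>Slicing an anchored rectangle, with the other components kept at the anchor,
    shows that each factor \<open>X i\<close> is anchored at \<open>c $ i\<close>.\<close>
  have anchor: "rect (c $ i) z \<subseteq> X i" if z: "z \<in> X i" for i z
  proof
    fix x assume x: "x \<in> rect (c $ i) z"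
    let ?up = "\<lambda>y. \<chi> j. ((\<lambda>j. c $ j)(i := y)) j"
    have "?up z \<in> ?R" using z c(1) by (auto simp: prod_region_def)
    moreover have "?up x \<in> rect c (?up z)"
      using x by (auto simp: rect_def Basis_vec_def inner_axis)
    ultimately have "?up x \<in> ?R" using c(2) by blast
    then show "x \<in> X i" unfolding in_prod_region by (metis fun_upd_same)
  qed
  have "\<exists>B. \<forall>x\<in>?R. \<bar>D v x\<bar> \<le> B" if "v \<subseteq> Basis" for v
    using compact_imp_bounded[OF compact_continuous_image[OF cont[OF that] cpt]]
    unfolding bounded_iff by auto
  then obtain Bv where Bv: "\<And>v x. v \<subseteq> Basis \<Longrightarrow> x \<in> ?R \<Longrightarrow> \<bar>D v x\<bar> \<le> Bv v" by metis
  define B where "B = (\<Sum>v\<in>Pow Basis. \<bar>Bv v\<bar>)"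
  have B0: "B \<ge> 0" unfolding B_def by (simp add: sum_nonneg)
  have B: "\<bar>D v x\<bar> \<le> B" if "v \<subseteq> Basis" "x \<in> ?R" for v x
  proof -
    have "\<bar>D v x\<bar> \<le> \<bar>Bv v\<bar>" using Bv[OF that] by simp
    also have "\<dots> \<le> B" unfolding B_def using that by (intro member_le_sum) auto
    finally show ?thesis .
  qed
  \<comment> \<open>The set \<open>v\<close> of derivatives already taken is generalised and avoids
    all axes of the components in \<open>u\<close>. Each induction step adds one axis of a new
    component, so no coordinate is differentiated twice.\<close>
  have main: "finite u \<Longrightarrow> v \<subseteq> Basis \<Longrightarrow> (\<And>j e. j \<in> u \<Longrightarrow> axis j e \<notin> v) \<Longrightarrow> (\<And>j. p j \<in> X j) \<Longrightarrow> (\<And>j. q j \<in> X j) \<Longrightarrow>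
      \<bar>mixed_diff u p q (\<lambda>z. D v (\<chi> j. z j))\<bar> \<le> B * (\<Prod>j\<in>u. real CARD('d) * dist (p j) (q j))" for u v p q
  proof (induction u arbitrary: v p q rule: finite_induct)
    case empty
    then show ?case using B by simp
  next
    case (insert i u)
    let ?Bu = "B * (\<Prod>j\<in>u. real CARD('d) * dist (p j) (q j))"
    let ?\<psi> = "\<lambda>v z. mixed_diff u (p(i := z)) q (\<lambda>z. D v (\<chi> j. z j))"
    \<comment> \<open>The mixed difference over \<open>u\<close> is a finite signed sum in which
      component \<open>i\<close> stays free, as \<open>i\<close> is not in \<open>u\<close>; it is
      differentiated term by term.\<close>
    have par': "has_partial_on (?\<psi> v) (?\<psi> (insert (axis i e) v)) e (X i)" if e: "e \<in> Basis" for e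
      unfolding has_partial_on_def
    proof
      fix z assume z: "z \<in> X i"
      let ?T = "{h. z + h *\<^sub>R e \<in> X i}"
      have "((\<lambda>h. D v (\<chi> j. if j \<in> w then q j else (p(i := z + h *\<^sub>R e)) j)) has_real_derivative
            D (insert (axis i e) v) (\<chi> j. if j \<in> w then q j else (p(i := z)) j)) (at 0 within ?T)"
        if w: "w \<subseteq> u" for w
      proof -
        let ?x = "\<chi> j. if j \<in> w then q j else (p(i := z)) j"
        have eq: "(\<chi> j. if j \<in> w then q j else (p(i := z + h *\<^sub>R e)) j) = ?x + h *\<^sub>R axis i e" for h
          using w insert.hyps by (auto simp: vec_eq_iff axis_def)
        have x: "?x \<in> ?R" using z insert.prems by (auto simp: prod_region_def)
        have "{h. ?x + h *\<^sub>R axis i e \<in> ?R} = ?T"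
          unfolding eq[symmetric] using w insert.hyps insert.prems by (auto simp: prod_region_def split: if_splits)
        moreover have "axis i e \<in> Basis - v" using insert.prems e by (auto simp: axis_in_Basis)
        from bspec[OF par[OF insert.prems(1) this, unfolded has_partial_on_def] x]
        have "((\<lambda>h. D v (?x + h *\<^sub>R axis i e)) has_real_derivative D (insert (axis i e) v) ?x)
          (at 0 within {h. ?x + h *\<^sub>R axis i e \<in> ?R})" .
        ultimately show ?thesis unfolding eq by metis
      qed
      then show "((\<lambda>h. ?\<psi> v (z + h *\<^sub>R e)) has_real_derivative ?\<psi> (insert (axis i e) v) z) (at 0 within ?T)"
        unfolding mixed_diff_def
        by (intro DERIV_sum DERIV_cmult) auto
    qed
    have bd: "\<bar>?\<psi> (insert (axis i e) v) z\<bar> \<le> ?Bu" if "e \<in> Basis" "z \<in> X i" for e z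
    proof -
      have "\<bar>?\<psi> (insert (axis i e) v) z\<bar> \<le> B * (\<Prod>j\<in>u. real CARD('d) * dist ((p(i:=z)) j) (q j))"
      proof (rule insert.IH)
        fix j e' assume "j \<in> u"
        then have "j \<noteq> i" using insert.hyps by auto
        moreover have "e \<noteq> 0" using \<open>e \<in> Basis\<close> by auto
        ultimately show "axis j e' \<notin> insert (axis i e) v"
          using \<open>j \<in> u\<close> insert.prems(2)[of j e'] by (auto simp: axis_eq_axis)
      qed (use insert.prems that in \<open>auto simp: axis_in_Basis\<close>)
      also have "\<dots> = ?Bu" using insert.hyps by (intro arg_cong2[of _ _ _ _ "(*)"] prod.cong) auto
      finally show ?thesis .
    qed
    have "\<bar>?\<psi> v (p i) - ?\<psi> v (q i)\<bar> \<le> ?Bu * (real DIM(real^'d) * dist (p i) (q i))"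
      by (rule anchored_lipschitz[OF par' anchor bd]) (use insert.prems B0 in \<open>auto intro!: prod_nonneg mult_nonneg_nonneg\<close>)
    then show ?case
      using insert.hyps by (simp add: mixed_diff_insert mult_ac)
  qed
  \<comment> \<open>One factor \<open>CARD('d)\<close> per component, from comparing the l1 distance
    with the Euclidean one in \<open>anchored_lipschitz\<close>.\<close>
  let ?L = "B * real CARD('d) ^ CARD('s)"
  have "\<bar>mixed_diff u p q (\<lambda>z. f (\<chi> j. z j))\<bar> \<le> ?L * (\<Prod>j\<in>u. dist (p j) (q j))"
    if pq: "\<forall>j. p j \<in> X j" "\<forall>j. q j \<in> X j" for u p q
  proof -
    have "mixed_diff u p q (\<lambda>z. f (\<chi> j. z j)) = mixed_diff u p q (\<lambda>z. D {} (\<chi> j. z j))"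
      by (intro mixed_diff_cong) (use pq in \<open>auto intro!: D0[symmetric]\<close>)
    also have "\<bar>\<dots>\<bar> \<le> B * (\<Prod>j\<in>u. real CARD('d) * dist (p j) (q j))"
      using pq by (intro main) auto
    also have "\<dots> = B * real CARD('d) ^ card u * (\<Prod>j\<in>u. dist (p j) (q j))"
      by (simp add: prod.distrib mult_ac)
    also have "\<dots> \<le> ?L * (\<Prod>j\<in>u. dist (p j) (q j))"
      using B0 by (intro mult_right_mono mult_left_mono power_increasing prod_nonneg)
        (auto simp: card_mono Suc_leI)
    finally show ?thesis .
  qed
  then show ?thesis unfolding mixed_lipschitz_def using B0
    by (intro exI[of _ ?L]) auto
qed


section \<open>Mixed Lipschitz bounds from Whitney jets\<close>

lemma finite_multi_indices: "finite (multi_indices r :: ('a::euclidean_space \<Rightarrow> nat) set)"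
proof (rule finite_subset)
  show "(multi_indices r :: ('a \<Rightarrow> nat) set) \<subseteq> {\<alpha>. \<forall>e. (e \<in> Basis \<longrightarrow> \<alpha> e \<in> {..r}) \<and> (e \<notin> Basis \<longrightarrow> \<alpha> e = 0)}"
  proof
    fix \<alpha> :: "'a \<Rightarrow> nat" assume \<alpha>: "\<alpha> \<in> multi_indices r"
    have "\<alpha> e \<le> r" if "e \<in> Basis" for e
      using member_le_sum[of e Basis \<alpha>] that \<alpha> unfolding multi_indices_def by auto
    then show "\<alpha> \<in> {\<alpha>. \<forall>e. (e \<in> Basis \<longrightarrow> \<alpha> e \<in> {..r}) \<and> (e \<notin> Basis \<longrightarrow> \<alpha> e = 0)}"
      using \<alpha> by (auto simp: multi_indices_def)
  qed
  show "finite {\<alpha>. \<forall>e::'a. (e \<in> Basis \<longrightarrow> \<alpha> e \<in> {..r}) \<and> (e \<notin> Basis \<longrightarrow> \<alpha> e = (0::nat))}"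
    by (intro finite_set_of_finite_funs) auto
qed

lemma multi_indices_mono: "r \<le> N \<Longrightarrow> multi_indices r \<subseteq> multi_indices N"
  by (auto simp: multi_indices_def)

lemma multi_indices_add:
  "\<alpha> \<in> multi_indices N \<Longrightarrow> \<beta> \<in> multi_indices (N - (\<Sum>i\<in>Basis. \<alpha> i)) \<Longrightarrow> (\<lambda>i. \<alpha> i + \<beta> i) \<in> multi_indices N"
  by (auto simp: multi_indices_def sum.distrib)

lemma monomial_bound:
  fixes v :: "'a::euclidean_space" and \<beta> :: "'a \<Rightarrow> nat"
  shows "\<bar>\<Prod>i\<in>Basis. (v \<bullet> i) ^ \<beta> i / fact (\<beta> i)\<bar> \<le> norm v ^ (\<Sum>i\<in>Basis. \<beta> i)"
proof -
  have "\<bar>\<Prod>i\<in>Basis. (v \<bullet> i) ^ \<beta> i / fact (\<beta> i)\<bar> \<le> (\<Prod>i\<in>(Basis::'a set). norm v ^ \<beta> i)"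
    unfolding abs_prod
  proof (intro prod_mono conjI)
    fix i :: 'a assume i: "i \<in> Basis"
    have "\<bar>(v \<bullet> i) ^ \<beta> i / fact (\<beta> i)\<bar> \<le> \<bar>(v \<bullet> i) ^ \<beta> i\<bar> / 1"
      unfolding abs_divide by (intro divide_left_mono) auto
    also have "\<dots> \<le> norm v ^ \<beta> i"
      by (simp add: power_abs power_mono Basis_le_norm i)
    finally show "\<bar>(v \<bullet> i) ^ \<beta> i / fact (\<beta> i)\<bar> \<le> norm v ^ \<beta> i" .
  qed auto
  then show ?thesis by (simp add: power_sum)
qed

text \<open>Whitney's condition is local and of little-o type. Taken with epsilon 1, it gives a
  big-O remainder for all pairs closer than a Lebesgue number \<open>e\<close> of the resulting
  cover. For pairs further apart the remainder is bounded while |y - x|^r is at least e^r, so a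
  larger constant suffices.\<close>

lemma C_class_on_jets:
  fixes R :: "'a::euclidean_space set"
  assumes cls: "C_class_on N R f" and cpt: "compact R"
  obtains D A where "\<And>x. x \<in> R \<Longrightarrow> D (\<lambda>_. 0) x = f x" and "A \<ge> 0"
    and "\<And>\<alpha> x. \<alpha> \<in> multi_indices N \<Longrightarrow> x \<in> R \<Longrightarrow> \<bar>D \<alpha> x\<bar> \<le> A"
    and "\<And>\<alpha> x y. \<alpha> \<in> multi_indices N \<Longrightarrow> x \<in> R \<Longrightarrow> y \<in> R \<Longrightarrow>
       \<bar>D \<alpha> y - (\<Sum>\<beta>\<in>multi_indices (N - (\<Sum>i\<in>Basis. \<alpha> i)).
          D (\<lambda>i. \<alpha> i + \<beta> i) x * (\<Prod>i\<in>Basis. ((y - x) \<bullet> i) ^ \<beta> i / fact (\<beta> i)))\<bar>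
        \<le> A * norm (y - x) ^ (N - (\<Sum>i\<in>Basis. \<alpha> i))"
proof -
  define T where "T D \<alpha> x y = D \<alpha> y - (\<Sum>\<beta>\<in>multi_indices (N - (\<Sum>i\<in>Basis. \<alpha> i)).
          D (\<lambda>i. \<alpha> i + \<beta> i) x * (\<Prod>i\<in>Basis. ((y - x) \<bullet> i) ^ \<beta> i / fact (\<beta> i)))"
    for D :: "('a \<Rightarrow> nat) \<Rightarrow> 'a \<Rightarrow> real" and \<alpha> x y
  from cls obtain D where D: "\<forall>x\<in>R. D (\<lambda>_. 0) x = f x" "\<forall>\<alpha>\<in>multi_indices N. continuous_on R (D \<alpha>)"
    "\<forall>\<alpha>\<in>multi_indices N. \<forall>z\<in>R. \<forall>\<epsilon>>0. \<exists>\<delta>>0. \<forall>x\<in>R \<inter> ball z \<delta>. \<forall>y\<in>R \<inter> ball z \<delta>.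
           \<bar>T D \<alpha> x y\<bar> \<le> \<epsilon> * norm (y - x) ^ (N - (\<Sum>i\<in>Basis. \<alpha> i))"
    unfolding C_class_on_def T_def by (elim exE conjE)
  have "\<exists>B. \<forall>x\<in>R. \<bar>D \<alpha> x\<bar> \<le> B" if "\<alpha> \<in> multi_indices N" for \<alpha>
    using compact_imp_bounded[OF compact_continuous_image[OF bspec[OF D(2) that] cpt]]
    unfolding bounded_iff by auto
  then obtain Bv where Bv: "\<And>\<alpha> x. \<alpha> \<in> multi_indices N \<Longrightarrow> x \<in> R \<Longrightarrow> \<bar>D \<alpha> x\<bar> \<le> Bv \<alpha>" by metis
  define B where "B = (\<Sum>\<alpha>\<in>multi_indices N. \<bar>Bv \<alpha>\<bar>)"
  have B0: "B \<ge> 0" unfolding B_def by (simp add: sum_nonneg)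
  have B: "\<bar>D \<alpha> x\<bar> \<le> B" if "\<alpha> \<in> multi_indices N" "x \<in> R" for \<alpha> x
  proof -
    have "\<bar>D \<alpha> x\<bar> \<le> \<bar>Bv \<alpha>\<bar>" using Bv[OF that] by simp
    also have "\<dots> \<le> B" unfolding B_def using that finite_multi_indices by (intro member_le_sum) auto
    finally show ?thesis .
  qed
  obtain H where H: "H \<ge> 1" "\<And>x y. x \<in> R \<Longrightarrow> y \<in> R \<Longrightarrow> norm (y - x) \<le> H"
  proof -
    have "norm (y - x) \<le> max 1 (diameter R)" if "x \<in> R" "y \<in> R" for x y
      using diameter_bounded_bound[OF compact_imp_bounded[OF cpt] that(2,1)] by (simp add: dist_norm)
    then show ?thesis by (intro that[of "max 1 (diameter R)"]) auto
  qed
  \<comment> \<open>Crude bound for any Taylor remainder: the value itself plus all terms of the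
    expansion, whose monomials are at most \<open>H ^ N\<close> because
    \<open>H \<ge> 1\<close>.\<close>
  define Q where "Q = B + real (card (multi_indices N :: ('a \<Rightarrow> nat) set)) * (B * H ^ N)"
  have Q0: "Q \<ge> 0" unfolding Q_def using B0 H by auto
  have "\<exists>A\<ge>0. \<forall>x\<in>R. \<forall>y\<in>R. \<bar>T D \<alpha> x y\<bar> \<le> A * norm (y - x) ^ (N - (\<Sum>i\<in>Basis. \<alpha> i))"
    if \<alpha>: "\<alpha> \<in> multi_indices N" for \<alpha>
  proof -
    let ?r = "N - (\<Sum>i\<in>Basis. \<alpha> i)"
    have "\<exists>\<delta>>0. \<forall>x\<in>R \<inter> ball z \<delta>. \<forall>y\<in>R \<inter> ball z \<delta>. \<bar>T D \<alpha> x y\<bar> \<le> 1 * norm (y - x) ^ ?r" if "z \<in> R" for z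
      using D(3) \<alpha> that zero_less_one by blast
    then obtain \<delta> where \<delta>: "\<And>z. z \<in> R \<Longrightarrow> \<delta> z > 0"
       "\<And>z x y. z \<in> R \<Longrightarrow> x \<in> R \<inter> ball z (\<delta> z) \<Longrightarrow> y \<in> R \<inter> ball z (\<delta> z) \<Longrightarrow> \<bar>T D \<alpha> x y\<bar> \<le> 1 * norm (y - x) ^ ?r"
      by metis
    have cov: "R \<subseteq> \<Union>((\<lambda>z. ball z (\<delta> z)) ` R)" using \<delta>(1) by auto
    obtain e where e: "e > 0" "\<And>x. x \<in> R \<Longrightarrow> \<exists>G\<in>(\<lambda>z. ball z (\<delta> z)) ` R. ball x e \<subseteq> G"
      by (rule Heine_Borel_lemma[OF cpt cov]) (auto simp: image_def)
    have "\<bar>T D \<alpha> x y\<bar> \<le> (1 + Q / e ^ ?r) * norm (y - x) ^ ?r" if xy: "x \<in> R" "y \<in> R" for x y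
    proof (cases "dist x y < e")
      case True
      from e(2)[OF xy(1)] obtain z where z: "z \<in> R" "ball x e \<subseteq> ball z (\<delta> z)" by auto
      have "\<bar>T D \<alpha> x y\<bar> \<le> 1 * norm (y - x) ^ ?r"
      proof (rule \<delta>(2)[OF z(1)])
        show "x \<in> R \<inter> ball z (\<delta> z)" using xy(1) z(2) e(1) by (meson IntI centre_in_ball subsetD)
        show "y \<in> R \<inter> ball z (\<delta> z)" using xy(2) z(2) True by (meson IntI mem_ball subsetD)
      qed
      also have "\<dots> \<le> (1 + Q / e ^ ?r) * norm (y - x) ^ ?r"
        using Q0 e(1) by (intro mult_right_mono) auto
      finally show ?thesis .
    next
      case False
      have "\<bar>\<Sum>\<beta>\<in>multi_indices ?r. D (\<lambda>i. \<alpha> i + \<beta> i) x * (\<Prod>i\<in>Basis. ((y - x) \<bullet> i) ^ \<beta> i / fact (\<beta> i))\<bar>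
         \<le> (\<Sum>\<beta>\<in>(multi_indices ?r :: ('a \<Rightarrow> nat) set). B * H ^ N)"
      proof (rule order_trans[OF sum_abs], rule sum_mono)
        fix \<beta> :: "'a \<Rightarrow> nat" assume \<beta>: "\<beta> \<in> multi_indices ?r"
        have "\<bar>\<Prod>i\<in>Basis. ((y - x) \<bullet> i) ^ \<beta> i / fact (\<beta> i)\<bar> \<le> norm (y - x) ^ (\<Sum>i\<in>Basis. \<beta> i)"
          by (rule monomial_bound)
        also have "\<dots> \<le> H ^ (\<Sum>i\<in>Basis. \<beta> i)" using H(2)[OF xy] by (intro power_mono) auto
        also have "\<dots> \<le> H ^ N" using \<beta> H(1) by (intro power_increasing) (auto simp: multi_indices_def)
        finally show "\<bar>D (\<lambda>i. \<alpha> i + \<beta> i) x * (\<Prod>i\<in>Basis. ((y - x) \<bullet> i) ^ \<beta> i / fact (\<beta> i))\<bar> \<le> B * H ^ N"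
          unfolding abs_mult using B[OF multi_indices_add[OF \<alpha> \<beta>] xy(1)] B0
          by (intro mult_mono) auto
      qed
      also have "\<dots> \<le> real (card (multi_indices N :: ('a \<Rightarrow> nat) set)) * (B * H ^ N)"
        using B0 H(1) by (auto intro!: mult_right_mono card_mono finite_multi_indices multi_indices_mono)
      finally have "\<bar>T D \<alpha> x y\<bar> \<le> Q"
        using B[OF \<alpha> xy(2)] unfolding T_def Q_def by linarith
      also have "Q \<le> Q / e ^ ?r * norm (y - x) ^ ?r"
      proof -
        have "e ^ ?r \<le> norm (y - x) ^ ?r" using False e(1) by (intro power_mono) (auto simp: dist_norm norm_minus_commute)
        then show ?thesis using Q0 e(1) by (simp add: field_simps mult_left_mono)
      qed
      also have "\<dots> \<le> (1 + Q / e ^ ?r) * norm (y - x) ^ ?r" by (intro mult_right_mono) auto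
      finally show ?thesis .
    qed
    moreover have "1 + Q / e ^ ?r \<ge> 0" using Q0 e(1) by simp
    ultimately show ?thesis by blast
  qed
  then obtain Av where Av: "\<And>\<alpha>. \<alpha> \<in> multi_indices N \<Longrightarrow> Av \<alpha> \<ge> 0"
    "\<And>\<alpha> x y. \<alpha> \<in> multi_indices N \<Longrightarrow> x \<in> R \<Longrightarrow> y \<in> R \<Longrightarrow> \<bar>T D \<alpha> x y\<bar> \<le> Av \<alpha> * norm (y - x) ^ (N - (\<Sum>i\<in>Basis. \<alpha> i))"
    by metis
  define A where "A = B + (\<Sum>\<alpha>\<in>multi_indices N. Av \<alpha>)"
  have AvA: "Av \<alpha> \<le> A" if "\<alpha> \<in> multi_indices N" for \<alpha>
    using member_le_sum[of \<alpha> "multi_indices N" Av] that Av(1) finite_multi_indices B0 unfolding A_def by fastforce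
  have A0: "B \<le> A" unfolding A_def using Av(1) by (simp add: sum_nonneg)
  show ?thesis
  proof (rule that[of D A])
    show "A \<ge> 0" using A0 B0 by simp
    show "\<bar>D \<alpha> x\<bar> \<le> A" if "\<alpha> \<in> multi_indices N" "x \<in> R" for \<alpha> x using B[OF that] A0 by simp
    show "\<bar>D \<alpha> y - (\<Sum>\<beta>\<in>multi_indices (N - (\<Sum>i\<in>Basis. \<alpha> i)).
          D (\<lambda>i. \<alpha> i + \<beta> i) x * (\<Prod>i\<in>Basis. ((y - x) \<bullet> i) ^ \<beta> i / fact (\<beta> i)))\<bar>
        \<le> A * norm (y - x) ^ (N - (\<Sum>i\<in>Basis. \<alpha> i))"
      if "\<alpha> \<in> multi_indices N" "x \<in> R" "y \<in> R" for \<alpha> x y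
      using Av(2)[OF that] mult_right_mono[OF AvA[OF that(1)], of "norm (y - x) ^ (N - (\<Sum>i\<in>Basis. \<alpha> i))"]
      unfolding T_def by simp
  qed (use D(1) in auto)
qed

lemma norm_axis_vec: "norm (axis i (x::'a::euclidean_space) :: 'a^'n::finite) = norm x"
  by (simp add: norm_eq_sqrt_inner inner_axis_axis)

text \<open>The Taylor expansion is taken in the component \<open>i\<close> of smallest increment \<open>d\<^sub>i\<close>: a term of order \<open>l\<close>
  has only \<open>N - \<bar>\<alpha>\<bar> - l\<close> further derivatives, but it carries a factor \<open>d\<^sub>i\<^sup>l\<close>, which pays for the components
  that can no longer be differenced, and for the remainder.\<close>

lemma whitney_mixed_lipschitz:
  fixes X :: "'s::finite \<Rightarrow> (real^'d::finite) set"
  assumes cls: "C_class_on N (prod_region X) f" and N: "CARD('s) \<le> N"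
    and cpt: "compact (prod_region X)"
  shows "mixed_lipschitz X f"
proof -
  let ?R = "prod_region X"
  let ?S = "CARD('s)"
  let ?I = "multi_indices :: nat \<Rightarrow> (real^'d^'s \<Rightarrow> nat) set"
  define sz where "sz \<alpha> = (\<Sum>i\<in>(Basis :: (real^'d^'s) set). \<alpha> i)" for \<alpha> :: "real^'d^'s \<Rightarrow> nat"
  obtain D A where D0: "\<And>x. x \<in> ?R \<Longrightarrow> D (\<lambda>_. 0) x = f x" and A0: "A \<ge> 0"
    and DA: "\<And>\<alpha> x. \<alpha> \<in> ?I N \<Longrightarrow> x \<in> ?R \<Longrightarrow> \<bar>D \<alpha> x\<bar> \<le> A"
    and Taylor: "\<And>\<alpha> x y. \<alpha> \<in> ?I N \<Longrightarrow> x \<in> ?R \<Longrightarrow> y \<in> ?R \<Longrightarrow>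
       \<bar>D \<alpha> y - (\<Sum>\<beta>\<in>?I (N - sz \<alpha>).
          D (\<lambda>i. \<alpha> i + \<beta> i) x * (\<Prod>i\<in>Basis. ((y - x) \<bullet> i) ^ \<beta> i / fact (\<beta> i)))\<bar>
        \<le> A * norm (y - x) ^ (N - sz \<alpha>)"
    using C_class_on_jets[OF cls cpt] unfolding sz_def by blast
  obtain H where H: "H \<ge> 1" "\<And>p q j. (\<And>j. p j \<in> X j) \<Longrightarrow> (\<And>j. q j \<in> X j) \<Longrightarrow> dist (p j) (q j) \<le> H"
  proof -
    have "dist (p j) (q j) \<le> max 1 (diameter ?R)" if "\<And>j. p j \<in> X j" "\<And>j. q j \<in> X j" for p q j
    proof -
      have "dist (p j) (q j) = dist ((\<chi> j. p j) $ j) ((\<chi> j. q j) $ j)" by simp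
      also have "\<dots> \<le> dist (\<chi> j. p j) (\<chi> j. q j)" by (rule dist_vec_nth_le)
      also have "\<dots> \<le> diameter ?R"
        using that by (intro diameter_bounded_bound compact_imp_bounded[OF cpt]) auto
      finally show ?thesis by simp
    qed
    then show ?thesis by (intro that[of "max 1 (diameter ?R)"]) auto
  qed
  \<comment> \<open>As \<open>d i\<close> is the smallest increment, one power of it can stand in
    for each component of \<open>u - w\<close>; the surplus powers are absorbed by
    \<open>H ^ N\<close>.\<close>
  have pw: "d i ^ n * (\<Prod>j\<in>w. d j) \<le> H ^ N * (\<Prod>j\<in>u. d j)"
    if w: "w \<subseteq> u" and n: "card u - card w \<le> n" "n \<le> N" and d: "\<And>j. j \<in> u \<Longrightarrow> d i \<le> d j" and d0: "\<And>j. 0 \<le> d j" "d i \<le> H"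
    for d :: "'s \<Rightarrow> real" and u w i n
  proof -
    let ?k = "card (u - w)"
    have k: "?k \<le> n" using card_Diff_subset[of w u] w n by simp
    have "d i ^ n = d i ^ ?k * d i ^ (n - ?k)" using k by (simp add: power_add[symmetric])
    also have "\<dots> \<le> (\<Prod>j\<in>u - w. d j) * H ^ N"
    proof (intro mult_mono)
      have "(\<Prod>j\<in>u - w. d i) \<le> (\<Prod>j\<in>u - w. d j)" using d d0 by (intro prod_mono) auto
      then show "d i ^ ?k \<le> (\<Prod>j\<in>u - w. d j)" by simp
      have "d i ^ (n - ?k) \<le> H ^ (n - ?k)" using d0 by (intro power_mono) auto
      also have "\<dots> \<le> H ^ N" using n H(1) by (intro power_increasing) auto
      finally show "d i ^ (n - ?k) \<le> H ^ N" .
    qed (use d0 H in \<open>auto intro!: prod_nonneg\<close>)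
    finally have "d i ^ n * (\<Prod>j\<in>w. d j) \<le> ((\<Prod>j\<in>u - w. d j) * H ^ N) * (\<Prod>j\<in>w. d j)"
      using d0 by (intro mult_right_mono prod_nonneg) auto
    also have "\<dots> = H ^ N * (\<Prod>j\<in>u. d j)"
      using prod.subset_diff[OF w, of d] by simp
    finally show ?thesis .
  qed
  \<comment> \<open>Induction on the number of differenced components, uniformly in the multi-index.
    The condition \<open>card u \<le> N - sz \<alpha>\<close> says that one order of smoothness is
    left for each component.\<close>
  have main: "\<exists>L\<ge>0. \<forall>u \<alpha> p q. card u \<le> k \<longrightarrow> \<alpha> \<in> ?I N \<longrightarrow> card u \<le> N - sz \<alpha> \<longrightarrow>
     (\<forall>j. p j \<in> X j) \<longrightarrow> (\<forall>j. q j \<in> X j) \<longrightarrow>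
     \<bar>mixed_diff u p q (\<lambda>z. D \<alpha> (\<chi> j. z j))\<bar> \<le> L * (\<Prod>j\<in>u. dist (p j) (q j))" for k
  proof (induction k)
    case 0
    show ?case using A0 DA by (intro exI[of _ A]) (auto simp: card_eq_0_iff)
  next
    case (Suc k)
    then obtain L where L0: "L \<ge> 0" and L: "\<And>u \<alpha> p q. card u \<le> k \<Longrightarrow> \<alpha> \<in> ?I N \<Longrightarrow> card u \<le> N - sz \<alpha> \<Longrightarrow>
       (\<And>j. p j \<in> X j) \<Longrightarrow> (\<And>j. q j \<in> X j) \<Longrightarrow>
       \<bar>mixed_diff u p q (\<lambda>z. D \<alpha> (\<chi> j. z j))\<bar> \<le> L * (\<Prod>j\<in>u. dist (p j) (q j))" by blast
    \<comment> \<open>The three contributions: smaller sets, Taylor terms of positive order, and the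
      remainder.\<close>
    define L' where "L' = L + (real (card (?I N)) * (2 ^ ?S * L * H ^ N) + 2 ^ ?S * A * H ^ N)"
    have LL': "L \<le> L'" unfolding L'_def using L0 A0 H by simp
    have "\<bar>mixed_diff u p q (\<lambda>z. D \<alpha> (\<chi> j. z j))\<bar> \<le> L' * (\<Prod>j\<in>u. dist (p j) (q j))"
      if cu: "card u \<le> Suc k" and \<alpha>: "\<alpha> \<in> ?I N" and cr: "card u \<le> N - sz \<alpha>" and pX: "\<And>j. p j \<in> X j" and qX: "\<And>j. q j \<in> X j"
      for u \<alpha> p q
    proof (cases "card u \<le> k")
      case True
      have "\<bar>mixed_diff u p q (\<lambda>z. D \<alpha> (\<chi> j. z j))\<bar> \<le> L * (\<Prod>j\<in>u. dist (p j) (q j))"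
        by (rule L[OF True \<alpha> cr pX qX])
      also have "\<dots> \<le> L' * (\<Prod>j\<in>u. dist (p j) (q j))"
        by (intro mult_right_mono LL' prod_nonneg) auto
      finally show ?thesis .
    next
      case False
      define d where "d j = dist (p j) (q j)" for j
      let ?P = "\<Prod>j\<in>u. d j"
      define r where "r = N - sz \<alpha>"
      have "u \<noteq> {}" using False by auto
      then obtain i where i: "i \<in> u" "\<And>j. j \<in> u \<Longrightarrow> d i \<le> d j"
        using arg_min_if_finite[of u d] by (metis finite not_le)
      define u' where "u' = u - {i}"
      have u: "u = insert i u'" "i \<notin> u'" using i by (auto simp: u'_def)
      have cu': "card u = Suc (card u')" "card u' \<le> k" using u cu by auto
      have P0: "?P \<ge> 0" by (intro prod_nonneg) (simp add: d_def)
      have dH: "d i \<le> H" "\<And>j. 0 \<le> d j" unfolding d_def using H(2)[OF pX qX] by auto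
      let ?p = "p(i := q i)"
      have pX': "\<And>j. ?p j \<in> X j" using pX qX by auto
      define \<Delta> where "\<Delta> = (axis i (p i - q i) :: real^'d^'s)"
      define c where "c \<beta> = (\<Prod>e\<in>Basis. (\<Delta> \<bullet> e) ^ \<beta> e / fact (\<beta> e))" for \<beta> :: "real^'d^'s \<Rightarrow> nat"
      have c: "\<bar>c \<beta>\<bar> \<le> d i ^ sz \<beta>" for \<beta>
        using monomial_bound[of \<Delta> \<beta>] unfolding c_def sz_def d_def \<Delta>_def by (simp add: norm_axis_vec dist_norm)
      \<comment> \<open>The expansion is based at the point whose component \<open>i\<close> is
        moved to \<open>q i\<close>. The increment \<open>\<Delta>\<close> lives in component
        \<open>i\<close> alone, so the monomials \<open>c \<beta>\<close> are constants for the
        differences over \<open>u'\<close>.\<close>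
      define E where "E \<beta> z = D (\<lambda>e. \<alpha> e + \<beta> e) (\<chi> j. (z(i := q i)) j)" for \<beta> and z :: "'s \<Rightarrow> real^'d"
      define Rm where "Rm z = D \<alpha> (\<chi> j. z j) - (\<Sum>\<beta>\<in>?I r. E \<beta> z * c \<beta>)" for z :: "'s \<Rightarrow> real^'d"
      have z0: "(\<lambda>_. 0) \<in> ?I r" by (simp add: multi_indices_def)
      have "mixed_diff u' p q (\<lambda>z. D \<alpha> (\<chi> j. z j)) = mixed_diff u' p q (\<lambda>z. (\<Sum>\<beta>\<in>?I r. E \<beta> z * c \<beta>) + Rm z)"
        by (intro mixed_diff_cong) (simp add: Rm_def)
      also have "\<dots> = (\<Sum>\<beta>\<in>?I r. mixed_diff u' p q (E \<beta>) * c \<beta>) + mixed_diff u' p q Rm"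
        by (simp add: mixed_diff_add mixed_diff_sum_mult)
      also have "(\<Sum>\<beta>\<in>?I r. mixed_diff u' p q (E \<beta>) * c \<beta>) = (\<Sum>\<beta>\<in>?I r. mixed_diff u' ?p q (\<lambda>z. D (\<lambda>e. \<alpha> e + \<beta> e) (\<chi> j. z j)) * c \<beta>)"
      proof (intro sum.cong refl arg_cong2[of _ _ _ _ "(*)"] mixed_diff_cong)
        fix \<beta> v assume "v \<subseteq> u'"
        then have "(\<lambda>j. if j \<in> v then q j else p j)(i := q i) = (\<lambda>j. if j \<in> v then q j else ?p j)"
          using u(2) by auto
        then show "E \<beta> (\<lambda>j. if j \<in> v then q j else p j) = D (\<lambda>e. \<alpha> e + \<beta> e) (\<chi> j. (if j \<in> v then q j else ?p j))"
          unfolding E_def by simp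
      qed
      \<comment> \<open>The term of order zero is exactly what \<open>mixed_diff_insert\<close>
        subtracts, so it cancels in the difference over \<open>u\<close>.\<close>
      also have "\<dots> = mixed_diff u' ?p q (\<lambda>z. D \<alpha> (\<chi> j. z j)) + (\<Sum>\<beta>\<in>?I r - {\<lambda>_. 0}. mixed_diff u' ?p q (\<lambda>z. D (\<lambda>e. \<alpha> e + \<beta> e) (\<chi> j. z j)) * c \<beta>)"
        by (subst sum.remove[OF finite_multi_indices z0]) (simp add: c_def)
      finally have eq: "mixed_diff u p q (\<lambda>z. D \<alpha> (\<chi> j. z j)) =
          (\<Sum>\<beta>\<in>?I r - {\<lambda>_. 0}. mixed_diff u' ?p q (\<lambda>z. D (\<lambda>e. \<alpha> e + \<beta> e) (\<chi> j. z j)) * c \<beta>) + mixed_diff u' p q Rm"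
        unfolding u(1) using u(2) by (simp add: mixed_diff_insert)
      have rem: "\<bar>mixed_diff u' p q Rm\<bar> \<le> 2 ^ ?S * A * H ^ N * ?P"
      proof -
        have "\<bar>mixed_diff u' p q Rm\<bar> \<le> 2 ^ card u' * (A * d i ^ r)"
        proof (rule mixed_diff_bound)
          fix v assume v: "v \<subseteq> u'"
          let ?z = "\<lambda>j. if j \<in> v then q j else p j"
          let ?y = "\<chi> j. ?z j" and ?x = "\<chi> j. (?z(i := q i)) j"
          have diff: "?y - ?x = \<Delta>" using v u(2) by (auto simp: vec_eq_iff \<Delta>_def axis_def)
          have norm: "norm \<Delta> = d i" by (simp add: \<Delta>_def norm_axis_vec dist_norm d_def)
          have "?x \<in> ?R" "?y \<in> ?R" using pX qX by auto
          from Taylor[OF \<alpha> this] show "\<bar>Rm ?z\<bar> \<le> A * d i ^ r"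
            unfolding Rm_def E_def c_def r_def diff norm .
        qed simp
        also have "\<dots> \<le> 2 ^ ?S * (A * (H ^ N * ?P))"
          using pw[of "{}" u r d i] cr dH i(2) A0 H(1) P0 unfolding r_def
          by (intro mult_mono power_increasing mult_left_mono) (auto simp: card_mono)
        finally show ?thesis by (simp add: mult_ac)
      qed
      have tm: "\<bar>mixed_diff u' ?p q (\<lambda>z. D (\<lambda>e. \<alpha> e + \<beta> e) (\<chi> j. z j)) * c \<beta>\<bar> \<le> 2 ^ ?S * L * H ^ N * ?P"
        if \<beta>: "\<beta> \<in> ?I r - {\<lambda>_. 0}" for \<beta>
      proof -
        let ?g = "\<lambda>z. D (\<lambda>e. \<alpha> e + \<beta> e) (\<chi> j. z j)"
        define l where "l = sz \<beta>"
        have \<beta>I: "\<beta> \<in> ?I (N - (\<Sum>i\<in>Basis. \<alpha> i))" using \<beta> unfolding r_def sz_def by simp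
        have ab: "(\<lambda>e. \<alpha> e + \<beta> e) \<in> ?I N" by (rule multi_indices_add[OF \<alpha> \<beta>I])
        have lr: "l \<le> r" using \<beta> unfolding l_def sz_def by (auto simp: multi_indices_def)
        have l1: "1 \<le> l"
        proof (rule ccontr)
          assume "\<not> 1 \<le> l"
          then have "(\<Sum>e\<in>Basis. \<beta> e) = 0" unfolding l_def sz_def by linarith
          then have "\<forall>e\<in>Basis. \<beta> e = 0" by simp
          moreover have "\<forall>e. e \<notin> Basis \<longrightarrow> \<beta> e = 0" using \<beta> by (auto simp: multi_indices_def)
          ultimately have "\<beta> = (\<lambda>_. 0)" by (metis ext)
          then show False using \<beta> by simp
        qed
        have sab: "sz (\<lambda>e. \<alpha> e + \<beta> e) = sz \<alpha> + l" unfolding sz_def l_def by (simp add: sum.distrib)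
        \<comment> \<open>Keep as many components of \<open>u'\<close> as the remaining order
          \<open>r - l\<close> permits. The others are expanded at the cost of powers of 2, and
          their increments are recovered from \<open>d i ^ l\<close>.\<close>
        obtain w where w: "w \<subseteq> u'" "card w = min (card u') (r - l)"
          using obtain_subset_with_card_n[of "min (card u') (r - l)" u'] by auto
        have "\<bar>mixed_diff u' ?p q ?g\<bar> \<le> 2 ^ card (u' - w) * (L * (\<Prod>j\<in>w. d j))"
        proof (rule mixed_diff_le_pow[OF _ w(1)])
          fix p' assume p': "\<And>j. p' j \<in> {?p j, q j}"
          have p'X: "p' j \<in> X j" for j using p'[of j] pX' qX by auto
          have "\<bar>mixed_diff w p' q ?g\<bar> \<le> L * (\<Prod>j\<in>w. dist (p' j) (q j))"
            using w(2) cu' sab by (intro L ab p'X qX) (auto simp: r_def)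
          also have "\<dots> \<le> L * (\<Prod>j\<in>w. d j)"
          proof (intro mult_left_mono L0 prod_mono conjI)
            fix j assume "j \<in> w"
            then have "j \<noteq> i" using w(1) u(2) by auto
            then show "dist (p' j) (q j) \<le> d j" using p'[of j] by (auto simp: d_def)
          qed auto
          finally show "\<bar>mixed_diff w p' q ?g\<bar> \<le> L * (\<Prod>j\<in>w. d j)" .
        qed simp
        also have "\<dots> \<le> 2 ^ ?S * (L * (\<Prod>j\<in>w. d j))"
          using L0 dH(2) by (intro mult_right_mono power_increasing mult_nonneg_nonneg prod_nonneg) (auto simp: card_mono)
        finally have "\<bar>mixed_diff u' ?p q ?g * c \<beta>\<bar> \<le> 2 ^ ?S * (L * (\<Prod>j\<in>w. d j)) * d i ^ l"
          unfolding abs_mult using c[of \<beta>] L0 dH(2) unfolding l_def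
          by (intro mult_mono) (auto intro!: mult_nonneg_nonneg prod_nonneg)
        also have "\<dots> = 2 ^ ?S * L * (d i ^ l * (\<Prod>j\<in>w. d j))" by simp
        also have "\<dots> \<le> 2 ^ ?S * L * (H ^ N * ?P)"
        proof (intro mult_left_mono pw)
          show "w \<subseteq> u" using w u by auto
          \<comment> \<open>If all of \<open>u'\<close> is kept, only component \<open>i\<close> is
            missing and \<open>l \<ge> 1\<close> pays for it; otherwise \<open>w\<close> has r - l
            elements and \<open>card u \<le> r\<close> leaves at most \<open>l\<close> to pay
            for.\<close>
          show "card u - card w \<le> l" using w(2) cu' l1 cr lr unfolding r_def by auto
          show "l \<le> N" using lr unfolding r_def by simp
        qed (use i dH L0 in auto)
        finally show ?thesis by (simp add: mult_ac)
      qed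
      have "?I r - {\<lambda>_. 0} \<subseteq> ?I N" using multi_indices_mono[of r N] unfolding r_def by auto
      then have card_le: "card (?I r - {\<lambda>_. 0}) \<le> card (?I N)"
        by (rule card_mono[OF finite_multi_indices])
      have "\<bar>\<Sum>\<beta>\<in>?I r - {\<lambda>_. 0}. mixed_diff u' ?p q (\<lambda>z. D (\<lambda>e. \<alpha> e + \<beta> e) (\<chi> j. z j)) * c \<beta>\<bar>
          \<le> real (card (?I r - {\<lambda>_. 0})) * (2 ^ ?S * L * H ^ N * ?P)"
        by (rule order_trans[OF sum_abs], rule sum_bounded_above[OF tm])
      also have "\<dots> \<le> real (card (?I N)) * (2 ^ ?S * L * H ^ N * ?P)"
        using L0 H(1) P0
        using card_le by (intro mult_right_mono) auto
      finally have "\<bar>mixed_diff u p q (\<lambda>z. D \<alpha> (\<chi> j. z j))\<bar> \<le>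
          real (card (?I N)) * (2 ^ ?S * L * H ^ N * ?P) + 2 ^ ?S * A * H ^ N * ?P"
        unfolding eq using rem by linarith
      also have "\<dots> \<le> L' * ?P" unfolding L'_def using L0 P0 by (simp add: algebra_simps)
      finally show ?thesis unfolding d_def .
    qed
    moreover have "0 \<le> L'" using LL' L0 by linarith
    ultimately show ?case by (intro exI[of _ L'] conjI allI impI) simp_all
  qed
  from main[of ?S] obtain L where L0: "L \<ge> 0" and L: "\<forall>u \<alpha> p q. card u \<le> ?S \<longrightarrow> \<alpha> \<in> ?I N \<longrightarrow> card u \<le> N - sz \<alpha> \<longrightarrow>
     (\<forall>j. p j \<in> X j) \<longrightarrow> (\<forall>j. q j \<in> X j) \<longrightarrow>
     \<bar>mixed_diff u p q (\<lambda>z. D \<alpha> (\<chi> j. z j))\<bar> \<le> L * (\<Prod>j\<in>u. dist (p j) (q j))" by blast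
  have "\<bar>mixed_diff u p q (\<lambda>z. f (\<chi> j. z j))\<bar> \<le> L * (\<Prod>j\<in>u. dist (p j) (q j))"
    if pq: "\<forall>j. p j \<in> X j" "\<forall>j. q j \<in> X j" for u p q
  proof -
    have "mixed_diff u p q (\<lambda>z. f (\<chi> j. z j)) = mixed_diff u p q (\<lambda>z. D (\<lambda>_. 0) (\<chi> j. z j))"
      by (intro mixed_diff_cong) (use pq in \<open>auto intro!: D0[symmetric]\<close>)
    moreover have "card u \<le> ?S" by (simp add: card_mono)
    moreover have "(\<lambda>_. 0) \<in> ?I N" "sz (\<lambda>_. 0) = 0" by (auto simp: multi_indices_def sz_def)
    ultimately show ?thesis using L pq N by simp
  qed
  then show ?thesis unfolding mixed_lipschitz_def using L0 by (intro exI[of _ L]) auto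
qed


section \<open>Wavelet decomposition on words\<close>

definition words :: "nat \<Rightarrow> nat \<Rightarrow> nat list set" where
  "words b K = {x. set x \<subseteq> {..<b} \<and> length x = K}"

lemma finite_words [simp]: "finite (words b K)"
  unfolding words_def by (rule finite_lists_length_eq) simp

lemma card_words: "card (words b K) = b ^ K"
  unfolding words_def by (simp add: card_lists_length_eq)

lemma length_words: "x \<in> words b K \<Longrightarrow> length x = K"
  by (simp add: words_def)

lemma words_SucE:
  assumes "x \<in> words b (Suc K)"
  obtains x' y where "x = x' @ [y]" "x' \<in> words b K" "y < b"
  using assms by (cases x rule: rev_cases) (auto simp: words_def)

text \<open>Conditional expectation given the first \<open>k\<close> letters, under the uniform law
  on words of length \<open>K\<close>: for k <= K the weight is the inverse of the number of words
  with a given prefix.\<close>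

definition avg_ker :: "nat \<Rightarrow> nat \<Rightarrow> nat \<Rightarrow> nat list \<Rightarrow> nat list \<Rightarrow> real" where
  "avg_ker b K k x y = (if take k x = take k y then real b ^ k / real b ^ K else 0)"

text \<open>The kernel of the projection onto the functions of the first \<open>k\<close> letters whose averages over
  the \<open>k\<close>-th letter vanish; for \<open>k = 0\<close>, onto the constants.\<close>

definition diff_ker :: "nat \<Rightarrow> nat \<Rightarrow> nat \<Rightarrow> nat list \<Rightarrow> nat list \<Rightarrow> real" where
  "diff_ker b K k x y = avg_ker b K k x y - (if k = 0 then 0 else avg_ker b K (k - 1) x y)"

lemma avg_ker_commute: "avg_ker b K k x y = avg_ker b K k y x"
  by (auto simp: avg_ker_def)

lemma diff_ker_commute: "diff_ker b K k x y = diff_ker b K k y x"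
  by (simp add: diff_ker_def avg_ker_commute[of b K _ x y])

lemma avg_ker_nonneg: "0 \<le> avg_ker b K k x y"
  by (simp add: avg_ker_def)

lemma sum_avg_ker:
  assumes "y \<in> words b K" "k \<le> K" "b > 0"
  shows "(\<Sum>x\<in>words b K. avg_ker b K k x y) = 1"
proof -
  have "{x \<in> words b K. take k x = take k y} = (\<lambda>z. take k y @ z) ` words b (K - k)"
  proof (intro equalityI subsetI)
    fix x assume x: "x \<in> {x \<in> words b K. take k x = take k y}"
    then have "x = take k y @ drop k x" by (metis (mono_tags, lifting) append_take_drop_id mem_Collect_eq)
    moreover have "drop k x \<in> words b (K - k)"
      using x by (auto simp: words_def dest: in_set_dropD)
    ultimately show "x \<in> (\<lambda>z. take k y @ z) ` words b (K - k)" by blast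
  next
    fix x assume "x \<in> (\<lambda>z. take k y @ z) ` words b (K - k)"
    then show "x \<in> {x \<in> words b K. take k x = take k y}"
      using assms set_take_subset[of k y] by (auto simp: words_def subset_iff)
  qed
  then have "card {x \<in> words b K. take k x = take k y} = b ^ (K - k)"
    by (simp add: card_image inj_on_def card_words)
  then have "(\<Sum>x\<in>words b K. avg_ker b K k x y) = real (b ^ (K - k)) * (real b ^ k / real b ^ K)"
    unfolding avg_ker_def by (simp add: sum.If_cases Int_def)
  also have "\<dots> = 1"
  proof -
    have "b ^ (K - k) * b ^ k = b ^ K" using assms(2) by (simp flip: power_add)
    then have "real (b ^ (K - k)) * real b ^ k = real b ^ K" by (metis of_nat_mult of_nat_power)
    then show ?thesis using assms(3) by simp
  qed
  finally show ?thesis .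
qed

text \<open>The tower property: averaging over coarse classes absorbs averaging over finer
  ones.\<close>

lemma avg_ker_comp_le:
  assumes "x' \<in> words b K" "k \<le> l" "l \<le> K" "b > 0"
  shows "(\<Sum>y\<in>words b K. avg_ker b K k x y * avg_ker b K l y x') = avg_ker b K k x x'"
proof -
  have "avg_ker b K k x y * avg_ker b K l y x' = avg_ker b K k x x' * avg_ker b K l y x'" for y
  proof (cases "take l y = take l x'")
    case True
    then have "take k y = take k x'" using assms(2) by (metis min.absorb1 take_take)
    then show ?thesis by (simp add: avg_ker_def)
  qed (simp add: avg_ker_def)
  then have "(\<Sum>y\<in>words b K. avg_ker b K k x y * avg_ker b K l y x')
      = (\<Sum>y\<in>words b K. avg_ker b K k x x' * avg_ker b K l y x')" by (rule sum.cong[OF refl])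
  also have "\<dots> = avg_ker b K k x x'"
    using sum_avg_ker[of x' b K l] assms by (simp flip: sum_distrib_left)
  finally show ?thesis .
qed

lemma avg_ker_comp:
  assumes "x \<in> words b K" "x' \<in> words b K" "k \<le> K" "l \<le> K" "b > 0"
  shows "(\<Sum>y\<in>words b K. avg_ker b K k x y * avg_ker b K l y x') = avg_ker b K (min k l) x x'"
proof (cases "k \<le> l")
  case True
  then show ?thesis using avg_ker_comp_le[of x' b K k l x] assms by simp
next
  case False
  then have "(\<Sum>y\<in>words b K. avg_ker b K l x' y * avg_ker b K k y x) = avg_ker b K l x' x"
    using assms by (intro avg_ker_comp_le) auto
  then show ?thesis using False
    by (simp add: avg_ker_commute[of b K _ x'] avg_ker_commute[of b K _ _ x] mult.commute)
qed

lemma diff_ker_idem: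
  assumes "x \<in> words b K" "x' \<in> words b K" "k \<le> K" "b > 0"
  shows "(\<Sum>y\<in>words b K. diff_ker b K k x y * diff_ker b K k y x') = diff_ker b K k x x'"
proof (cases "k = 0")
  case True
  then show ?thesis using avg_ker_comp[of x b K x' 0 0] assms by (simp add: diff_ker_def)
next
  case False
  have "diff_ker b K k x y * diff_ker b K k y x' =
      avg_ker b K k x y * avg_ker b K k y x' - avg_ker b K k x y * avg_ker b K (k-1) y x'
      - avg_ker b K (k-1) x y * avg_ker b K k y x' + avg_ker b K (k-1) x y * avg_ker b K (k-1) y x'" (is "_ = ?e y") for y
    using False by (simp add: diff_ker_def algebra_simps)
  then have "(\<Sum>y\<in>words b K. diff_ker b K k x y * diff_ker b K k y x') = (\<Sum>y\<in>words b K. ?e y)"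
    by (rule sum.cong[OF refl])
  also have "\<dots> = avg_ker b K (min k k) x x' - avg_ker b K (min k (k-1)) x x'
      - avg_ker b K (min (k-1) k) x x' + avg_ker b K (min (k-1) (k-1)) x x'"
    using assms by (simp add: sum.distrib sum_subtractf avg_ker_comp)
  finally show ?thesis using False by (simp add: diff_ker_def min_absorb2 min_absorb1)
qed

lemma sum_diff_ker_0:
  assumes "y \<in> words b K" "k \<le> K" "k \<noteq> 0" "b > 0"
  shows "(\<Sum>x\<in>words b K. diff_ker b K k x y) = 0"
  using assms sum_avg_ker[of y b K k] sum_avg_ker[of y b K "k - 1"] by (simp add: diff_ker_def sum_subtractf)

text \<open>The 2 counts the unit masses of the two averaging kernels.\<close>

lemma sum_abs_diff_ker:
  assumes "y \<in> words b K" "k \<le> K" "b > 0"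
  shows "(\<Sum>x\<in>words b K. \<bar>diff_ker b K k x y\<bar>) \<le> 2"
proof -
  have "(\<Sum>x\<in>words b K. \<bar>diff_ker b K k x y\<bar>) \<le> (\<Sum>x\<in>words b K. avg_ker b K k x y + avg_ker b K (k-1) x y)"
    using avg_ker_nonneg[of b K] by (intro sum_mono) (auto simp: diff_ker_def abs_le_iff algebra_simps intro: add_increasing2 order_trans)
  also have "\<dots> = 2" using sum_avg_ker[of y b K k] sum_avg_ker[of y b K "k - 1"] assms by (simp add: sum.distrib)
  finally show ?thesis .
qed

text \<open>The kernel of level \<open>k\<close> still couples words that differ in their
  \<open>k\<close>-th letter; hence the \<open>l j - 1\<close> common letters in the bounds
  below.\<close>

lemma diff_ker_support: "diff_ker b K k x y \<noteq> 0 \<Longrightarrow> take (k - 1) x = take (k - 1) y"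
proof (rule ccontr)
  assume ne: "take (k - 1) x \<noteq> take (k - 1) y" and nz: "diff_ker b K k x y \<noteq> 0"
  have "take k x \<noteq> take k y" using ne by (metis diff_le_self min.absorb1 take_take)
  then show False using ne nz by (simp add: diff_ker_def avg_ker_def split: if_splits)
qed

lemma sum_diff_ker: "(\<Sum>k\<le>K'. diff_ker b K k x y) = avg_ker b K K' x y"
  by (induction K') (auto simp: diff_ker_def)

lemma diff_ker_snoc:
  assumes "length x = K" "length x' = K" "k \<le> K" "b > 0"
  shows "diff_ker b (Suc K) k (x @ [y]) (x' @ [y']) = diff_ker b K k x x' / real b"
  using assms by (auto simp: diff_ker_def avg_ker_def field_simps)

text \<open>\<open>level_prob\<close> is the probability that the permutations on level \<open>l\<close> along the branches \<open>A\<close> and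
  \<open>A'\<close> send the letters \<open>A ! l\<close>, \<open>A' ! l\<close> to \<open>x ! l\<close>, \<open>x' ! l\<close>.\<close>

definition level_prob :: "nat \<Rightarrow> nat list \<Rightarrow> nat list \<Rightarrow> nat list \<Rightarrow> nat list \<Rightarrow> nat \<Rightarrow> real" where
  "level_prob b A A' x x' l =
     (if take l A = take l A' then
        if A ! l = A' ! l then of_bool (x ! l = x' ! l) / real b
        else of_bool (x ! l \<noteq> x' ! l) / (real b * (real b - 1))
      else 1 / (real b * real b))"

text \<open>\<open>Upsilon\<close> read off from words, with the level shifted by one:
  \<open>k\<close> stands for \<open>\<kappa> j + 1\<close>, and \<open>k = 0\<close> for a
  component outside \<open>u\<close>, which contributes the factor 1.\<close>

definition gain_factor :: "nat \<Rightarrow> nat \<Rightarrow> nat list \<Rightarrow> nat list \<Rightarrow> real" where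
  "gain_factor b k A A' =
     (if k = 0 then 1
      else (real b * of_bool (take k A = take k A') - of_bool (take (k - 1) A = take (k - 1) A')) / (real b - 1))"

lemma gain_factor_refl: "b \<ge> 2 \<Longrightarrow> gain_factor b k A A = 1"
  by (simp add: gain_factor_def)

text \<open>The projections diagonalise the joint law of two scrambled words. Once the prefixes of
  \<open>A\<close> and \<open>A'\<close> differ, new letters are independent and uniform and no
  further term arises. While they agree, only the newest level has to be compared, where equal and
  different letters give the gain factors 1 and -1/(b - 1).\<close>

lemma prod_level_prob:
  assumes "b \<ge> 2" "A \<in> words b K" "A' \<in> words b K" "x \<in> words b K" "x' \<in> words b K"
  shows "(\<Prod>l<K. level_prob b A A' x x' l) = (1 / real b ^ K) * (\<Sum>k\<le>K. gain_factor b k A A' * diff_ker b K k x x')"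
  using assms(2-)
proof (induction K arbitrary: A A' x x')
  case 0
  then show ?case by (simp add: words_def gain_factor_def diff_ker_def avg_ker_def)
next
  case (Suc K)
  from Suc.prems(1) obtain A0 d where A: "A = A0 @ [d]" "A0 \<in> words b K" "d < b" by (rule words_SucE)
  from Suc.prems(2) obtain A0' d' where A': "A' = A0' @ [d']" "A0' \<in> words b K" "d' < b" by (rule words_SucE)
  from Suc.prems(3) obtain x0 y where x: "x = x0 @ [y]" "x0 \<in> words b K" "y < b" by (rule words_SucE)
  from Suc.prems(4) obtain x0' y' where x': "x' = x0' @ [y']" "x0' \<in> words b K" "y' < b" by (rule words_SucE)
  note len = length_words[OF A(2)] length_words[OF A'(2)] length_words[OF x(2)] length_words[OF x'(2)]
  let ?b = "real b"
  have b: "?b \<ge> 2" using assms(1) by simp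
  define S where "S = (\<Sum>k\<le>K. gain_factor b k A0 A0' * diff_ker b K k x0 x0')"
  have lower: "level_prob b A A' x x' l = level_prob b A0 A0' x0 x0' l" if "l < K" for l
    using that len by (simp add: level_prob_def A(1) A'(1) x(1) x'(1) nth_append)
  have "(\<Prod>l<Suc K. level_prob b A A' x x' l) = (1 / ?b ^ K) * S * level_prob b A A' x x' K"
    using Suc.IH[OF A(2) A'(2) x(2) x'(2)] lower unfolding S_def by simp
  moreover have "(\<Sum>k\<le>Suc K. gain_factor b k A A' * diff_ker b (Suc K) k x x') =
      S / ?b + gain_factor b (Suc K) A A' * diff_ker b (Suc K) (Suc K) x x'"
  proof -
    have "gain_factor b k A A' * diff_ker b (Suc K) k x x' = gain_factor b k A0 A0' * diff_ker b K k x0 x0' / ?b"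
      if "k \<le> K" for k
      using that len diff_ker_snoc[of x0 K x0' k b y y'] assms(1)
      by (simp add: gain_factor_def A(1) A'(1) x(1) x'(1))
    then show ?thesis unfolding S_def by (simp add: sum_divide_distrib)
  qed
  moreover have "S * level_prob b A A' x x' K = (S / ?b + gain_factor b (Suc K) A A' * diff_ker b (Suc K) (Suc K) x x') / ?b"
  proof (cases "A0 = A0'")
    case False
    then show ?thesis using len by (simp add: level_prob_def gain_factor_def A(1) A'(1))
  next
    case True
    \<comment> \<open>All gain factors up to level \<open>K\<close> are 1, so the projections add up
      to the averaging kernel of full length, which is the identity.\<close>
    have S: "S = of_bool (x0 = x0')"
      using sum_diff_ker[where K' = K and K = K and b = b and x = x0 and y = x0'] len assms(1)
      unfolding S_def True by (auto simp: gain_factor_refl[OF assms(1)] avg_ker_def)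
    have dk: "diff_ker b (Suc K) (Suc K) x x' = of_bool (x0 = x0' \<and> y = y') - of_bool (x0 = x0') / ?b"
      using len b by (simp add: diff_ker_def avg_ker_def x(1) x'(1))
    have nth: "A ! K = d" "A' ! K = d'" "x ! K = y" "x' ! K = y'"
      using len by (auto simp: A(1) A'(1) x(1) x'(1) nth_append)
    have tk: "take K A = A0" "take K A' = A0'" using len by (auto simp: A(1) A'(1))
    have gf: "gain_factor b (Suc K) A A' = (?b * of_bool (d = d') - 1) / (?b - 1)"
      using len True by (simp add: gain_factor_def A(1) A'(1))
    show ?thesis unfolding S dk gf level_prob_def nth tk using True b
      by (auto simp: divide_simps) (auto simp: algebra_simps)
  qed
  ultimately show ?case by (simp add: field_simps)
qed

text \<open>Fubini in coordinate \<open>i\<close>: as \<open>h\<close> ignores it, the sum of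
  \<open>\<tau> i\<close> splits off.\<close>

lemma sum_PiE_prod_eq_0:
  fixes \<tau> :: "'s::finite \<Rightarrow> 'a \<Rightarrow> real" and h :: "('s \<Rightarrow> 'a) \<Rightarrow> real"
  assumes "finite W" "(\<Sum>x\<in>W. \<tau> i x) = 0" and h: "\<And>x y. h (x(i := y)) = h x"
  shows "(\<Sum>x\<in>UNIV \<rightarrow>\<^sub>E W. (\<Prod>j\<in>UNIV. \<tau> j (x j)) * h x) = 0"
proof -
  let ?S = "UNIV - {i}"
  have U: "(UNIV :: 's set) = insert i ?S" by auto
  have "(\<Sum>x\<in>UNIV \<rightarrow>\<^sub>E W. (\<Prod>j\<in>UNIV. \<tau> j (x j)) * h x)
      = (\<Sum>x\<in>(\<lambda>(y, g). g(i := y)) ` (W \<times> (?S \<rightarrow>\<^sub>E W)). (\<Prod>j\<in>UNIV. \<tau> j (x j)) * h x)"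
    by (subst U, subst PiE_insert_eq) simp
  also have "\<dots> = (\<Sum>(y, g)\<in>W \<times> (?S \<rightarrow>\<^sub>E W). (\<Prod>j\<in>UNIV. \<tau> j ((g(i := y)) j)) * h (g(i := y)))"
    by (subst sum.reindex[OF inj_combinator]) (auto simp: case_prod_beta)
  also have "\<dots> = (\<Sum>(y, g)\<in>W \<times> (?S \<rightarrow>\<^sub>E W). \<tau> i y * ((\<Prod>j\<in>?S. \<tau> j (g j)) * h g))"
  proof (rule sum.cong[OF refl], clarify)
    fix y g
    have "(\<Prod>j\<in>UNIV. \<tau> j ((g(i := y)) j)) = \<tau> i y * (\<Prod>j\<in>?S. \<tau> j ((g(i := y)) j))"
      by (subst prod.remove[of UNIV i]) auto
    also have "(\<Prod>j\<in>?S. \<tau> j ((g(i := y)) j)) = (\<Prod>j\<in>?S. \<tau> j (g j))" by (rule prod.cong) auto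
    finally show "(\<Prod>j\<in>UNIV. \<tau> j ((g(i := y)) j)) * h (g(i := y)) = \<tau> i y * ((\<Prod>j\<in>?S. \<tau> j (g j)) * h g)"
      by (simp only: h mult.assoc)
  qed
  also have "\<dots> = (\<Sum>y\<in>W. \<tau> i y) * (\<Sum>g\<in>?S \<rightarrow>\<^sub>E W. (\<Prod>j\<in>?S. \<tau> j (g j)) * h g)"
    by (simp add: sum_product sum.cartesian_product)
  finally show ?thesis using assms by simp
qed

lemma sum_PiE_prod:
  fixes \<tau> :: "'s::finite \<Rightarrow> 'a \<Rightarrow> real"
  assumes "finite W"
  shows "(\<Sum>x\<in>UNIV \<rightarrow>\<^sub>E W. \<Prod>j\<in>UNIV. \<tau> j (x j)) = (\<Prod>j\<in>UNIV. \<Sum>x\<in>W. \<tau> j x)"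
  using assms by (subst prod_sum_PiE) auto

section \<open>Tensor products of the projections over the components\<close>

context
  fixes b K :: nat
  assumes b: "b \<ge> 2"
begin

abbreviation "grid \<equiv> (UNIV :: 's::finite set) \<rightarrow>\<^sub>E words b K"

lemma finite_grid [simp]: "finite (grid :: ('s::finite \<Rightarrow> nat list) set)"
  by (simp add: finite_PiE)

lemma card_grid: "card (grid :: ('s::finite \<Rightarrow> nat list) set) = b ^ (K * CARD('s))"
  by (simp add: card_PiE card_words power_mult)

text \<open>This is the projection \<open>T\<^sub>l g\<close>: the tensor product over the
  components of the kernels of level \<open>l j\<close>, applied to \<open>g\<close>.\<close>

definition wavelet_part :: "('s::finite \<Rightarrow> nat) \<Rightarrow> (('s \<Rightarrow> nat list) \<Rightarrow> real) \<Rightarrow> ('s \<Rightarrow> nat list) \<Rightarrow> real" where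
  "wavelet_part l g y = (\<Sum>x\<in>grid. (\<Prod>j\<in>UNIV. diff_ker b K (l j) (x j) (y j)) * g x)"

text \<open>\<open>diff_ker\<close> has vanishing sums, so \<open>g\<close> may be replaced by its mixed difference against \<open>y\<close>.\<close>

lemma wavelet_part_eq_mixed_diff:
  fixes l :: "'s::finite \<Rightarrow> nat"
  assumes l: "\<And>j. l j \<le> K" and y: "y \<in> grid"
  shows "wavelet_part l g y =
    (\<Sum>x\<in>grid. (\<Prod>j\<in>UNIV. diff_ker b K (l j) (x j) (y j)) * mixed_diff {j. l j \<noteq> 0} x y g)"
proof -
  let ?u = "{j. l j \<noteq> 0}"
  let ?t = "\<lambda>x. \<Prod>j\<in>UNIV. diff_ker b K (l j) (x j) (y j)"
  have "(\<Sum>x\<in>grid. ?t x * mixed_diff ?u x y g) =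
      (\<Sum>v\<in>Pow ?u. (-1) ^ card v * (\<Sum>x\<in>grid. ?t x * g (\<lambda>j. if j \<in> v then y j else x j)))"
    unfolding mixed_diff_def sum_distrib_left
    by (subst sum.swap) (simp add: mult_ac)
  \<comment> \<open>For nonempty \<open>v\<close> pick \<open>i\<close> in \<open>v\<close>:
    \<open>g\<close> no longer depends on \<open>x i\<close>, and the kernel in component
    \<open>i\<close> sums to zero. Only the vertex \<open>x\<close> itself survives.\<close>
  also have "\<dots> = (\<Sum>v\<in>{{}}. (-1) ^ card v * (\<Sum>x\<in>grid. ?t x * g (\<lambda>j. if j \<in> v then y j else x j)))"
  proof (rule sum.mono_neutral_right)
    show "\<forall>v\<in>Pow ?u - {{}}. (-1) ^ card v * (\<Sum>x\<in>grid. ?t x * g (\<lambda>j. if j \<in> v then y j else x j)) = 0"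
    proof
      fix v assume "v \<in> Pow ?u - {{}}"
      then obtain i where i: "i \<in> v" "l i \<noteq> 0" by auto
      have "(\<Sum>x\<in>words b K. diff_ker b K (l i) x (y i)) = 0"
        using y l i b by (intro sum_diff_ker_0) auto
      moreover have "g (\<lambda>j. if j \<in> v then y j else (x(i := z)) j) = g (\<lambda>j. if j \<in> v then y j else x j)" for x z
        using i by (intro arg_cong[of _ _ g]) auto
      ultimately have "(\<Sum>x\<in>grid. ?t x * g (\<lambda>j. if j \<in> v then y j else x j)) = 0"
        by (intro sum_PiE_prod_eq_0[where i = i]) auto
      then show "(-1) ^ card v * (\<Sum>x\<in>grid. ?t x * g (\<lambda>j. if j \<in> v then y j else x j)) = 0" by simp
    qed
  qed auto
  finally show ?thesis by (simp add: wavelet_part_def)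
qed

text \<open>In each component the kernel has absolute mass at most 2 and vanishes unless the words
  share \<open>l j - 1\<close> letters, so \<open>B\<close> has to hold for such pairs only.\<close>

lemma wavelet_part_bound:
  fixes l :: "'s::finite \<Rightarrow> nat"
  assumes l: "\<And>j. l j \<le> K" and y: "y \<in> grid" and B0: "B \<ge> 0"
    and B: "\<And>x. x \<in> grid \<Longrightarrow> (\<And>j. take (l j - 1) (x j) = take (l j - 1) (y j)) \<Longrightarrow>
       \<bar>mixed_diff {j. l j \<noteq> 0} x y g\<bar> \<le> B"
  shows "\<bar>wavelet_part l g y\<bar> \<le> 2 ^ CARD('s) * B"
proof -
  let ?t = "\<lambda>x. \<Prod>j\<in>UNIV. diff_ker b K (l j) (x j) (y j)"
  have "\<bar>wavelet_part l g y\<bar> \<le> (\<Sum>x\<in>grid. \<bar>?t x\<bar> * B)"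
    unfolding wavelet_part_eq_mixed_diff[OF l y]
  proof (rule order_trans[OF sum_abs], rule sum_mono)
    fix x assume x: "x \<in> (grid :: ('s \<Rightarrow> nat list) set)"
    show "\<bar>?t x * mixed_diff {j. l j \<noteq> 0} x y g\<bar> \<le> \<bar>?t x\<bar> * B"
    proof (cases "?t x = 0")
      case True
      then show ?thesis by (simp only: mult_zero_left abs_zero)
    next
      case False
      then have "take (l j - 1) (x j) = take (l j - 1) (y j)" for j
        by (intro diff_ker_support[of b K]) (simp add: prod_zero_iff)
      then show ?thesis unfolding abs_mult using B[OF x] by (intro mult_left_mono) auto
    qed
  qed
  also have "\<dots> = (\<Sum>x\<in>grid. \<Prod>j\<in>UNIV. \<bar>diff_ker b K (l j) (x j) (y j)\<bar>) * B"
    by (simp only: abs_prod sum_distrib_right)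
  also have "(\<Sum>x\<in>grid. \<Prod>j\<in>UNIV. \<bar>diff_ker b K (l j) (x j) (y j)\<bar>) =
      (\<Prod>j\<in>UNIV. \<Sum>x\<in>words b K. \<bar>diff_ker b K (l j) x (y j)\<bar>)"
    by (rule sum_PiE_prod[where \<tau> = "\<lambda>j x. \<bar>diff_ker b K (l j) x (y j)\<bar>"]) simp
  also have "\<dots> * B \<le> (\<Prod>j\<in>(UNIV::'s set). 2) * B"
    using y l b B0 by (intro mult_right_mono prod_mono conjI sum_abs_diff_ker sum_nonneg) auto
  finally show ?thesis by simp
qed

text \<open>The kernel is symmetric and idempotent, so its quadratic form is a squared norm. Its
  sign is what makes one-sided bounds on the gain coefficients sufficient.\<close>

lemma wavelet_part_inner:
  fixes l :: "'s::finite \<Rightarrow> nat"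
  assumes l: "\<And>j. l j \<le> K"
  shows "(\<Sum>x\<in>grid. \<Sum>x'\<in>grid. (\<Prod>j\<in>UNIV. diff_ker b K (l j) (x j) (x' j)) * (g x * g x'))
    = (\<Sum>y\<in>grid. (wavelet_part l g y)\<^sup>2)"
proof -
  let ?t = "\<lambda>x y. \<Prod>j\<in>UNIV. diff_ker b K (l j) (x j) (y j)"
  have idem: "?t x x' = (\<Sum>y\<in>grid. ?t x y * ?t x' y)" if "x \<in> grid" "x' \<in> grid" for x x'
  proof -
    have "?t x x' = (\<Prod>j\<in>UNIV. \<Sum>y\<in>words b K. diff_ker b K (l j) (x j) y * diff_ker b K (l j) y (x' j))"
      using that l b by (intro prod.cong refl diff_ker_idem[symmetric]) auto
    also have "\<dots> = (\<Sum>y\<in>grid. \<Prod>j\<in>UNIV. diff_ker b K (l j) (x j) (y j) * diff_ker b K (l j) (y j) (x' j))"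
      by (rule sum_PiE_prod[symmetric, where \<tau> = "\<lambda>j y. diff_ker b K (l j) (x j) y * diff_ker b K (l j) y (x' j)"]) simp
    finally show ?thesis by (simp add: prod.distrib diff_ker_commute[of b K _ _ "x' _"])
  qed
  have "(\<Sum>x\<in>grid. \<Sum>x'\<in>grid. ?t x x' * (g x * g x')) =
      (\<Sum>x\<in>grid. \<Sum>x'\<in>grid. \<Sum>y\<in>grid. (?t x y * g x) * (?t x' y * g x'))"
  proof (intro sum.cong refl)
    fix x x' assume "x \<in> (grid :: ('s \<Rightarrow> nat list) set)" "x' \<in> (grid :: ('s \<Rightarrow> nat list) set)"
    from idem[OF this] show "?t x x' * (g x * g x') = (\<Sum>y\<in>grid. (?t x y * g x) * (?t x' y * g x'))"
      by (simp only: sum_distrib_right) (simp only: mult_ac)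
  qed
  also have "\<dots> = (\<Sum>x\<in>grid. \<Sum>y\<in>grid. \<Sum>x'\<in>grid. (?t x y * g x) * (?t x' y * g x'))"
    by (intro sum.cong refl sum.swap)
  also have "\<dots> = (\<Sum>y\<in>grid. \<Sum>x\<in>grid. \<Sum>x'\<in>grid. (?t x y * g x) * (?t x' y * g x'))"
    by (rule sum.swap)
  also have "\<dots> = (\<Sum>y\<in>grid. (wavelet_part l g y)\<^sup>2)"
    by (simp add: wavelet_part_def power2_eq_square sum_product)
  finally show ?thesis .
qed

text \<open>Multiply out \<open>prod_level_prob\<close> over the components, choosing one level in
  each: the dependence on the two net points separates from the dependence on
  \<open>g\<close>.\<close>

lemma pair_law_expansion:
  fixes A A' :: "'s::finite \<Rightarrow> nat list"
  assumes "A \<in> grid" "A' \<in> grid"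
  shows "(\<Sum>x\<in>grid. \<Sum>x'\<in>grid. (\<Prod>j\<in>UNIV. \<Prod>k<K. level_prob b (A j) (A' j) (x j) (x' j) k) * (g x * g x'))
    = (1 / real b ^ (K * CARD('s))) *
      (\<Sum>l\<in>UNIV \<rightarrow>\<^sub>E {..K}. (\<Prod>j\<in>UNIV. gain_factor b (l j) (A j) (A' j)) * (\<Sum>y\<in>grid. (wavelet_part l g y)\<^sup>2))"
proof -
  let ?L = "(UNIV::'s set) \<rightarrow>\<^sub>E {..K}"
  let ?c = "1 / real b ^ (K * CARD('s))"
  let ?t = "\<lambda>l x y. \<Prod>j\<in>UNIV. diff_ker b K (l j) (x j) (y j)"
  let ?g = "\<lambda>l. \<Prod>j\<in>UNIV. gain_factor b (l j) (A j) (A' j)"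
  have "(\<Prod>j\<in>UNIV. \<Prod>k<K. level_prob b (A j) (A' j) (x j) (x' j) k) = ?c * (\<Sum>l\<in>?L. ?g l * ?t l x x')"
    if "x \<in> grid" "x' \<in> grid" for x x'
  proof -
    have "(\<Prod>j\<in>UNIV. \<Prod>k<K. level_prob b (A j) (A' j) (x j) (x' j) k) =
       (\<Prod>j\<in>UNIV. (1 / real b ^ K) * (\<Sum>k\<le>K. gain_factor b k (A j) (A' j) * diff_ker b K k (x j) (x' j)))"
      using assms that b by (intro prod.cong refl prod_level_prob) auto
    also have "\<dots> = ?c * (\<Prod>j\<in>UNIV. \<Sum>k\<le>K. gain_factor b k (A j) (A' j) * diff_ker b K k (x j) (x' j))"
      by (simp add: prod.distrib power_mult power_one_over prod_dividef)
    also have "\<dots> = ?c * (\<Sum>l\<in>?L. \<Prod>j\<in>UNIV. gain_factor b (l j) (A j) (A' j) * diff_ker b K (l j) (x j) (x' j))"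
      by (subst prod_sum_PiE) auto
    finally show ?thesis by (simp add: prod.distrib)
  qed
  then have "(\<Sum>x\<in>grid. \<Sum>x'\<in>grid. (\<Prod>j\<in>UNIV. \<Prod>k<K. level_prob b (A j) (A' j) (x j) (x' j) k) * (g x * g x'))
     = (\<Sum>x\<in>grid. \<Sum>x'\<in>grid. \<Sum>l\<in>?L. ?c * (?g l * (?t l x x' * (g x * g x'))))"
    by (intro sum.cong refl) (simp add: sum_distrib_left sum_distrib_right mult.assoc)
  also have "\<dots> = (\<Sum>x\<in>grid. \<Sum>l\<in>?L. \<Sum>x'\<in>grid. ?c * (?g l * (?t l x x' * (g x * g x'))))"
    by (intro sum.cong refl sum.swap)
  also have "\<dots> = (\<Sum>l\<in>?L. \<Sum>x\<in>grid. \<Sum>x'\<in>grid. ?c * (?g l * (?t l x x' * (g x * g x'))))"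
    by (rule sum.swap)
  also have "\<dots> = (\<Sum>l\<in>?L. ?c * (?g l * (\<Sum>x\<in>grid. \<Sum>x'\<in>grid. ?t l x x' * (g x * g x'))))"
    by (simp add: sum_distrib_left)
  also have "\<dots> = (\<Sum>l\<in>?L. ?c * (?g l * (\<Sum>y\<in>grid. (wavelet_part l g y)\<^sup>2)))"
  proof (rule sum.cong[OF refl])
    fix l assume "l \<in> ?L"
    then have "l j \<le> K" for j by auto
    then show "?c * (?g l * (\<Sum>x\<in>grid. \<Sum>x'\<in>grid. ?t l x x' * (g x * g x'))) = ?c * (?g l * (\<Sum>y\<in>grid. (wavelet_part l g y)\<^sup>2))"
      by (simp only: wavelet_part_inner)
  qed
  finally show ?thesis by (simp add: sum_distrib_left)
qed

text \<open>Summing \<open>pair_law_expansion\<close> over all pairs of points collects the gain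
  factors into one gain coefficient per \<open>l\<close>. The bound \<open>G l\<close> depends on
  \<open>l\<close> so that it can be 0 where the net makes the coefficient vanish.\<close>

lemma second_moment_bound:
  fixes A :: "nat \<Rightarrow> 's::finite \<Rightarrow> nat list" and B :: "('s \<Rightarrow> nat) \<Rightarrow> real"
  assumes n: "n > 0" and A: "\<And>i. i \<in> {1..n} \<Longrightarrow> A i \<in> grid"
    and g0: "(\<Sum>x\<in>grid. g x) = 0"
    and gain: "\<And>l. (\<And>j. l j \<le> K) \<Longrightarrow> l \<noteq> (\<lambda>_. 0) \<Longrightarrow> (1 / real n) * (\<Sum>i=1..n. \<Sum>i'=1..n. \<Prod>j\<in>UNIV. gain_factor b (l j) (A i j) (A i' j)) \<le> G l"
    and B0: "\<And>l. B l \<ge> 0"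
    and B: "\<And>l x y. l \<noteq> (\<lambda>_. 0) \<Longrightarrow> (\<And>j. l j \<le> K) \<Longrightarrow> x \<in> grid \<Longrightarrow> y \<in> grid \<Longrightarrow> (\<And>j. take (l j - 1) (x j) = take (l j - 1) (y j)) \<Longrightarrow>
       \<bar>mixed_diff {j. l j \<noteq> 0} x y g\<bar> \<le> B l"
    and G0: "\<And>l. G l \<ge> 0"
  shows "(1 / real n ^ 2) * (\<Sum>i=1..n. \<Sum>i'=1..n. \<Sum>x\<in>grid. \<Sum>x'\<in>grid.
      (\<Prod>j\<in>UNIV. \<Prod>k<K. level_prob b (A i j) (A i' j) (x j) (x' j) k) * (g x * g x'))
    \<le> (1 / real n) * (\<Sum>l\<in>(UNIV \<rightarrow>\<^sub>E {..K}) - {\<lambda>_. 0}. G l * (2 ^ CARD('s) * B l)\<^sup>2)"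
proof -
  let ?L = "(UNIV::'s set) \<rightarrow>\<^sub>E {..K}"
  define c where "c = 1 / real b ^ (K * CARD('s))"
  define Q where "Q l = (\<Sum>y\<in>grid. (wavelet_part l g y)\<^sup>2)" for l :: "'s \<Rightarrow> nat"
  define a where "a l i i' = (\<Prod>j\<in>UNIV. gain_factor b (l j) (A i j) (A i' j))" for l i i'
  define S where "S i i' = (\<Sum>x\<in>grid. \<Sum>x'\<in>grid.
      (\<Prod>j\<in>UNIV. \<Prod>k<K. level_prob b (A i j) (A i' j) (x j) (x' j) k) * (g x * g x'))" for i i'
  define \<Gamma> where "\<Gamma> l = (1 / real n) * (\<Sum>i=1..n. \<Sum>i'=1..n. a l i i')" for l
  \<comment> \<open>The mean square of the part of level \<open>l\<close>, since \<open>c\<close> is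
    the inverse of the number of word tuples.\<close>
  define N where "N l = c * Q l" for l
  have S: "S i i' = (\<Sum>l\<in>?L. a l i i' * N l)" if "i \<in> {1..n}" "i' \<in> {1..n}" for i i'
  proof -
    have "S i i' = c * (\<Sum>l\<in>?L. a l i i' * Q l)"
      using pair_law_expansion[where A = "A i" and A' = "A i'" and g = g, OF A[OF that(1)] A[OF that(2)]]
      unfolding S_def c_def a_def Q_def .
    then show ?thesis by (simp add: N_def sum_distrib_left mult.left_commute)
  qed
  have "(\<Sum>i=1..n. \<Sum>i'=1..n. S i i') = (\<Sum>i=1..n. \<Sum>i'=1..n. \<Sum>l\<in>?L. a l i i' * N l)"
    by (intro sum.cong refl S)
  also have "\<dots> = (\<Sum>i=1..n. \<Sum>l\<in>?L. \<Sum>i'=1..n. a l i i' * N l)"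
    by (intro sum.cong refl sum.swap)
  also have "\<dots> = (\<Sum>l\<in>?L. \<Sum>i=1..n. \<Sum>i'=1..n. a l i i' * N l)"
    by (rule sum.swap)
  also have "\<dots> = (\<Sum>l\<in>?L. real n * (\<Gamma> l * N l))"
    using n by (simp add: \<Gamma>_def sum_distrib_right)
  finally have "(1 / real n ^ 2) * (\<Sum>i=1..n. \<Sum>i'=1..n. S i i') = (1 / real n) * (\<Sum>l\<in>?L. \<Gamma> l * N l)"
    using n by (simp add: power2_eq_square flip: sum_distrib_left)
  also have "\<dots> = (1 / real n) * (\<Sum>l\<in>?L - {\<lambda>_. 0}. \<Gamma> l * N l)"
  proof -
    \<comment> \<open>Level 0 in all components is the projection onto constants, which sees only
      the sum of \<open>g\<close>.\<close>
    have "wavelet_part (\<lambda>_. 0) g y = 0" for y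
      unfolding wavelet_part_def diff_ker_def avg_ker_def by (simp add: g0 flip: sum_distrib_left)
    then have "N (\<lambda>_. 0) = 0" by (simp add: N_def Q_def)
    then have "(\<Sum>l\<in>?L. \<Gamma> l * N l) = (\<Sum>l\<in>?L - {\<lambda>_. 0}. \<Gamma> l * N l)"
      by (intro sum.mono_neutral_right) (auto intro: finite_PiE)
    then show ?thesis by simp
  qed
  also have "\<dots> \<le> (1 / real n) * (\<Sum>l\<in>?L - {\<lambda>_. 0}. G l * (2 ^ CARD('s) * B l)\<^sup>2)"
  proof (intro mult_left_mono sum_mono)
    fix l assume l: "l \<in> ?L - {\<lambda>_. 0}"
    then have lK: "l j \<le> K" for j by auto
    have l0: "l \<noteq> (\<lambda>_. 0)" using l by blast
    have N0: "N l \<ge> 0" by (simp add: N_def Q_def c_def sum_nonneg)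
    have "Q l \<le> (\<Sum>y\<in>(grid :: ('s \<Rightarrow> nat list) set). (2 ^ CARD('s) * B l)\<^sup>2)"
      unfolding Q_def
    proof (rule sum_mono)
      fix y assume y: "y \<in> (grid :: ('s \<Rightarrow> nat list) set)"
      have "\<bar>wavelet_part l g y\<bar> \<le> 2 ^ CARD('s) * B l"
        by (rule wavelet_part_bound[OF lK y B0 B[OF l0 lK _ y]])
      from power_mono[OF this abs_ge_zero, of 2]
      show "(wavelet_part l g y)\<^sup>2 \<le> (2 ^ CARD('s) * B l)\<^sup>2" by simp
    qed
    then have "N l \<le> c * (real b ^ (K * CARD('s)) * (2 ^ CARD('s) * B l)\<^sup>2)"
      unfolding N_def by (intro mult_left_mono) (auto simp: card_grid c_def)
    also have "\<dots> = (2 ^ CARD('s) * B l)\<^sup>2" using b by (simp add: c_def)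
    finally have N: "N l \<le> (2 ^ CARD('s) * B l)\<^sup>2" .
    from mult_right_mono[OF gain[OF lK l0] N0] have "\<Gamma> l * N l \<le> G l * N l"
      unfolding \<Gamma>_def a_def .
    also have "\<dots> \<le> G l * (2 ^ CARD('s) * B l)\<^sup>2" by (rule mult_left_mono[OF N G0])
    finally show "\<Gamma> l * N l \<le> G l * (2 ^ CARD('s) * B l)\<^sup>2" .
  qed simp
  finally show ?thesis unfolding S_def .
qed

end


section \<open>Gain coefficients of digital nets\<close>

lemma floor_eq_digit:
  assumes "0 \<le> x" "b > 0"
  shows "nat \<lfloor>real b ^ Suc k * x\<rfloor> = b * nat \<lfloor>real b ^ k * x\<rfloor> + digit b (Suc k) x"
proof -
  have "\<lfloor>real b ^ k * x\<rfloor> = \<lfloor>real b ^ Suc k * x\<rfloor> div int b"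
    using assms floor_divide_real_eq_div[of "int b" "real b ^ Suc k * x"] by simp
  then have "nat \<lfloor>real b ^ k * x\<rfloor> = nat \<lfloor>real b ^ Suc k * x\<rfloor> div b"
    using assms by (simp add: nat_div_distrib)
  then show ?thesis by (simp add: digit_def)
qed

lemma length_digits [simp]: "length (digits b K x) = K"
  by (simp add: digits_def)

lemma digits_Suc: "digits b (Suc K) x = digits b K x @ [digit b (Suc K) x]"
  by (simp add: digits_def)

lemma take_digits: "k \<le> K \<Longrightarrow> take k (digits b K x) = digits b k x"
  by (simp add: digits_def take_map)

lemma digits_nth: "k < K \<Longrightarrow> digits b K x ! k = digit b (Suc k) x"
  by (simp add: digits_def)

lemma digit_less: "b > 0 \<Longrightarrow> digit b k x < b"
  by (simp add: digit_def)

lemma digits_words: "b > 0 \<Longrightarrow> digits b K x \<in> words b K"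
  by (auto simp: words_def digits_def digit_less)

text \<open>By induction with division by \<open>b\<close> with remainder; the range [0,1) settles
  \<open>k = 0\<close>, where both floors are 0.\<close>

lemma floor_eq_iff_digits_eq:
  assumes "0 \<le> x" "x < 1" "0 \<le> y" "y < 1" "b > 0"
  shows "nat \<lfloor>real b ^ k * x\<rfloor> = nat \<lfloor>real b ^ k * y\<rfloor> \<longleftrightarrow> digits b k x = digits b k y"
proof (induction k)
  case 0
  have "\<lfloor>x\<rfloor> = 0" "\<lfloor>y\<rfloor> = 0" using assms by (auto simp: floor_eq_iff)
  then show ?case by (simp add: digits_def)
next
  case (Suc k)
  have "b * p + d = b * q + e \<longleftrightarrow> p = q \<and> d = e" if "d < b" "e < b" for p q d e :: nat
  proof
    assume "b * p + d = b * q + e"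
    then have "(b * p + d) div b = (b * q + e) div b" "(b * p + d) mod b = (b * q + e) mod b" by auto
    then show "p = q \<and> d = e" using that by simp
  qed auto
  then show ?case
    unfolding floor_eq_digit[OF assms(1,5)] floor_eq_digit[OF assms(3,5)] digits_Suc
    using Suc assms by (simp add: digit_less)
qed

lemma Upsilon_eq_gain_factor:
  assumes "0 \<le> x" "x < 1" "0 \<le> y" "y < 1" "b > 0" "k < K"
  shows "Upsilon b x y k = gain_factor b (Suc k) (digits b K x) (digits b K y)"
proof -
  have *: "\<lfloor>real b ^ k * x\<rfloor> = \<lfloor>real b ^ k * y\<rfloor> \<longleftrightarrow> digits b k x = digits b k y" for k
    using floor_eq_iff_digits_eq[OF assms(1-5), of k] assms
    by (metis nat_eq_iff2 mult_nonneg_nonneg of_nat_0_le_iff zero_le_floor zero_le_power nat_0_le)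
  show ?thesis unfolding Upsilon_def gain_factor_def * using assms by (simp add: take_digits)
qed

text \<open>Components with \<open>l j = 0\<close> have gain factor 1, so the product over
  \<open>u\<close> extends to all components.\<close>

lemma gain_eq_gain_factor:
  fixes a :: "nat \<Rightarrow> real^'s::finite"
  assumes "b > 0" and a: "\<And>i j. i \<in> {1..n} \<Longrightarrow> 0 \<le> a i $ j \<and> a i $ j < 1" and l: "\<And>j. l j \<le> K"
  shows "gain b n a {j. l j \<noteq> 0} (\<lambda>j. l j - 1) =
    (1 / real n) * (\<Sum>i=1..n. \<Sum>i'=1..n. \<Prod>j\<in>UNIV. gain_factor b (l j) (digits b K (a i $ j)) (digits b K (a i' $ j)))"
proof -
  have "(\<Prod>j\<in>{j. l j \<noteq> 0}. Upsilon b (a i $ j) (a i' $ j) (l j - 1)) =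
      (\<Prod>j\<in>UNIV. gain_factor b (l j) (digits b K (a i $ j)) (digits b K (a i' $ j)))"
    if "i \<in> {1..n}" "i' \<in> {1..n}" for i i'
  proof (rule prod.mono_neutral_cong_left)
    fix j assume "j \<in> {j. l j \<noteq> 0}"
    moreover from this have "l j - 1 < K" using l[of j] by simp
    ultimately show "Upsilon b (a i $ j) (a i' $ j) (l j - 1) = gain_factor b (l j) (digits b K (a i $ j)) (digits b K (a i' $ j))"
      using a[OF that(1), of j] a[OF that(2), of j] assms(1)
      by (subst Upsilon_eq_gain_factor[of _ _ b _ K]) auto
  qed (auto simp: gain_factor_def)
  then show ?thesis unfolding gain_def by (intro arg_cong2[of _ _ _ _ "(*)"] sum.cong refl)
qed

text \<open>The half-open box lies between an open and a closed box of the same volume.\<close>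

lemma measure_adic_box:
  fixes k c :: "'s::finite \<Rightarrow> nat"
  assumes "b > 0"
  shows "measure lborel (adic_box b k c :: (real^'s) set) = 1 / real b ^ (\<Sum>j\<in>UNIV. k j)"
proof -
  let ?S = "adic_box b k c :: (real^'s) set"
  let ?l = "(\<chi> j. real (c j) / real b ^ k j) :: real^'s"
  let ?h = "(\<chi> j. (real (c j) + 1) / real b ^ k j) :: real^'s"
  have lh: "?l $ j < ?h $ j" for j using assms by (simp add: divide_strict_right_mono)
  have le: "?l \<bullet> e \<le> ?h \<bullet> e" if "e \<in> Basis" for e
    using that lh by (auto simp: Basis_vec_def inner_axis less_imp_le simp del: vec_lambda_beta)
  have "?S = (\<Inter>j. {x. ?l $ j \<le> x $ j} \<inter> {x. x $ j < ?h $ j})"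
    by (auto simp: adic_box_def)
  also have "\<dots> \<in> sets borel"
    by (intro sets.finite_INT sets.Int borel_closed borel_open closed_Collect_le open_Collect_less continuous_intros) auto
  finally have S: "?S \<in> sets borel" .
  have sub: "box ?l ?h \<subseteq> ?S" "?S \<subseteq> cbox ?l ?h"
    by (auto simp: mem_box_cart adic_box_def less_imp_le)
  have fin: "cbox ?l ?h \<in> fmeasurable lborel"
    by (rule fmeasurableI2[OF _ order_refl]) (auto simp: fmeasurable_cbox)
  have Sf: "?S \<in> fmeasurable lborel" by (rule fmeasurableI2[OF fin sub(2)]) (use S in auto)
  have "measure lborel (box ?l ?h) \<le> measure lborel ?S"
    by (rule measure_mono_fmeasurable[OF sub(1) _ Sf]) simp
  moreover have "measure lborel ?S \<le> measure lborel (cbox ?l ?h)"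
    by (rule measure_mono_fmeasurable[OF sub(2) _ fin]) (use S in simp)
  moreover have "measure lborel (box ?l ?h) = (\<Prod>e\<in>Basis. (?h - ?l) \<bullet> e)"
    using le by (simp add: measure_lborel_box_eq)
  moreover have "measure lborel (cbox ?l ?h) = (\<Prod>e\<in>Basis. (?h - ?l) \<bullet> e)"
    using le by (simp add: measure_lborel_cbox_eq)
  moreover have "(\<Prod>e\<in>Basis. (?h - ?l) \<bullet> e) = 1 / real b ^ (\<Sum>j\<in>UNIV. k j)"
  proof -
    have "measure lborel (cbox ?l ?h) = (\<Prod>j\<in>UNIV. ?h $ j - ?l $ j)"
      by (rule content_cbox_cart) (use lh in \<open>auto simp: interval_ne_empty_cart less_imp_le simp del: vec_lambda_beta\<close>)
    also have "\<dots> = (\<Prod>j\<in>UNIV. 1 / real b ^ k j)"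
      by (simp add: diff_divide_distrib[symmetric])
    finally show ?thesis using \<open>measure lborel (cbox ?l ?h) = (\<Prod>e\<in>Basis. (?h - ?l) \<bullet> e)\<close>
      by (simp add: power_sum prod_dividef)
  qed
  ultimately show ?thesis by simp
qed

section \<open>Counting net points in boxes, and vanishing gain coefficients\<close>

lemma tms_net_range:
  assumes "tms_net b t m a" "i \<in> {1..b ^ m}"
  shows "0 \<le> a i $ j \<and> a i $ j < 1"
proof -
  have "\<forall>i\<in>{1..b ^ m}. \<forall>j. 0 \<le> a i $ j \<and> a i $ j < 1" using assms(1) unfolding tms_net_def by (elim conjE)
  then show ?thesis using assms(2) by blast
qed

lemma tms_net_count:
  assumes "tms_net b t m a" "\<And>j. c j < b ^ k j"
    and "measure lborel (adic_box b k c) = real b powi (int t - int m)"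
  shows "card {i\<in>{1..b ^ m}. a i \<in> adic_box b k c} = b ^ t"
proof -
  have "\<forall>k c. (\<forall>j. c j < b ^ k j) \<longrightarrow> measure lborel (adic_box b k c) = real b powi (int t - int m) \<longrightarrow>
        card {i\<in>{1..b ^ m}. a i \<in> adic_box b k c} = b ^ t"
    using assms(1) unfolding tms_net_def by (elim conjE)
  from this[rule_format, OF assms(2,3)] show ?thesis .
qed

lemma adic_box_iff_floor:
  assumes "b > 0"
  shows "x \<in> adic_box b k c \<longleftrightarrow> (\<forall>j. \<lfloor>real b ^ k j * x $ j\<rfloor> = int (c j))"
proof -
  have "real (c j) / real b ^ k j \<le> x $ j \<and> x $ j < (real (c j) + 1) / real b ^ k j
      \<longleftrightarrow> \<lfloor>real b ^ k j * x $ j\<rfloor> = int (c j)" for j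
    using assms by (simp add: floor_eq_iff divide_le_eq less_divide_eq mult.commute)
  then show ?thesis unfolding adic_box_def by simp
qed

lemma floor_refine:
  assumes "b > 0"
  shows "\<lfloor>real b ^ k * y\<rfloor> = int c \<longleftrightarrow> (\<exists>d<b. \<lfloor>real b ^ Suc k * y\<rfloor> = int (b * c + d))"
proof -
  have fl: "\<lfloor>real b ^ k * y\<rfloor> = \<lfloor>real b ^ Suc k * y\<rfloor> div int b"
    using assms floor_divide_real_eq_div[of "int b" "real b ^ Suc k * y"] by simp
  show ?thesis
  proof
    assume l: "\<lfloor>real b ^ k * y\<rfloor> = int c"
    let ?d = "\<lfloor>real b ^ Suc k * y\<rfloor> mod int b"
    have "\<lfloor>real b ^ Suc k * y\<rfloor> = int b * int c + ?d"
      using l fl by (metis mult_div_mod_eq)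
    moreover have "0 \<le> ?d" "?d < int b" using assms by auto
    ultimately show "\<exists>d<b. \<lfloor>real b ^ Suc k * y\<rfloor> = int (b * c + d)"
      by (intro exI[of _ "nat ?d"]) auto
  next
    assume "\<exists>d<b. \<lfloor>real b ^ Suc k * y\<rfloor> = int (b * c + d)"
    then obtain d where "d < b" "\<lfloor>real b ^ Suc k * y\<rfloor> = int (b * c + d)" by (elim exE conjE)
    then show "\<lfloor>real b ^ k * y\<rfloor> = int c" unfolding fl using assms by simp
  qed
qed

lemma adic_box_refine:
  fixes x :: "real^'s::finite"
  assumes "b > 0"
  shows "x \<in> adic_box b k c \<longleftrightarrow> (\<exists>d<b. x \<in> adic_box b (k(i := Suc (k i))) (c(i := b * c i + d)))"
proof
  assume "x \<in> adic_box b k c"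
  then have x: "\<lfloor>real b ^ k j * x $ j\<rfloor> = int (c j)" for j
    using adic_box_iff_floor[OF assms, of x k c] by blast
  from iffD1[OF floor_refine[OF assms] x[of i]]
  obtain d where d: "d < b" "\<lfloor>real b ^ Suc (k i) * x $ i\<rfloor> = int (b * c i + d)" by (elim exE conjE)
  have "\<lfloor>real b ^ (k(i := Suc (k i))) j * x $ j\<rfloor> = int ((c(i := b * c i + d)) j)" for j
    using x[of j] d(2) by (cases "j = i") (simp_all del: power_Suc)
  then have "x \<in> adic_box b (k(i := Suc (k i))) (c(i := b * c i + d))"
    unfolding adic_box_iff_floor[OF assms] by (rule allI)
  then show "\<exists>d<b. x \<in> adic_box b (k(i := Suc (k i))) (c(i := b * c i + d))" using d(1) by (intro exI conjI)
next
  assume "\<exists>d<b. x \<in> adic_box b (k(i := Suc (k i))) (c(i := b * c i + d))"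
  then obtain d where d: "d < b" "x \<in> adic_box b (k(i := Suc (k i))) (c(i := b * c i + d))" by (elim exE conjE)
  then have x: "\<lfloor>real b ^ (k(i := Suc (k i))) j * x $ j\<rfloor> = int ((c(i := b * c i + d)) j)" for j
    using adic_box_iff_floor[OF assms] by blast
  have "\<lfloor>real b ^ k j * x $ j\<rfloor> = int (c j)" for j
  proof (cases "j = i")
    case True
    have "\<lfloor>real b ^ Suc (k i) * x $ i\<rfloor> = int (b * c i + d)" using x[of i] by (simp del: power_Suc)
    then have "\<exists>d<b. \<lfloor>real b ^ Suc (k i) * x $ i\<rfloor> = int (b * c i + d)" using d(1) by (intro exI conjI)
    then show ?thesis unfolding True by (rule iffD2[OF floor_refine[OF assms]])
  next
    case False
    then show ?thesis using x[of j] by simp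
  qed
  then show "x \<in> adic_box b k c" unfolding adic_box_iff_floor[OF assms] by (rule allI)
qed

lemma sum_UNIV_fun_upd:
  fixes k :: "'s::finite \<Rightarrow> nat"
  shows "(\<Sum>j\<in>UNIV. (k(i := v)) j) + k i = (\<Sum>j\<in>UNIV. k j) + v"
proof -
  have "(\<Sum>j\<in>UNIV - {i}. (k(i := v)) j) = (\<Sum>j\<in>UNIV - {i}. k j)"
    by (rule sum.cong) simp_all
  then show ?thesis
    unfolding sum.remove[OF finite UNIV_I, of k i] sum.remove[OF finite UNIV_I, of "k(i := v)" i] by simp
qed

text \<open>The net property speaks of boxes of volume b^(t-m) only. A larger box is the disjoint
  union of \<open>b\<close> boxes refined in one coordinate, so the count follows by induction on
  the number of refinements still missing.\<close>

lemma net_count_box: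
  fixes a :: "nat \<Rightarrow> real^'s::finite"
  assumes net: "tms_net b t m a" and b: "b \<ge> 2"
    and "(\<Sum>j\<in>UNIV. k j) \<le> m - t" "\<And>j. c j < b ^ k j"
  shows "card {i\<in>{1..b ^ m}. a i \<in> adic_box b k c} = b ^ (m - (\<Sum>j\<in>UNIV. k j))"
  using assms(3,4)
proof (induction "m - t - (\<Sum>j\<in>UNIV. k j)" arbitrary: k c)
  case 0
  have tm: "t \<le> m" using net unfolding tms_net_def by (elim conjE)
  have sum: "(\<Sum>j\<in>UNIV. k j) = m - t" using 0 by simp
  have "measure lborel (adic_box b k c :: (real^'s) set) = real b powi (int t - int m)"
  proof -
    have "int t - int m = - int (m - t)" using tm by simp
    then have "real b powi (int t - int m) = inverse (real b ^ (m - t))"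
      by (simp only: power_int_minus power_int_of_nat)
    moreover have "measure lborel (adic_box b k c :: (real^'s) set) = 1 / real b ^ (m - t)"
      using measure_adic_box[of b k c] b sum by simp
    ultimately show ?thesis by (simp only: inverse_eq_divide)
  qed
  then have "card {i\<in>{1..b ^ m}. a i \<in> adic_box b k c} = b ^ t"
    by (rule tms_net_count[OF net 0(3)])
  then show ?case using sum tm by simp
next
  case (Suc N)
  \<comment> \<open>An arbitrary coordinate along which to split.\<close>
  obtain i :: 's where True by simp
  let ?k = "k(i := Suc (k i))"
  let ?c = "\<lambda>d. c(i := b * c i + d)"
  let ?I = "\<lambda>k c. {i\<in>{1..b ^ m}. a i \<in> adic_box b k c}"
  have sk: "(\<Sum>j\<in>UNIV. ?k j) = Suc (\<Sum>j\<in>UNIV. k j)"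
    using sum_UNIV_fun_upd[of k i "Suc (k i)"] by linarith
  have b0: "b > 0" using b by simp
  have eq: "?I k c = (\<Union>d\<in>{..<b}. ?I ?k (?c d))"
    by (rule set_eqI) (simp add: adic_box_refine[OF b0, of _ k c i] Bex_def)
  have "card (?I k c) = (\<Sum>d\<in>{..<b}. card (?I ?k (?c d)))"
    unfolding eq
  proof (rule card_UN_disjoint)
    have "d = d'" if "x \<in> adic_box b ?k (?c d)" "x \<in> adic_box b ?k (?c d')" for x d d'
    proof -
      have "int (?c d i) = int (?c d' i)" using that unfolding adic_box_iff_floor[OF b0] by metis
      then show ?thesis by simp
    qed
    note uniq = this
    have "?I ?k (?c d) \<inter> ?I ?k (?c d') = {}" if "d \<noteq> d'" for d d'
    proof (rule equals0I)
      fix n assume n: "n \<in> ?I ?k (?c d) \<inter> ?I ?k (?c d')"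
      have "a n \<in> adic_box b ?k (?c d)" using IntD1[OF n] by simp
      moreover have "a n \<in> adic_box b ?k (?c d')" using IntD2[OF n] by simp
      ultimately show False using uniq that by simp
    qed
    then show "\<forall>d\<in>{..<b}. \<forall>d'\<in>{..<b}. d \<noteq> d' \<longrightarrow> ?I ?k (?c d) \<inter> ?I ?k (?c d') = {}" by simp
  qed simp_all
  also have "\<dots> = (\<Sum>d\<in>{..<b}. b ^ (m - (\<Sum>j\<in>UNIV. ?k j)))"
  proof (rule sum.cong[OF refl])
    fix d assume d: "d \<in> {..<b}"
    have "b * c i + d < b ^ Suc (k i)"
    proof -
      have "b * c i + d < b * (c i + 1)" using d by simp
      also have "\<dots> \<le> b * b ^ k i" using Suc.prems(2)[of i] by (intro mult_le_mono2) simp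
      finally show ?thesis by simp
    qed
    then have c: "?c d j < b ^ ?k j" for j using Suc.prems(2)[of j] by (cases "j = i") simp_all
    have k: "N = m - t - (\<Sum>j\<in>UNIV. ?k j)" "(\<Sum>j\<in>UNIV. ?k j) \<le> m - t"
      unfolding sk using Suc.hyps(2) by linarith+
    show "card (?I ?k (?c d)) = b ^ (m - (\<Sum>j\<in>UNIV. ?k j))"
      by (rule Suc.hyps(1)[OF k c])
  qed
  also have "\<dots> = b ^ (m - (\<Sum>j\<in>UNIV. k j))"
  proof -
    have "m - (\<Sum>j\<in>UNIV. k j) = Suc (m - (\<Sum>j\<in>UNIV. ?k j))" unfolding sk using Suc.hyps(2) by linarith
    then show ?thesis by simp
  qed
  finally show ?case .
qed

lemma net_count_digits:
  fixes a :: "nat \<Rightarrow> real^'s::finite"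
  assumes net: "tms_net b t m a" and b: "b \<ge> 2" and k: "(\<Sum>j\<in>UNIV. k j) \<le> m - t"
    and x: "\<And>j. 0 \<le> x j \<and> x j < 1"
  shows "card {i\<in>{1..b ^ m}. \<forall>j. digits b (k j) (a i $ j) = digits b (k j) (x j)} = b ^ (m - (\<Sum>j\<in>UNIV. k j))"
proof -
  let ?c = "\<lambda>j. nat \<lfloor>real b ^ k j * x j\<rfloor>"
  have b0: "real b > 0" using b by simp
  have "?c j < b ^ k j" for j
  proof -
    have "real b ^ k j * x j < real b ^ k j * 1" using x[of j] b0 by (intro mult_strict_left_mono) auto
    then show ?thesis using x[of j] by (simp add: nat_less_iff floor_less_iff)
  qed
  note c = this
  have mem: "(a i \<in> adic_box b k ?c) = (\<forall>j. digits b (k j) (a i $ j) = digits b (k j) (x j))" if "i \<in> {1..b ^ m}" for i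
  proof -
    have ai: "0 \<le> a i $ j" "a i $ j < 1" for j using tms_net_range[OF net that] by auto
    have "\<lfloor>real b ^ k j * a i $ j\<rfloor> = int (?c j) \<longleftrightarrow> (digits b (k j) (a i $ j) = digits b (k j) (x j))" for j
    proof -
      have "\<lfloor>real b ^ k j * a i $ j\<rfloor> = int (?c j) \<longleftrightarrow> nat \<lfloor>real b ^ k j * a i $ j\<rfloor> = ?c j"
      proof -
        have "p = int (nat q) \<longleftrightarrow> nat p = nat q" if "0 \<le> p" "0 \<le> q" for p q using that by auto
        then show ?thesis using ai[of j] x[of j] by simp
      qed
      also have "\<dots> \<longleftrightarrow> digits b (k j) (a i $ j) = digits b (k j) (x j)"
        using ai[of j] x[of j] b by (intro floor_eq_iff_digits_eq) auto
      finally show ?thesis .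
    qed
    then show ?thesis using b by (simp add: adic_box_iff_floor)
  qed
  have "{i\<in>{1..b ^ m}. a i \<in> adic_box b k ?c} = {i\<in>{1..b ^ m}. \<forall>j. digits b (k j) (a i $ j) = digits b (k j) (x j)}"
    by (intro Collect_cong conj_cong refl mem)
  then show ?thesis using net_count_box[OF net b k c] by simp
qed

text \<open>The inner sum already vanishes for each fixed point \<open>i0\<close>. Asking for one
  digit less in one component multiplies the number of matching points by \<open>b\<close>, as long
  as the boxes are large enough for the net property, so each difference in \<open>Upsilon\<close>
  cancels exactly.\<close>

lemma net_gain_zero:
  fixes a :: "nat \<Rightarrow> real^'s::finite"
  assumes net: "tms_net b t m a" and b: "b \<ge> 2" and l: "(\<Sum>j\<in>UNIV. l j) \<le> m - t" "l \<noteq> (\<lambda>_. 0)" "\<And>j. l j \<le> K"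
  shows "(\<Sum>i=1..b ^ m. \<Sum>i'=1..b ^ m. \<Prod>j\<in>UNIV. gain_factor b (l j) (digits b K (a i $ j)) (digits b K (a i' $ j))) = 0"
proof (rule sum.neutral, rule ballI)
  fix i0 assume i0: "i0 \<in> {1..b ^ m}"
  define I where "I i j k = (of_bool (digits b k (a i0 $ j) = digits b k (a i $ j)) :: real)" for i j k
  \<comment> \<open>Interpolates between plain counts and gain sums: components in \<open>v\<close>
    carry the difference factor of \<open>Upsilon\<close>, the others the indicator of common
    digits.\<close>
  define T where "T v k = (\<Sum>i=1..b ^ m. (\<Prod>j\<in>v. real b * I i j (k j) - I i j (k j - 1)) * (\<Prod>j\<in>-v. I i j (k j)))"
    for v :: "'s set" and k
  have T0: "T {} k = real b ^ (m - (\<Sum>j\<in>UNIV. k j))" if "(\<Sum>j\<in>UNIV. k j) \<le> m - t" for k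
  proof -
    have x: "0 \<le> a i0 $ j \<and> a i0 $ j < 1" for j by (rule tms_net_range[OF net i0])
    have "T {} k = (\<Sum>i=1..b ^ m. of_bool (\<forall>j. digits b (k j) (a i0 $ j) = digits b (k j) (a i $ j)))"
      unfolding T_def I_def by (intro sum.cong refl) (auto simp: prod_zero_iff intro!: prod.neutral)
    also have "\<dots> = real (card {i\<in>{1..b ^ m}. \<forall>j. digits b (k j) (a i0 $ j) = digits b (k j) (a i $ j)})"
      by (simp add: sum_of_bool_eq Int_def)
    also have "\<dots> = real (b ^ (m - (\<Sum>j\<in>UNIV. k j)))"
      using net_count_digits[OF net b that x] unfolding eq_commute[of "digits b _ (a i0 $ _)"] by presburger
    also have "\<dots> = real b ^ (m - (\<Sum>j\<in>UNIV. k j))" by simp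
    finally show ?thesis .
  qed
  have Tins: "T (insert j v) k = real b * T v k - T v (k(j := k j - 1))" if "j \<notin> v" for j v k
  proof -
    have "(\<Prod>j\<in>insert j v. real b * I i j (k j) - I i j (k j - 1)) * (\<Prod>j\<in>-insert j v. I i j (k j)) =
       real b * ((\<Prod>j\<in>v. real b * I i j (k j) - I i j (k j - 1)) * (\<Prod>j\<in>-v. I i j (k j)))
       - (\<Prod>j'\<in>v. real b * I i j' ((k(j := k j - 1)) j') - I i j' ((k(j := k j - 1)) j' - 1)) * (\<Prod>j'\<in>-v. I i j' ((k(j := k j - 1)) j'))" for i
    proof -
      have e: "- v - {j} = - insert j v" by auto
      have 1: "(\<Prod>j\<in>-v. I i j (k j)) = I i j (k j) * (\<Prod>j\<in>-insert j v. I i j (k j))"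
        using that prod.remove[of "-v" j "\<lambda>j. I i j (k j)"] unfolding e by simp
      have 2: "(\<Prod>j'\<in>-v. I i j' ((k(j := k j - 1)) j')) = I i j (k j - 1) * (\<Prod>j\<in>-insert j v. I i j (k j))"
      proof -
        have "(\<Prod>j'\<in>-insert j v. I i j' ((k(j := k j - 1)) j')) = (\<Prod>j\<in>-insert j v. I i j (k j))"
          by (rule prod.cong) auto
        then show ?thesis using that prod.remove[of "-v" j "\<lambda>j'. I i j' ((k(j := k j - 1)) j')"] unfolding e by simp
      qed
      have 3: "(\<Prod>j'\<in>v. real b * I i j' ((k(j := k j - 1)) j') - I i j' ((k(j := k j - 1)) j' - 1)) = (\<Prod>j\<in>v. real b * I i j (k j) - I i j (k j - 1))"
        using that by (intro prod.cong) auto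
      show ?thesis unfolding 1 2 3 using that by (simp add: algebra_simps)
    qed
    then show ?thesis unfolding T_def by (simp only: sum_subtractf sum_distrib_left)
  qed
  \<comment> \<open>With a single differenced component this is b * b^(m-|k|) - b^(m-|k|+1) = 0;
    each further difference combines two zeros.\<close>
  have Tz: "T v k = 0" if "finite v" "v \<noteq> {}" "(\<Sum>j\<in>UNIV. k j) \<le> m - t" "\<And>j. j \<in> v \<Longrightarrow> k j \<noteq> 0" for v k
    using that
  proof (induction v arbitrary: k rule: finite_ne_induct)
    case (singleton j)
    have s: "(\<Sum>i\<in>UNIV. k i) = Suc (\<Sum>i\<in>UNIV. (k(j := k j - 1)) i)"
      using singleton(2)[of j] sum_UNIV_fun_upd[of k j "k j - 1"] by simp
    then have "m - (\<Sum>i\<in>UNIV. (k(j := k j - 1)) i) = Suc (m - (\<Sum>i\<in>UNIV. k i))"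
      using singleton(1) by simp
    then show ?case using Tins[of j "{}" k] T0[of k] T0[of "k(j := k j - 1)"] singleton(1) s by simp
  next
    case (insert j v)
    have "(\<Sum>i\<in>UNIV. (k(j := k j - 1)) i) \<le> (\<Sum>i\<in>UNIV. k i)" by (intro sum_mono) auto
    then have "T v (k(j := k j - 1)) = 0" using insert by (intro insert.IH) auto
    moreover have "T v k = 0" using insert by (intro insert.IH) auto
    ultimately show ?case using Tins[of j v k] insert by simp
  qed
  let ?u = "{j. l j \<noteq> 0}"
  have "(\<Prod>j\<in>UNIV. gain_factor b (l j) (digits b K (a i0 $ j)) (digits b K (a i $ j))) =
      ((\<Prod>j\<in>?u. real b * I i j (l j) - I i j (l j - 1)) * (\<Prod>j\<in>-?u. I i j (l j))) / (real b - 1) ^ card ?u" for i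
  proof -
    have "(\<Prod>j\<in>UNIV. gain_factor b (l j) (digits b K (a i0 $ j)) (digits b K (a i $ j))) =
       (\<Prod>j\<in>?u. (real b * I i j (l j) - I i j (l j - 1)) / (real b - 1))"
    proof (rule prod.mono_neutral_cong_right)
      fix j assume "j \<in> ?u"
      then show "gain_factor b (l j) (digits b K (a i0 $ j)) (digits b K (a i $ j)) = (real b * I i j (l j) - I i j (l j - 1)) / (real b - 1)"
        using l(3)[of j] by (simp add: gain_factor_def I_def take_digits)
    qed (auto simp: gain_factor_def)
    moreover have "(\<Prod>j\<in>-?u. I i j (l j)) = 1" by (intro prod.neutral) (auto simp: I_def digits_def)
    ultimately show ?thesis by (simp add: prod_dividef)
  qed
  then have "(\<Sum>i'=1..b ^ m. \<Prod>j\<in>UNIV. gain_factor b (l j) (digits b K (a i0 $ j)) (digits b K (a i' $ j)))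
      = T ?u l / (real b - 1) ^ card ?u"
    unfolding T_def by (simp only: sum_divide_distrib)
  also have "\<dots> = 0"
  proof -
    have "?u \<noteq> {}" using l(2) by (auto simp: fun_eq_iff)
    then show ?thesis using Tz[of ?u l] l(1) by simp
  qed
  finally show "(\<Sum>i'=1..b ^ m. \<Prod>j\<in>UNIV. gain_factor b (l j) (digits b K (a i0 $ j)) (digits b K (a i' $ j))) = 0" .
qed


section \<open>Summation over levels\<close>

text \<open>Termwise differentiation of the series with exponent \<open>p\<close> gives coefficients
  (n+1)(n+2)^p, which dominate (n+1)^(p+1).\<close>

lemma summable_poly_geometric:
  fixes x :: real
  assumes "\<bar>x\<bar> < 1"
  shows "summable (\<lambda>n. real (Suc n) ^ p * x ^ n)"
proof -
  have "summable (\<lambda>n. real (Suc n) ^ p * x ^ n)" if "0 \<le> x" "x < 1" for x :: real and p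
    using that
  proof (induction p arbitrary: x)
    case 0
    then show ?case by (simp add: summable_geometric)
  next
    case (Suc p)
    have all: "summable (\<lambda>n. real (Suc n) ^ p * y ^ n)" if "norm y < 1" for y :: real
    proof (rule summable_norm_cancel)
      have "summable (\<lambda>n. real (Suc n) ^ p * \<bar>y\<bar> ^ n)" using Suc.IH[of "\<bar>y\<bar>"] that by simp
      then show "summable (\<lambda>n. norm (real (Suc n) ^ p * y ^ n))" by (simp add: abs_mult power_abs)
    qed
    have "summable (\<lambda>n. diffs (\<lambda>n. real (Suc n) ^ p) n * x ^ n)"
      by (rule termdiff_converges[where K = 1]) (use Suc.prems all in auto)
    then show ?case
    proof (rule summable_comparison_test')
      fix n
      have "real (Suc n) ^ p \<le> real (Suc (Suc n)) ^ p" by (intro power_mono) auto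
      then have "real (Suc n) ^ Suc p * x ^ n \<le> diffs (\<lambda>n. real (Suc n) ^ p) n * x ^ n"
        unfolding diffs_def using Suc.prems(1) by (intro mult_right_mono) (simp_all del: of_nat_Suc)
      then show "norm (real (Suc n) ^ Suc p * x ^ n) \<le> diffs (\<lambda>n. real (Suc n) ^ p) n * x ^ n"
        using Suc.prems(1) by (simp add: abs_mult)
    qed
  qed
  from this[of "\<bar>x\<bar>" p] assms have "summable (\<lambda>n. norm (real (Suc n) ^ p * x ^ n))"
    by (simp add: abs_mult power_abs)
  then show ?thesis by (rule summable_norm_cancel)
qed

text \<open>A level of given total \<open>r\<close> is determined by all but one of its entries,
  each of which is at most \<open>r\<close>. This is the origin of the exponent s - 1 of the
  logarithm.\<close>

lemma card_levels_le:
  "card {l \<in> (UNIV :: 's::finite set) \<rightarrow>\<^sub>E {..K}. (\<Sum>j\<in>UNIV. l j) = r} \<le> Suc r ^ (CARD('s) - 1)"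
proof -
  obtain i :: 's where True by simp
  let ?S = "{l \<in> (UNIV :: 's set) \<rightarrow>\<^sub>E {..K}. (\<Sum>j\<in>UNIV. l j) = r}"
  let ?f = "\<lambda>l. restrict l (UNIV - {i})"
  have "card ?S \<le> card ((UNIV - {i}) \<rightarrow>\<^sub>E {..r})"
  proof (rule card_inj_on_le[of ?f])
    show "inj_on ?f ?S"
    proof (rule inj_onI)
      fix l l' assume l: "l \<in> ?S" "l' \<in> ?S" and eq: "?f l = ?f l'"
      have off: "l j = l' j" if "j \<noteq> i" for j
        using fun_cong[OF eq, of j] that by simp
      have "l i + (\<Sum>j\<in>UNIV - {i}. l j) = l' i + (\<Sum>j\<in>UNIV - {i}. l' j)"
        using l sum.remove[OF finite UNIV_I, of l i] sum.remove[OF finite UNIV_I, of l' i] by simp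
      moreover have "(\<Sum>j\<in>UNIV - {i}. l j) = (\<Sum>j\<in>UNIV - {i}. l' j)"
        by (rule sum.cong) (use off in auto)
      ultimately have "l i = l' i" by simp
      then show "l = l'" using off by (metis ext)
    qed
    show "?f ` ?S \<subseteq> (UNIV - {i}) \<rightarrow>\<^sub>E {..r}"
    proof
      fix h assume "h \<in> ?f ` ?S"
      then obtain l where l: "h = ?f l" "(\<Sum>j\<in>UNIV. l j) = r" by blast
      have "l j \<le> r" for j using member_le_sum[of j UNIV l] l(2) by simp
      then show "h \<in> (UNIV - {i}) \<rightarrow>\<^sub>E {..r}" unfolding l(1) by simp
    qed
  qed (simp add: finite_PiE)
  also have "\<dots> = Suc r ^ (CARD('s) - 1)" by (simp add: card_PiE card_Diff_subset)
  finally show ?thesis .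
qed

lemma level_tail_sum:
  fixes \<theta> :: real
  assumes "0 < \<theta>" "\<theta> < 1"
  obtains C where "C \<ge> 0" "\<And>R K. (\<Sum>l\<in>{l \<in> (UNIV :: 's::finite set) \<rightarrow>\<^sub>E {..K}. R < (\<Sum>j\<in>UNIV. l j)}. \<theta> ^ (\<Sum>j\<in>UNIV. l j))
     \<le> C * real (R + 2) ^ (CARD('s) - 1) * \<theta> ^ R"
proof -
  let ?p = "CARD('s) - 1"
  define C where "C = (\<Sum>n. real (Suc n) ^ ?p * \<theta> ^ n)"
  have smm: "summable (\<lambda>n. real (Suc n) ^ ?p * \<theta> ^ n)"
    using assms by (intro summable_poly_geometric) auto
  have C0: "C \<ge> 0" unfolding C_def using assms by (intro suminf_nonneg smm) auto
  have "(\<Sum>l\<in>{l \<in> (UNIV :: 's set) \<rightarrow>\<^sub>E {..K}. R < (\<Sum>j\<in>UNIV. l j)}. \<theta> ^ (\<Sum>j\<in>UNIV. l j))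
     \<le> C * real (R + 2) ^ ?p * \<theta> ^ R" for R K
  proof -
    let ?S = "{l \<in> (UNIV :: 's set) \<rightarrow>\<^sub>E {..K}. R < (\<Sum>j\<in>UNIV. l j)}"
    let ?N = "CARD('s) * K"
    let ?T = "(\<lambda>i. R + 1 + i) ` {..<?N}"
    have fin: "finite ?S" by (rule finite_subset[of _ "(UNIV :: 's set) \<rightarrow>\<^sub>E {..K}"]) (auto intro: finite_PiE)
    have sub: "(\<lambda>l. \<Sum>j\<in>UNIV. l j) ` ?S \<subseteq> ?T"
    proof
      fix r assume "r \<in> (\<lambda>l. \<Sum>j\<in>UNIV. l j) ` ?S"
      then obtain l where l: "l \<in> (UNIV :: 's set) \<rightarrow>\<^sub>E {..K}" "R < r" "r = (\<Sum>j\<in>UNIV. l j)" by blast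
      have "l j \<le> K" for j using l(1) by auto
      then have "r \<le> ?N" unfolding l(3) using sum_bounded_above[of UNIV l K] by simp
      then show "r \<in> ?T" using l(2) by (intro image_eqI[of _ _ "r - (R + 1)"]) auto
    qed
    have "(\<Sum>l\<in>?S. \<theta> ^ (\<Sum>j\<in>UNIV. l j)) = (\<Sum>r\<in>?T. \<Sum>l\<in>{l \<in> ?S. (\<Sum>j\<in>UNIV. l j) = r}. \<theta> ^ (\<Sum>j\<in>UNIV. l j))"
      by (rule sum.group[OF fin _ sub, symmetric]) simp
    also have "\<dots> \<le> (\<Sum>r\<in>?T. real (Suc r) ^ ?p * \<theta> ^ r)"
    proof (rule sum_mono)
      fix r
      have "(\<Sum>l\<in>{l \<in> ?S. (\<Sum>j\<in>UNIV. l j) = r}. \<theta> ^ (\<Sum>j\<in>UNIV. l j)) = real (card {l \<in> ?S. (\<Sum>j\<in>UNIV. l j) = r}) * \<theta> ^ r"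
        by simp
      also have "\<dots> \<le> real (Suc r ^ ?p) * \<theta> ^ r"
      proof (intro mult_right_mono of_nat_mono)
        have "card {l \<in> ?S. (\<Sum>j\<in>UNIV. l j) = r} \<le> card {l \<in> (UNIV :: 's set) \<rightarrow>\<^sub>E {..K}. (\<Sum>j\<in>UNIV. l j) = r}"
          by (rule card_mono) (auto intro: finite_subset[OF _ finite_PiE[of UNIV "\<lambda>_. {..K}"]])
        also have "\<dots> \<le> Suc r ^ ?p" by (rule card_levels_le)
        finally show "card {l \<in> ?S. (\<Sum>j\<in>UNIV. l j) = r} \<le> Suc r ^ ?p" .
      qed (use assms in simp)
      finally show "(\<Sum>l\<in>{l \<in> ?S. (\<Sum>j\<in>UNIV. l j) = r}. \<theta> ^ (\<Sum>j\<in>UNIV. l j)) \<le> real (Suc r) ^ ?p * \<theta> ^ r" by simp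
    qed
    also have "\<dots> = (\<Sum>i<?N. real (Suc (R + 1 + i)) ^ ?p * \<theta> ^ (R + 1 + i))"
      by (subst sum.reindex) (auto simp: inj_on_def)
    also have "\<dots> \<le> (\<Sum>i<?N. (real (R + 2) ^ ?p * \<theta> ^ R) * (real (Suc i) ^ ?p * \<theta> ^ i))"
    proof (rule sum_mono)
      fix i
      \<comment> \<open>Separates \<open>R\<close> from the summation index, so that one convergent
        series serves every \<open>R\<close> and \<open>K\<close>.\<close>
      have "real (Suc (R + 1 + i)) \<le> real (R + 2) * real (Suc i)"
        by (simp add: algebra_simps)
      then have "real (Suc (R + 1 + i)) ^ ?p \<le> (real (R + 2) * real (Suc i)) ^ ?p"
        by (intro power_mono) auto
      moreover have "\<theta> ^ (R + 1 + i) \<le> \<theta> ^ (R + i)" using assms by (intro power_decreasing) auto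
      ultimately have "real (Suc (R + 1 + i)) ^ ?p * \<theta> ^ (R + 1 + i) \<le> (real (R + 2) * real (Suc i)) ^ ?p * \<theta> ^ (R + i)"
        using assms by (intro mult_mono) auto
      then show "real (Suc (R + 1 + i)) ^ ?p * \<theta> ^ (R + 1 + i) \<le> (real (R + 2) ^ ?p * \<theta> ^ R) * (real (Suc i) ^ ?p * \<theta> ^ i)"
        by (simp only: power_mult_distrib power_add mult_ac)
    qed
    also have "\<dots> = (real (R + 2) ^ ?p * \<theta> ^ R) * (\<Sum>i<?N. real (Suc i) ^ ?p * \<theta> ^ i)"
      by (rule sum_distrib_left[symmetric])
    also have "\<dots> \<le> (real (R + 2) ^ ?p * \<theta> ^ R) * C"
      unfolding C_def using assms by (intro mult_left_mono sum_le_suminf smm) auto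
    finally show ?thesis by (simp only: mult_ac)
  qed
  with C0 show ?thesis by (rule that)
qed


section \<open>The law of the scrambled words\<close>

text \<open>Composing with a transposition maps the permutations with p d = z injectively to those
  with p d = z', so the \<open>b\<close> classes have equal size.\<close>

lemma card_permutes_1:
  assumes "d < b" "y < b"
  shows "real (card {p. p permutes {..<b} \<and> p d = y}) = fact b / real b"
proof -
  let ?F = "\<lambda>y. {p. p permutes {..<b} \<and> p d = y}"
  have fin: "finite (?F z)" for z
    by (rule finite_subset[OF _ finite_permutations[of "{..<b}"]]) auto
  have le: "card (?F z) \<le> card (?F z')" if "z < b" "z' < b" for z z'
  proof (rule card_inj_on_le[of "\<lambda>p. Transposition.transpose z z' \<circ> p"])
    show "inj_on (\<lambda>p. Transposition.transpose z z' \<circ> p) (?F z)"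
      by (auto simp: inj_on_def fun_eq_iff) (metis transpose_involutory)
    show "(\<lambda>p. Transposition.transpose z z' \<circ> p) ` ?F z \<subseteq> ?F z'"
      using that by (auto intro!: permutes_compose permutes_swap_id)
  qed (rule fin)
  have "{p. p permutes {..<b}} = (\<Union>z\<in>{..<b}. ?F z)"
    using assms permutes_in_image[of _ "{..<b}" d] by auto
  then have "fact b = card (\<Union>z\<in>{..<b}. ?F z)"
    by (metis card_permutations card_lessThan finite_lessThan)
  also have "\<dots> = (\<Sum>z<b. card (?F z))"
    by (rule card_UN_disjoint) (auto simp: fin)
  also have "\<dots> = (\<Sum>z<b. card (?F y))"
    using le assms by (intro sum.cong refl antisym) auto
  finally have "fact b = b * card (?F y)" by simp
  then have "(fact b :: real) = real b * real (card (?F y))" by (metis of_nat_fact of_nat_mult)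
  then show ?thesis using assms by simp
qed

text \<open>The same argument within the class p d = y: the value at \<open>d'\<close> is
  equidistributed over the b - 1 letters other than \<open>y\<close>.\<close>

lemma card_permutes_2:
  assumes "d < b" "d' < b" "d \<noteq> d'" "y < b" "y' < b"
  shows "real (card {p. p permutes {..<b} \<and> p d = y \<and> p d' = y'}) = of_bool (y \<noteq> y') * (fact b / (real b * (real b - 1)))"
proof (cases "y = y'")
  case True
  have "{p. p permutes {..<b} \<and> p d = y \<and> p d' = y'} = {}"
  proof (rule equals0I)
    fix p assume p: "p \<in> {p. p permutes {..<b} \<and> p d = y \<and> p d' = y'}"
    then have "inj p" by (auto intro: permutes_inj)
    then show False using p True assms(3) by (auto dest: injD)
  qed
  then have "card {p. p permutes {..<b} \<and> p d = y \<and> p d' = y'} = 0" by (simp only: card.empty)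
  then show ?thesis using True by simp
next
  case False
  let ?F = "\<lambda>z. {p. p permutes {..<b} \<and> p d = y \<and> p d' = z}"
  let ?S = "{..<b} - {y}"
  have fin: "finite (?F z)" for z
    by (rule finite_subset[OF _ finite_permutations[of "{..<b}"]]) auto
  have le: "card (?F z) \<le> card (?F z')" if "z \<in> ?S" "z' \<in> ?S" for z z'
  proof (rule card_inj_on_le[of "\<lambda>p. Transposition.transpose z z' \<circ> p"])
    show "inj_on (\<lambda>p. Transposition.transpose z z' \<circ> p) (?F z)"
      by (auto simp: inj_on_def fun_eq_iff) (metis transpose_involutory)
    show "(\<lambda>p. Transposition.transpose z z' \<circ> p) ` ?F z \<subseteq> ?F z'"
      using that by (auto intro!: permutes_compose permutes_swap_id simp: transpose_apply_other)
  qed (rule fin)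
  have "{p. p permutes {..<b} \<and> p d = y} = (\<Union>z\<in>?S. ?F z)"
  proof -
    have "p d' \<in> ?S" if p: "p permutes {..<b}" "p d = y" for p
    proof -
      have "p d' \<in> {..<b}" using permutes_in_image[OF p(1), of d'] assms(2) by simp
      moreover have "p d' \<noteq> p d" using permutes_inj[OF p(1)] assms(3) by (metis injD)
      ultimately show ?thesis using p(2) by simp
    qed
    then show ?thesis by blast
  qed
  then have "card {p. p permutes {..<b} \<and> p d = y} = card (\<Union>z\<in>?S. ?F z)" by simp
  also have "\<dots> = (\<Sum>z\<in>?S. card (?F z))"
    by (rule card_UN_disjoint) (auto simp: fin)
  also have "\<dots> = (\<Sum>z\<in>?S. card (?F y'))"
    using le assms False by (intro sum.cong refl antisym) auto
  also have "\<dots> = (b - 1) * card (?F y')" using assms by (simp add: card_Diff_subset)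
  finally have eq: "fact b / real b = (real b - 1) * real (card (?F y'))"
    using card_permutes_1[OF assms(1,4)] assms(1) by (simp add: of_nat_diff)
  have "real b > 1" using assms(1-3) by linarith
  then show ?thesis using eq False by (simp add: field_simps)
qed

text \<open>The scrambled letters before they are summed to a number. They can differ from the
  digits of that number, which never end in a constant sequence of b - 1.\<close>

definition scrambled_word :: "nat \<Rightarrow> nat \<Rightarrow> (nat list \<Rightarrow> nat \<Rightarrow> nat) \<Rightarrow> real \<Rightarrow> nat list" where
  "scrambled_word b K \<pi> x = map (\<lambda>k. \<pi> (digits b k x) (digit b (Suc k) x)) [0..<K]"

lemma scrambled_word_eq_iff:
  "length w = K \<Longrightarrow> scrambled_word b K \<pi> x = w \<longleftrightarrow> (\<forall>k<K. \<pi> (digits b k x) (digit b (Suc k) x) = w ! k)"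
  by (auto simp: scrambled_word_def list_eq_iff_nth_eq)

lemma words_nth_less: "x \<in> words b K \<Longrightarrow> k < K \<Longrightarrow> x ! k < b"
  unfolding words_def by (metis (mono_tags, lifting) lessThan_iff mem_Collect_eq nth_mem subsetD)

text \<open>Fixes the permutations that \<open>nested_uniform_scramble\<close> only asserts to
  exist.\<close>

locale scrambling = prob_space M for M :: "'w measure" +
  fixes b :: nat and \<pi> :: "'s::finite \<times> nat list \<Rightarrow> 'w \<Rightarrow> nat \<Rightarrow> nat"
  assumes b: "b \<ge> 2"
    and indep: "indep_vars (\<lambda>_. count_space {p. p permutes {..<b}}) \<pi> (UNIV \<times> lists {..<b})"
    and unif: "\<And>q. q \<in> UNIV \<times> lists {..<b} \<Longrightarrow>
       distr M (count_space {p. p permutes {..<b}}) (\<pi> q) = uniform_count_measure {p. p permutes {..<b}}"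
begin

abbreviation "Perms \<equiv> {p. p permutes {..<b}}"

lemma measurable_perm: "q \<in> UNIV \<times> lists {..<b} \<Longrightarrow> \<pi> q \<in> measurable M (count_space Perms)"
  using indep unfolding indep_vars_def by (elim conjE ballE) auto

lemma perm_permutes: "q \<in> UNIV \<times> lists {..<b} \<Longrightarrow> \<omega> \<in> space M \<Longrightarrow> \<pi> q \<omega> permutes {..<b}"
  using measurable_space[OF measurable_perm, of q \<omega>] by simp

lemma digits_lists: "digits b k x \<in> lists {..<b}"
  using b by (auto simp: digits_def digit_less)

lemma perm_digit_less:
  assumes "\<omega> \<in> space M"
  shows "\<pi> (j, digits b k x) \<omega> (digit b (Suc k) x) < b"
proof -
  have "\<pi> (j, digits b k x) \<omega> permutes {..<b}"
    using assms digits_lists by (intro perm_permutes) auto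
  from permutes_in_image[OF this, of "digit b (Suc k) x"] show ?thesis
    using b digit_less[of b "Suc k" x] by simp
qed

lemma prob_perm:
  assumes "q \<in> UNIV \<times> lists {..<b}" "B \<subseteq> Perms"
  shows "prob (\<pi> q -` B \<inter> space M) = real (card B) / fact b"
proof -
  have "prob (\<pi> q -` B \<inter> space M) = measure (distr M (count_space Perms) (\<pi> q)) B"
    using assms by (intro measure_distr[symmetric] measurable_perm) auto
  also have "\<dots> = measure (uniform_count_measure Perms) B" using unif[OF assms(1)] by simp
  also have "\<dots> = real (card B) / real (card Perms)"
    using assms by (intro measure_uniform_count_measure finite_permutations) auto
  also have "card Perms = fact b" by (rule card_permutations) auto
  finally show ?thesis by simp
qed

lemma prob_perms:
  assumes "finite J" "J \<noteq> {}" "J \<subseteq> UNIV \<times> lists {..<b}" "\<And>q. q \<in> J \<Longrightarrow> B q \<subseteq> Perms"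
  shows "(\<Inter>q\<in>J. \<pi> q -` B q \<inter> space M) \<in> events"
    and "prob (\<Inter>q\<in>J. \<pi> q -` B q \<inter> space M) = (\<Prod>q\<in>J. real (card (B q)) / fact b)"
proof -
  show "(\<Inter>q\<in>J. \<pi> q -` B q \<inter> space M) \<in> events"
    using assms by (intro sets.finite_INT measurable_sets[OF measurable_perm]) auto
  have "prob (\<Inter>q\<in>J. \<pi> q -` B q \<inter> space M) = (\<Prod>q\<in>J. prob (\<pi> q -` B q \<inter> space M))"
    using assms by (intro indep_varsD[OF indep]) auto
  also have "\<dots> = (\<Prod>q\<in>J. real (card (B q)) / fact b)"
    using assms by (intro prod.cong refl prob_perm) auto
  finally show "prob (\<Inter>q\<in>J. \<pi> q -` B q \<inter> space M) = (\<Prod>q\<in>J. real (card (B q)) / fact b)" .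
qed

abbreviation "word K j \<omega> x \<equiv> scrambled_word b K (\<lambda>w. \<pi> (j, w) \<omega>) x"

lemma word_in_words: "\<omega> \<in> space M \<Longrightarrow> word K j \<omega> x \<in> words b K"
  by (auto simp: words_def scrambled_word_def perm_digit_less)

definition pair_event :: "nat \<Rightarrow> ('s \<Rightarrow> real) \<Rightarrow> ('s \<Rightarrow> real) \<Rightarrow> ('s \<Rightarrow> nat list) \<Rightarrow> ('s \<Rightarrow> nat list) \<Rightarrow> 'w set" where
  "pair_event K \<alpha> \<alpha>' x x' = {\<omega> \<in> space M. \<forall>j. word K j \<omega> (\<alpha> j) = x j \<and> word K j \<omega> (\<alpha>' j) = x' j}"

text \<open>The event constrains finitely many permutations, grouped by component and level. In a
  group the two branches either use different permutations, which are independent, or one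
  permutation with a joint constraint; these are the cases of \<open>level_prob\<close>.\<close>

lemma pair_event:
  assumes "K > 0" and x: "\<And>j. x j \<in> words b K" "\<And>j. x' j \<in> words b K"
  shows "pair_event K \<alpha> \<alpha>' x x' \<in> events"
    and "prob (pair_event K \<alpha> \<alpha>' x x') =
      (\<Prod>j\<in>UNIV. \<Prod>k<K. level_prob b (digits b K (\<alpha> j)) (digits b K (\<alpha>' j)) (x j) (x' j) k)"
proof -
  let ?d = "\<lambda>k y. digit b (Suc k) y"
  \<comment> \<open>The constraint on the permutation at an address, whose length is the level. If
    both branches pass through the address, both constraints fall on the same permutation.\<close>
  define B where "B = (\<lambda>(j, w). {p. p permutes {..<b} \<and>
      (w = digits b (length w) (\<alpha> j) \<longrightarrow> p (?d (length w) (\<alpha> j)) = x j ! length w) \<and>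
      (w = digits b (length w) (\<alpha>' j) \<longrightarrow> p (?d (length w) (\<alpha>' j)) = x' j ! length w)})"
  define Q where "Q = (\<lambda>(j, k). {(j, digits b k (\<alpha> j)), (j, digits b k (\<alpha>' j))})"
  define I where "I = (UNIV :: 's set) \<times> {..<K}"
  define J where "J = (\<Union>i\<in>I. Q i)"
  \<comment> \<open>Independence is applied to a nonempty family, which is why \<open>K > 0\<close>
    is required.\<close>
  have finJ: "finite J" "J \<noteq> {}" using assms(1) by (auto simp: J_def I_def Q_def)
  have subJ: "J \<subseteq> UNIV \<times> lists {..<b}" using digits_lists by (auto simp: J_def Q_def)
  have BP: "B q \<subseteq> Perms" for q by (auto simp: B_def split: prod.splits)
  have B: "B (j, digits b k y) = {p. p permutes {..<b} \<and>
      (digits b k y = digits b k (\<alpha> j) \<longrightarrow> p (?d k (\<alpha> j)) = x j ! k) \<and>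
      (digits b k y = digits b k (\<alpha>' j) \<longrightarrow> p (?d k (\<alpha>' j)) = x' j ! k)}" for j k y
    by (simp add: B_def)
  have E: "pair_event K \<alpha> \<alpha>' x x' = (\<Inter>q\<in>J. \<pi> q -` B q \<inter> space M)"
  proof (intro equalityI subsetI)
    fix \<omega> assume "\<omega> \<in> pair_event K \<alpha> \<alpha>' x x'"
    then have \<omega>: "\<omega> \<in> space M" and eq: "word K j \<omega> (\<alpha> j) = x j" "word K j \<omega> (\<alpha>' j) = x' j" for j
      by (auto simp: pair_event_def)
    have w: "\<pi> (j, digits b k (\<alpha> j)) \<omega> (?d k (\<alpha> j)) = x j ! k" "\<pi> (j, digits b k (\<alpha>' j)) \<omega> (?d k (\<alpha>' j)) = x' j ! k"
      if "k < K" for j k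
      using that eq[of j] unfolding scrambled_word_eq_iff[OF length_words[OF x(1)]] scrambled_word_eq_iff[OF length_words[OF x(2)]]
      by blast+
    show "\<omega> \<in> (\<Inter>q\<in>J. \<pi> q -` B q \<inter> space M)"
    proof
      fix q assume q: "q \<in> J"
      then obtain j k y where jk: "k < K" "q = (j, digits b k y)" unfolding J_def I_def Q_def by auto
      have "\<pi> q \<omega> permutes {..<b}" using q subJ \<omega> by (intro perm_permutes) auto
      then show "\<omega> \<in> \<pi> q -` B q \<inter> space M" using \<omega> w[OF jk(1), of j] unfolding jk(2) B by auto
    qed
  next
    fix \<omega> assume \<omega>: "\<omega> \<in> (\<Inter>q\<in>J. \<pi> q -` B q \<inter> space M)"
    have sp: "\<omega> \<in> space M" using \<omega> finJ(2) by auto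
    have "\<pi> (j, digits b k (\<alpha> j)) \<omega> (?d k (\<alpha> j)) = x j ! k \<and> \<pi> (j, digits b k (\<alpha>' j)) \<omega> (?d k (\<alpha>' j)) = x' j ! k"
      if "k < K" for j k
    proof -
      have "(j, digits b k (\<alpha> j)) \<in> J" "(j, digits b k (\<alpha>' j)) \<in> J"
        using that unfolding J_def I_def Q_def by blast+
      then have "\<pi> (j, digits b k (\<alpha> j)) \<omega> \<in> B (j, digits b k (\<alpha> j))"
         "\<pi> (j, digits b k (\<alpha>' j)) \<omega> \<in> B (j, digits b k (\<alpha>' j))" using \<omega> by blast+
      then show ?thesis unfolding B by simp
    qed
    then show "\<omega> \<in> pair_event K \<alpha> \<alpha>' x x'"
      unfolding pair_event_def scrambled_word_eq_iff[OF length_words[OF x(1)]] scrambled_word_eq_iff[OF length_words[OF x(2)]]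
      using sp by simp
  qed
  show "pair_event K \<alpha> \<alpha>' x x' \<in> events" unfolding E by (rule prob_perms(1)[OF finJ subJ BP])
  have level: "(\<Prod>q\<in>Q (j, k). real (card (B q)) / fact b) =
      level_prob b (digits b K (\<alpha> j)) (digits b K (\<alpha>' j)) (x j) (x' j) k" if k: "k < K" for j k
  proof -
    let ?w = "digits b k (\<alpha> j)" and ?w' = "digits b k (\<alpha>' j)"
    have lt: "?d k (\<alpha> j) < b" "?d k (\<alpha>' j) < b" "x j ! k < b" "x' j ! k < b"
      using b k words_nth_less[OF x(1) k] words_nth_less[OF x(2) k] by (auto simp: digit_less)
    have lp: "level_prob b (digits b K (\<alpha> j)) (digits b K (\<alpha>' j)) (x j) (x' j) k =
       (if ?w = ?w' then
        if ?d k (\<alpha> j) = ?d k (\<alpha>' j) then of_bool (x j ! k = x' j ! k) / real b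
        else of_bool (x j ! k \<noteq> x' j ! k) / (real b * (real b - 1))
       else 1 / (real b * real b))"
      using k by (simp add: level_prob_def take_digits digits_nth)
    show ?thesis
    proof (cases "?w = ?w'")
      case False
      have 1: "B (j, ?w) = {p. p permutes {..<b} \<and> p (?d k (\<alpha> j)) = x j ! k}"
        using False unfolding B by auto
      have 2: "B (j, ?w') = {p. p permutes {..<b} \<and> p (?d k (\<alpha>' j)) = x' j ! k}"
        using False unfolding B by auto
      have "(\<Prod>q\<in>Q (j, k). real (card (B q)) / fact b) = real (card (B (j, ?w))) / fact b * (real (card (B (j, ?w'))) / fact b)"
        using False unfolding Q_def by simp
      then show ?thesis unfolding lp 1 2 card_permutes_1[OF lt(1,3)] card_permutes_1[OF lt(2,4)] using False by simp
    next
      case True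
      have "(\<Prod>q\<in>Q (j, k). real (card (B q)) / fact b) = real (card (B (j, ?w))) / fact b"
        using True unfolding Q_def by simp
      moreover have Bw: "B (j, ?w) = {p. p permutes {..<b} \<and> p (?d k (\<alpha> j)) = x j ! k \<and> p (?d k (\<alpha>' j)) = x' j ! k}"
        using True unfolding B by auto
      moreover have "real (card (B (j, ?w))) = of_bool (x j ! k = x' j ! k) * (fact b / real b)" if "?d k (\<alpha> j) = ?d k (\<alpha>' j)"
      proof (cases "x j ! k = x' j ! k")
        case True
        then have "B (j, ?w) = {p. p permutes {..<b} \<and> p (?d k (\<alpha> j)) = x j ! k}" unfolding Bw that by auto
        then show ?thesis using card_permutes_1[OF lt(1,3)] True by simp
      next
        case False
        then have "B (j, ?w) = {}" unfolding Bw that by auto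
        then show ?thesis using False by simp
      qed
      moreover have "real (card (B (j, ?w))) = of_bool (x j ! k \<noteq> x' j ! k) * (fact b / (real b * (real b - 1)))"
        if "?d k (\<alpha> j) \<noteq> ?d k (\<alpha>' j)"
        unfolding Bw by (rule card_permutes_2[OF lt(1,2) that lt(3,4)])
      ultimately show ?thesis unfolding lp using True by auto
    qed
  qed
  have "prob (pair_event K \<alpha> \<alpha>' x x') = (\<Prod>q\<in>J. real (card (B q)) / fact b)"
    unfolding E by (rule prob_perms(2)[OF finJ subJ BP])
  also have "\<dots> = (\<Prod>i\<in>I. \<Prod>q\<in>Q i. real (card (B q)) / fact b)"
    unfolding J_def
  proof (rule prod.UNION_disjoint)
    have "Q i \<inter> Q i' = {}" if "i \<noteq> i'" for i i'
    proof (rule equals0I)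
      fix q assume "q \<in> Q i \<inter> Q i'"
      moreover have "(fst q, length (snd q)) = i" if "q \<in> Q i" for i
        using that unfolding Q_def by (cases i) auto
      ultimately show False using that by blast
    qed
    then show "\<forall>i\<in>I. \<forall>i'\<in>I. i \<noteq> i' \<longrightarrow> Q i \<inter> Q i' = {}" by simp
    show "finite I" by (simp add: I_def)
    show "\<forall>i\<in>I. finite (Q i)" by (auto simp: Q_def)
  qed
  also have "\<dots> = (\<Prod>(j, k)\<in>UNIV \<times> {..<K}. level_prob b (digits b K (\<alpha> j)) (digits b K (\<alpha>' j)) (x j) (x' j) k)"
    unfolding I_def by (rule prod.cong[OF refl]) (auto simp: level)
  also have "\<dots> = (\<Prod>j\<in>UNIV. \<Prod>k<K. level_prob b (digits b K (\<alpha> j)) (digits b K (\<alpha>' j)) (x j) (x' j) k)"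
    by (rule prod.cartesian_product[symmetric])
  finally show "prob (pair_event K \<alpha> \<alpha>' x x') =
      (\<Prod>j\<in>UNIV. \<Prod>k<K. level_prob b (digits b K (\<alpha> j)) (digits b K (\<alpha>' j)) (x j) (x' j) k)" .
qed

text \<open>The integrand takes finitely many values and is a combination of indicators of pair
  events; \<open>has_bochner_integral\<close> delivers integrability together with the
  value.\<close>

lemma word_product_integral:
  fixes g :: "('s \<Rightarrow> nat list) \<Rightarrow> real"
  assumes K: "K > 0"
  shows "has_bochner_integral M (\<lambda>\<omega>. g (\<lambda>j. word K j \<omega> (\<alpha> j)) * g (\<lambda>j. word K j \<omega> (\<alpha>' j)))
    (\<Sum>x\<in>UNIV \<rightarrow>\<^sub>E words b K. \<Sum>x'\<in>UNIV \<rightarrow>\<^sub>E words b K.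
      (\<Prod>j\<in>UNIV. \<Prod>k<K. level_prob b (digits b K (\<alpha> j)) (digits b K (\<alpha>' j)) (x j) (x' j) k) * (g x * g x'))"
proof -
  let ?G = "(UNIV :: 's set) \<rightarrow>\<^sub>E words b K"
  have fin: "finite ?G" by (simp add: finite_PiE)
  have hb: "has_bochner_integral M (\<lambda>\<omega>. \<Sum>x\<in>?G. \<Sum>x'\<in>?G. indicator (pair_event K \<alpha> \<alpha>' x x') \<omega> * (g x * g x'))
    (\<Sum>x\<in>?G. \<Sum>x'\<in>?G. prob (pair_event K \<alpha> \<alpha>' x x') * (g x * g x'))"
  proof (intro has_bochner_integral_sum has_bochner_integral_mult_left has_bochner_integral_real_indicator)
    fix x x' assume "x \<in> ?G" "x' \<in> ?G"
    then show "pair_event K \<alpha> \<alpha>' x x' \<in> events" by (intro pair_event(1)[OF K]) auto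
  qed (simp add: emeasure_eq_measure)
  have eq: "g (\<lambda>j. word K j \<omega> (\<alpha> j)) * g (\<lambda>j. word K j \<omega> (\<alpha>' j)) =
     (\<Sum>x\<in>?G. \<Sum>x'\<in>?G. indicator (pair_event K \<alpha> \<alpha>' x x') \<omega> * (g x * g x'))" if \<omega>: "\<omega> \<in> space M" for \<omega>
  proof -
    let ?Y = "\<lambda>j. word K j \<omega> (\<alpha> j)" and ?Y' = "\<lambda>j. word K j \<omega> (\<alpha>' j)"
    have Y: "?Y \<in> ?G" "?Y' \<in> ?G" using word_in_words[OF \<omega>] by auto
    have "indicator (pair_event K \<alpha> \<alpha>' x x') \<omega> * (g x * g x') = (if x' = ?Y' then if x = ?Y then g x * g x' else 0 else 0)" for x x'
      using \<omega> by (auto simp: pair_event_def indicator_def fun_eq_iff)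
    then show ?thesis using Y fin by (simp add: sum.delta)
  qed
  have "(\<Sum>x\<in>?G. \<Sum>x'\<in>?G. prob (pair_event K \<alpha> \<alpha>' x x') * (g x * g x')) = (\<Sum>x\<in>?G. \<Sum>x'\<in>?G.
      (\<Prod>j\<in>UNIV. \<Prod>k<K. level_prob b (digits b K (\<alpha> j)) (digits b K (\<alpha>' j)) (x j) (x' j) k) * (g x * g x'))"
    by (intro sum.cong refl arg_cong2[of _ _ _ _ "(*)"] pair_event(2)[OF K]) auto
  with hb show ?thesis
    by (subst has_bochner_integral_cong[OF refl eq refl]) auto
qed

lemma word_mean_second_moment:
  fixes g :: "('s \<Rightarrow> nat list) \<Rightarrow> real" and \<alpha> :: "nat \<Rightarrow> 's \<Rightarrow> real"
  assumes K: "K > 0"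
  shows "has_bochner_integral M (\<lambda>\<omega>. ((1 / real n) * (\<Sum>i=1..n. g (\<lambda>j. word K j \<omega> (\<alpha> i j))))\<^sup>2)
    ((1 / real n ^ 2) * (\<Sum>i=1..n. \<Sum>i'=1..n. \<Sum>x\<in>UNIV \<rightarrow>\<^sub>E words b K. \<Sum>x'\<in>UNIV \<rightarrow>\<^sub>E words b K.
      (\<Prod>j\<in>UNIV. \<Prod>k<K. level_prob b (digits b K (\<alpha> i j)) (digits b K (\<alpha> i' j)) (x j) (x' j) k) * (g x * g x')))"
proof -
  have "((1 / real n) * (\<Sum>i=1..n. g (\<lambda>j. word K j \<omega> (\<alpha> i j))))\<^sup>2 =
     (1 / real n ^ 2) * (\<Sum>i=1..n. \<Sum>i'=1..n. g (\<lambda>j. word K j \<omega> (\<alpha> i j)) * g (\<lambda>j. word K j \<omega> (\<alpha> i' j)))" for \<omega>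
    unfolding sum_product[symmetric] by (simp add: power2_eq_square)
  then show ?thesis
    by (simp only:) (intro has_bochner_integral_mult_right has_bochner_integral_sum word_product_integral K)
qed

text \<open>Letters on different levels come from permutations with addresses of different length,
  hence are independent, and each is uniform.\<close>

lemma prob_all_top_digits:
  "prob {\<omega> \<in> space M. \<forall>k\<in>{K0..<K0 + N}. \<pi> (j, digits b k x) \<omega> (digit b (Suc k) x) = b - 1} = (1 / real b) ^ N"
  "{\<omega> \<in> space M. \<forall>k\<in>{K0..<K0 + N}. \<pi> (j, digits b k x) \<omega> (digit b (Suc k) x) = b - 1} \<in> events"
proof -
  let ?S = "{\<omega> \<in> space M. \<forall>k\<in>{K0..<K0 + N}. \<pi> (j, digits b k x) \<omega> (digit b (Suc k) x) = b - 1}"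
  have "prob ?S = (1 / real b) ^ N \<and> ?S \<in> events"
  proof (cases "N = 0")
    case True
    then show ?thesis by (simp add: prob_space)
  next
    case False
    let ?q = "\<lambda>k. (j, digits b k x)"
    let ?J = "?q ` {K0..<K0 + N}"
    define B where "B = (\<lambda>(j :: 's, w :: nat list). {p. p permutes {..<b} \<and> p (digit b (Suc (length w)) x) = b - 1})"
    have J: "finite ?J" "?J \<noteq> {}" "?J \<subseteq> UNIV \<times> lists {..<b}" using False digits_lists by auto
    have BP: "B q \<subseteq> Perms" for q by (auto simp: B_def split: prod.splits)
    have inj: "inj_on ?q {K0..<K0 + N}"
      by (rule inj_onI) (metis length_digits prod.inject)
    have S: "?S = (\<Inter>q\<in>?J. \<pi> q -` B q \<inter> space M)"
    proof (intro equalityI subsetI)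
      fix \<omega> assume \<omega>: "\<omega> \<in> ?S"
      have "\<pi> (?q k) \<omega> permutes {..<b}" for k using \<omega> digits_lists by (intro perm_permutes) auto
      then show "\<omega> \<in> (\<Inter>q\<in>?J. \<pi> q -` B q \<inter> space M)" using \<omega> by (auto simp: B_def)
    next
      fix \<omega> assume "\<omega> \<in> (\<Inter>q\<in>?J. \<pi> q -` B q \<inter> space M)"
      then show "\<omega> \<in> ?S" using False by (auto simp: B_def)
    qed
    have "prob ?S = (\<Prod>k\<in>{K0..<K0 + N}. real (card (B (?q k))) / fact b)"
      unfolding S by (subst prob_perms(2)[OF J BP]) (simp add: prod.reindex[OF inj])
    also have "\<dots> = (\<Prod>k\<in>{K0..<K0 + N}. 1 / real b)"
    proof (rule prod.cong[OF refl])
      fix k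
      show "real (card (B (?q k))) / fact b = 1 / real b"
        using card_permutes_1[of "digit b (Suc k) x" b "b - 1"] b digit_less[of b "Suc k" x] by (simp add: B_def)
    qed
    finally have "prob ?S = (1 / real b) ^ N" by simp
    moreover have "?S \<in> events" unfolding S by (rule prob_perms(1)[OF J BP])
    ultimately show ?thesis by simp
  qed
  then show "prob ?S = (1 / real b) ^ N" "?S \<in> events" by auto
qed

text \<open>Almost surely the scrambled digits are those of the scrambled number: the expansion of the latter
  differs only if the former end in a constant sequence of \<open>b - 1\<close>.\<close>

lemma AE_not_eventually_top:
  "AE \<omega> in M. \<forall>j. \<forall>K0. \<exists>k\<ge>K0. \<pi> (j, digits b k (x j)) \<omega> (digit b (Suc k) (x j)) \<noteq> b - 1"
proof -
  have "AE \<omega> in M. \<exists>k\<ge>K0. \<pi> (j, digits b k (x j)) \<omega> (digit b (Suc k) (x j)) \<noteq> b - 1" for j K0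
  proof -
    let ?S = "\<lambda>N. {\<omega> \<in> space M. \<forall>k\<in>{K0..<K0 + N}. \<pi> (j, digits b k (x j)) \<omega> (digit b (Suc k) (x j)) = b - 1}"
    have ev: "(\<Inter>N. ?S N) \<in> events" by (intro sets.countable_INT image_subsetI prob_all_top_digits(2)) simp
    have "prob (\<Inter>N. ?S N) \<le> (1 / real b) ^ N" for N
    proof -
      have "prob (\<Inter>N. ?S N) \<le> prob (?S N)"
        by (rule finite_measure_mono[OF _ prob_all_top_digits(2)]) blast
      also have "\<dots> = (1 / real b) ^ N" by (rule prob_all_top_digits(1))
      finally show ?thesis .
    qed
    moreover have "(\<lambda>N. (1 / real b) ^ N) \<longlonglongrightarrow> 0" using b by (intro LIMSEQ_realpow_zero) auto
    ultimately have "prob (\<Inter>N. ?S N) \<le> 0" by (intro LIMSEQ_le_const) auto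
    then have "prob (\<Inter>N. ?S N) = 0" using measure_nonneg[of M "\<Inter>N. ?S N"] by linarith
    then have em: "emeasure M (\<Inter>N. ?S N) = 0" by (simp add: emeasure_eq_measure)
    show ?thesis
    proof (rule AE_I[OF _ em ev])
      show "{\<omega> \<in> space M. \<not> (\<exists>k\<ge>K0. \<pi> (j, digits b k (x j)) \<omega> (digit b (Suc k) (x j)) \<noteq> b - 1)} \<subseteq> (\<Inter>N. ?S N)"
        by auto
    qed
  qed
  then show ?thesis by (simp add: AE_all_countable)
qed

end

text \<open>The tails satisfy b * r k = c k + r (k + 1). If all of them lie in [0,1), then
  \<open>c k\<close> is the integer part, that is, the digit.\<close>

lemma digits_of_expansion:
  fixes c :: "nat \<Rightarrow> nat"
  assumes b: "b \<ge> 2" and c: "\<And>k. c k < b" and top: "\<And>K. \<exists>k\<ge>K. c k \<noteq> b - 1"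
  shows "digits b K (\<Sum>k. real (c k) / real b ^ Suc k) = map c [0..<K]"
proof -
  define r where "r k = (\<Sum>i. real (c (k + i)) / real b ^ Suc i)" for k
  have b1: "real b > 1" using b by simp
  have geo: "(\<lambda>i. (real b - 1) / real b ^ Suc i) sums 1"
  proof -
    have "(\<lambda>i. (1 / real b) ^ i) sums (1 / (1 - 1 / real b))" using b1 by (intro geometric_sums) simp
    then have "(\<lambda>i. (real b - 1) / real b * (1 / real b) ^ i) sums ((real b - 1) / real b * (1 / (1 - 1 / real b)))"
      by (rule sums_mult)
    moreover have "(real b - 1) / real b * (1 / (1 - 1 / real b)) = 1" using b1 by (simp add: field_simps)
    ultimately show ?thesis by (simp add: power_one_over field_simps)
  qed
  have le: "real (c k) / real b ^ Suc i \<le> (real b - 1) / real b ^ Suc i" for k i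
  proof (rule divide_right_mono)
    show "real (c k) \<le> real b - 1" using c[of k] by linarith
  qed simp
  have smm: "summable (\<lambda>i. real (c (k + i)) / real b ^ Suc i)" for k
    by (rule summable_comparison_test'[OF sums_summable[OF geo]]) (use le in auto)
  have r0: "0 \<le> r k" for k unfolding r_def by (rule suminf_nonneg[OF smm]) simp
  have r1: "r k \<le> 1" for k
    unfolding r_def using suminf_le[OF le smm sums_summable[OF geo]] sums_unique[OF geo] by simp
  have step: "real b * r k = real (c k) + r (Suc k)" for k
  proof -
    have "r k = real (c k) / real b + (\<Sum>i. real (c (k + Suc i)) / real b ^ Suc (Suc i))"
      unfolding r_def using suminf_split_head[OF smm[of k]] by simp
    also have "(\<Sum>i. real (c (k + Suc i)) / real b ^ Suc (Suc i)) = (\<Sum>i. (real (c (Suc k + i)) / real b ^ Suc i) / real b)"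
      by (intro suminf_cong) (simp add: field_simps)
    also have "\<dots> = r (Suc k) / real b" unfolding r_def by (rule suminf_divide[OF smm])
    finally show ?thesis using b1 by (simp add: field_simps)
  qed
  have lt_1: "r k < 1" for k
  proof -
    \<comment> \<open>Strictness travels backwards: a tail below 1 makes the previous one below 1.
      It starts at a letter other than b - 1, where even a following tail of 1 is harmless.\<close>
    have descend: "r k < 1" if "r (k + n) < 1" for n
      using that
    proof (induction n)
      case (Suc n)
      have "real b * r (k + n) < real b * 1" using step[of "k + n"] Suc.prems c[of "k + n"] by simp
      then show ?case using Suc.IH b1 by simp
    qed simp
    from top[of k] obtain i where i: "c (k + i) \<noteq> b - 1" by (metis le_Suc_ex)
    have "real b * r (k + i) < real b * 1" using step[of "k + i"] r1[of "Suc (k + i)"] i c[of "k + i"] by simp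
    then have "r (k + i) < 1" using b1 by simp
    then show ?thesis by (rule descend)
  qed
  \<comment> \<open>The integer formed by the first \<open>k\<close> letters, the integer part of
    b^k * r 0.\<close>
  define N where "N = rec_nat 0 (\<lambda>k n. b * n + c k)"
  have N: "N 0 = 0" "N (Suc k) = b * N k + c k" for k by (simp_all add: N_def)
  have x: "real b ^ k * r 0 = real (N k) + r k" for k
  proof (induction k)
    case (Suc k)
    have "real b ^ Suc k * r 0 = real b * (real b ^ k * r 0)" by simp
    also have "\<dots> = real b * real (N k) + (real (c k) + r (Suc k))" unfolding Suc step[symmetric] by (simp add: algebra_simps)
    finally show ?case by (simp add: N)
  qed (simp add: N)
  have "digit b (Suc k) (r 0) = c k" for k
  proof -
    have "\<lfloor>real b ^ Suc k * r 0\<rfloor> = int (N (Suc k))" unfolding x using r0[of "Suc k"] lt_1[of "Suc k"] by (simp add: floor_eq_iff)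
    then have "nat \<lfloor>real b ^ Suc k * r 0\<rfloor> = N (Suc k)" by (simp only: nat_int)
    then show ?thesis unfolding digit_def using c[of k] by (simp only: N) simp
  qed
  moreover have "(\<Sum>k. real (c k) / real b ^ Suc k) = r 0" by (simp add: r_def)
  ultimately show ?thesis by (simp add: digits_def)
qed


section \<open>Cells and the limit of fine levels\<close>

text \<open>The limit need not lie in the sets, but it shares a cube with each of them. The volumes
  of these cubes are at most \<open>\<alpha>\<close> times those of the sets, so their sides shrink
  to 0. Limits are therefore unique.\<close>

lemma converges_nicely_points:
  fixes x :: "'a::euclidean_space"
  assumes conv: "converges_nicely S x" and q: "\<And>k. q k \<in> S k"
    and vol: "(\<lambda>k. measure lborel (S k)) \<longlonglongrightarrow> 0"
  shows "q \<longlonglongrightarrow> x"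
proof -
  let ?d = "DIM('a)"
  from conv obtain \<alpha> C where C: "\<And>k. \<exists>c r. C k = cbox c (c + r *\<^sub>R One)" "\<And>k. x \<in> C k" "\<And>k. S k \<subseteq> C k"
    "\<And>k. 0 < measure lborel (C k)" "\<And>k. measure lborel (C k) \<le> \<alpha> * measure lborel (S k)"
    unfolding converges_nicely_def by blast
  have bound: "dist (q k) x ^ ?d \<le> real ?d ^ ?d * (\<alpha> * measure lborel (S k))" for k
  proof -
    obtain c r where cr: "C k = cbox c (c + r *\<^sub>R One)" using C(1) by blast
    have in_box: "c \<bullet> i \<le> y \<bullet> i \<and> y \<bullet> i \<le> c \<bullet> i + r" if "y \<in> C k" "i \<in> Basis" for y i
      using that unfolding cr mem_box by (auto simp: inner_add_left)
    have "r \<ge> 0"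
    proof -
      obtain i :: 'a where "i \<in> Basis" using nonempty_Basis by blast
      from in_box[OF C(2) this] show ?thesis by linarith
    qed
    have vol: "measure lborel (C k) = r ^ ?d"
      unfolding cr using \<open>r \<ge> 0\<close> by (simp add: measure_lborel_cbox_eq inner_add_left)
    have "dist (q k) x \<le> (\<Sum>i\<in>Basis. \<bar>(q k - x) \<bullet> i\<bar>)"
      unfolding dist_norm by (rule norm_le_l1)
    also have "\<dots> \<le> (\<Sum>i\<in>(Basis::'a set). r)"
    proof (rule sum_mono)
      fix i :: 'a assume i: "i \<in> Basis"
      have "q k \<in> C k" using C(3) q by blast
      then show "\<bar>(q k - x) \<bullet> i\<bar> \<le> r"
        using in_box[OF _ i, of "q k"] in_box[OF C(2) i] unfolding inner_diff_left by linarith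
    qed
    finally have "dist (q k) x ^ ?d \<le> (real ?d * r) ^ ?d"
      by (intro power_mono) auto
    also have "\<dots> = real ?d ^ ?d * measure lborel (C k)" by (simp add: vol power_mult_distrib)
    also have "\<dots> \<le> real ?d ^ ?d * (\<alpha> * measure lborel (S k))" by (intro mult_left_mono C(5)) simp
    finally show ?thesis .
  qed
  have "(\<lambda>k. dist (q k) x ^ ?d) \<longlonglongrightarrow> 0"
  proof (rule tendsto_sandwich[OF _ _ tendsto_const])
    show "(\<lambda>k. real ?d ^ ?d * (\<alpha> * measure lborel (S k))) \<longlonglongrightarrow> 0"
      by (intro tendsto_mult_right_zero vol)
  qed (use bound in auto)
  then have "(\<lambda>k. root ?d (dist (q k) x ^ ?d)) \<longlonglongrightarrow> root ?d 0"
    by (rule tendsto_real_root)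
  then have "(\<lambda>k. dist (q k) x) \<longlonglongrightarrow> 0" by (simp add: real_root_power_cancel)
  then show ?thesis by (rule tendsto_dist_iff[THEN iffD2])
qed

locale unit_split =
  fixes b :: nat and X :: "(real^'d::finite) set" and cell :: "nat list \<Rightarrow> (real^'d) set"
  assumes b: "b \<ge> 2" and bounded: "bounded X" and vol: "measure lborel X = 1"
    and split: "recursive_split b X cell" and conv: "convergent_split b cell" and spherical: "spherical_split b cell"
begin

lemma fold_split_cell: "w \<in> lists {..<b} \<Longrightarrow> fold_split b (cell w) (\<lambda>a. cell (w @ [a]))"
  using split unfolding recursive_split_def by blast

lemma cell_Nil: "cell [] = X"
  using split unfolding recursive_split_def by blast

lemma cell_nonempty: "w \<in> lists {..<b} \<Longrightarrow> cell w \<noteq> {}"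
proof -
  assume "w \<in> lists {..<b}"
  from fold_split_cell[OF this] have "0 < measure lborel (cell w)" unfolding fold_split_def by (elim conjE)
  then show ?thesis by auto
qed

lemma cell_snoc_subset: "w \<in> lists {..<b} \<Longrightarrow> a < b \<Longrightarrow> cell (w @ [a]) \<subseteq> cell w"
  using fold_split_cell[of w] unfolding fold_split_def by blast

lemma cell_append_subset: "w \<in> lists {..<b} \<Longrightarrow> v \<in> lists {..<b} \<Longrightarrow> cell (w @ v) \<subseteq> cell w"
proof (induction v rule: rev_induct)
  case (snoc a v)
  then have "cell ((w @ v) @ [a]) \<subseteq> cell (w @ v)" by (intro cell_snoc_subset) auto
  then show ?case using snoc by auto
qed simp

lemma cell_take_subset: "w \<in> lists {..<b} \<Longrightarrow> cell w \<subseteq> cell (take k w)"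
  using cell_append_subset[of "take k w" "drop k w"] by (auto dest: in_set_takeD in_set_dropD)

lemma cell_subset: "w \<in> lists {..<b} \<Longrightarrow> cell w \<subseteq> X"
  using cell_take_subset[of w 0] by (simp add: cell_Nil)

lemma measure_cell: "w \<in> lists {..<b} \<Longrightarrow> measure lborel (cell w) = (1 / real b) ^ length w"
proof (induction w rule: rev_induct)
  case Nil
  then show ?case by (simp add: cell_Nil vol)
next
  case (snoc a w)
  then have "measure lborel (cell (w @ [a])) = measure lborel (cell w) / real b"
    using fold_split_cell[of w] unfolding fold_split_def by auto
  then show ?case using snoc by simp
qed

definition pick :: "nat list \<Rightarrow> real^'d" where
  "pick w = (SOME p. p \<in> cell w)"

lemma pick_in_cell: "w \<in> lists {..<b} \<Longrightarrow> pick w \<in> cell w"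
  unfolding pick_def using cell_nonempty by (intro some_in_eq[THEN iffD2])

lemma pick_in_X: "w \<in> lists {..<b} \<Longrightarrow> pick w \<in> X"
  using pick_in_cell cell_subset by blast

lemma digits_lists: "digits b K y \<in> lists {..<b}"
  using b by (auto simp: digits_def digit_less)

text \<open>Representatives of the cells converge to every nice limit of the cells; this uniqueness
  makes the \<open>THE\<close> in \<open>split_map\<close> meaningful.\<close>

lemma pick_digits_tendsto: "(\<lambda>K. pick (digits b K y)) \<longlonglongrightarrow> split_map b cell y"
proof -
  have lim: "(\<lambda>K. pick (digits b K y)) \<longlonglongrightarrow> p" if "converges_nicely (\<lambda>K. cell (digits b K y)) p" for p
  proof (rule converges_nicely_points[OF that])
    show "pick (digits b K y) \<in> cell (digits b K y)" for K by (intro pick_in_cell digits_lists)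
    have "(\<lambda>K. (1 / real b) ^ K) \<longlonglongrightarrow> 0" using b by (intro LIMSEQ_realpow_zero) auto
    then show "(\<lambda>K. measure lborel (cell (digits b K y))) \<longlonglongrightarrow> 0"
      using measure_cell[OF digits_lists] by simp
  qed
  have "\<exists>p. converges_nicely (\<lambda>K. cell (map (\<lambda>k. digit b (Suc k) y) [0..<K])) p"
    using conv b unfolding convergent_split_def by (auto simp: digit_less)
  then obtain p where p: "converges_nicely (\<lambda>K. cell (digits b K y)) p" by (auto simp: digits_def)
  have "split_map b cell y = p"
    unfolding split_map_def
  proof (rule the_equality)
    show "converges_nicely (\<lambda>K. cell (digits b K y)) p" by (rule p)
  next
    fix p' assume "converges_nicely (\<lambda>K. cell (digits b K y)) p'"
    from LIMSEQ_unique[OF lim[OF this] lim[OF p]] show "p' = p" .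
  qed
  with lim[OF p] show ?thesis by simp
qed

lemma spherical_bound:
  obtains C where "C \<ge> 0"
    "\<And>x y k K. x \<in> words b K \<Longrightarrow> y \<in> words b K \<Longrightarrow> k \<le> K \<Longrightarrow> take k x = take k y \<Longrightarrow>
      dist (pick x) (pick y) \<le> C * (real b powr (- 1 / real CARD('d))) ^ k"
proof -
  from spherical obtain C where C: "\<And>w. w \<in> lists {..<b} \<Longrightarrow> diameter (cell w) \<le> C * real b powr (- real (length w) / real CARD('d))"
    unfolding spherical_split_def by auto
  have "dist (pick x) (pick y) \<le> max C 0 * (real b powr (- 1 / real CARD('d))) ^ k"
    if "x \<in> words b K" "y \<in> words b K" "k \<le> K" "take k x = take k y" for x y k K
  proof -
    let ?w = "take k x"
    have xy: "x \<in> lists {..<b}" "y \<in> lists {..<b}" using that by (auto simp: words_def)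
    have w: "?w \<in> lists {..<b}" "length ?w = k" using that by (auto simp: words_def dest: in_set_takeD)
    have "pick x \<in> cell ?w" "pick y \<in> cell ?w"
      using pick_in_cell[OF xy(1)] pick_in_cell[OF xy(2)] cell_take_subset[OF xy(1), of k] cell_take_subset[OF xy(2), of k] that(4)
      by auto
    then have "dist (pick x) (pick y) \<le> diameter (cell ?w)"
      using bounded_subset[OF bounded cell_subset[OF w(1)]] by (intro diameter_bounded_bound)
    also have "\<dots> \<le> C * real b powr (- real k / real CARD('d))" using C[OF w(1)] w(2) by simp
    also have "\<dots> \<le> max C 0 * real b powr (- real k / real CARD('d))" by (intro mult_right_mono) auto
    also have "real b powr (- real k / real CARD('d)) = (real b powr (- 1 / real CARD('d))) ^ k"
      using b by (simp add: powr_realpow[symmetric] powr_powr)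
    finally show ?thesis .
  qed
  then show ?thesis by (intro that[of "max C 0"]) auto
qed

end

section \<open>Measurability at finite levels, and variance in the limit\<close>

lemma measurable_word_fun:
  fixes D :: "'s::finite \<Rightarrow> nat \<Rightarrow> 'w \<Rightarrow> nat" and g :: "('s \<Rightarrow> nat list) \<Rightarrow> real"
  assumes D: "\<And>j k. D j k \<in> measurable M (count_space UNIV)"
  shows "(\<lambda>\<omega>. g (\<lambda>j. map (\<lambda>k. D j k \<omega>) [0..<K])) \<in> borel_measurable M"
proof -
  let ?T = "\<lambda>\<omega> j. map (\<lambda>k. D j k \<omega>) [0..<K]"
  \<comment> \<open>Tuples of words form a countable type, so it is enough to consider preimages of
    points, and \<open>g\<close> may be arbitrary. This matters because \<open>g\<close> will
    involve an unspecified choice of representatives.\<close>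
  have "?T \<in> measurable M (count_space UNIV)"
  proof (subst measurable_count_space_eq2_countable, safe)
    fix x :: "'s \<Rightarrow> nat list"
    note D[measurable]
    have "?T -` {x} \<inter> space M = {\<omega> \<in> space M. \<forall>j. length (x j) = K \<and> (\<forall>k\<in>{..<K}. D j k \<omega> = x j ! k)}"
      by (auto simp: fun_eq_iff list_eq_iff_nth_eq)
    also have "\<dots> \<in> sets M" by measurable
    finally show "?T -` {x} \<inter> space M \<in> sets M" .
  qed auto
  then show ?thesis by (rule measurable_compose) simp
qed

lemma measurable_digit: "digit b k \<in> measurable borel (count_space UNIV)"
  unfolding digit_def[abs_def] by measurable

text \<open>The expectation minimises the mean square deviation, so any centre gives an upper
  bound.\<close>

lemma (in prob_space) variance_le:
  fixes Y :: "'a \<Rightarrow> real"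
  assumes "integrable M Y" "integrable M (\<lambda>x. (Y x)\<^sup>2)"
  shows "variance Y \<le> expectation (\<lambda>x. (Y x - c)\<^sup>2)"
proof -
  have "expectation (\<lambda>x. (Y x - c)\<^sup>2) = expectation (\<lambda>x. (Y x)\<^sup>2) - 2 * c * expectation Y + c\<^sup>2"
    using assms by (simp add: power2_diff prob_space mult.commute mult.left_commute)
  also have "\<dots> = variance Y + (expectation Y - c)\<^sup>2"
    using variance_eq[OF assms] by (simp add: power2_diff)
  finally show ?thesis by simp
qed

text \<open>Dominated convergence with a constant majorant. The centres \<open>c K\<close> need not
  converge, because \<open>variance_le\<close> removes them before the limit.\<close>

lemma (in prob_space) variance_le_lim:
  fixes Y :: "nat \<Rightarrow> 'a \<Rightarrow> real"
  assumes meas: "\<And>K. Y K \<in> borel_measurable M"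
    and lim: "\<And>x. x \<in> space M \<Longrightarrow> (\<lambda>K. Y K x) \<longlonglongrightarrow> Z x"
    and bd: "\<And>K x. x \<in> space M \<Longrightarrow> \<bar>Y K x\<bar> \<le> F"
    and V: "\<And>K. expectation (\<lambda>x. (Y K x - c K)\<^sup>2) \<le> V"
  shows "variance Z \<le> V"
proof -
  note meas[measurable]
  have measZ[measurable]: "Z \<in> borel_measurable M"
    by (rule borel_measurable_LIMSEQ_real[OF lim meas])
  have bdZ: "\<bar>Z x\<bar> \<le> F" if "x \<in> space M" for x
    by (rule LIMSEQ_le_const2[OF tendsto_rabs[OF lim[OF that]]]) (use bd[OF that] in auto)
  have sq: "(y :: real)\<^sup>2 \<le> F\<^sup>2" if "\<bar>y\<bar> \<le> F" for y using power_mono[OF that abs_ge_zero, of 2] by simp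
  have intY: "integrable M (Y K)" "integrable M (\<lambda>x. (Y K x)\<^sup>2)" for K
    by (rule integrable_const_bound[of _ F] integrable_const_bound[of _ "F\<^sup>2"]; use bd sq in auto)+
  have intZ: "integrable M Z" "integrable M (\<lambda>x. (Z x)\<^sup>2)"
    by (rule integrable_const_bound[of _ F] integrable_const_bound[of _ "F\<^sup>2"]; use bdZ sq in auto)+
  have "(\<lambda>K. expectation (Y K)) \<longlonglongrightarrow> expectation Z"
    by (rule integral_dominated_convergence[where w = "\<lambda>_. F"]) (use lim bd in auto)
  moreover have "(\<lambda>K. expectation (\<lambda>x. (Y K x)\<^sup>2)) \<longlonglongrightarrow> expectation (\<lambda>x. (Z x)\<^sup>2)"
    by (rule integral_dominated_convergence[where w = "\<lambda>_. F\<^sup>2"]) (use bd sq in \<open>auto intro!: tendsto_power lim\<close>)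
  ultimately have "(\<lambda>K. variance (Y K)) \<longlonglongrightarrow> variance Z"
    unfolding variance_eq[OF intY] variance_eq[OF intZ] by (intro tendsto_diff tendsto_power)
  then show ?thesis
    by (rule LIMSEQ_le_const2) (use order_trans[OF variance_le[OF intY] V] in auto)
qed


section \<open>The variance bound\<close>

lemma mixed_diff_comp:
  "mixed_diff u x y (\<lambda>z. h (\<lambda>j. P j (z j))) = mixed_diff u (\<lambda>j. P j (x j)) (\<lambda>j. P j (y j)) h"
  unfolding mixed_diff_def by (intro sum.cong refl arg_cong2[of _ _ _ _ "(*)"] arg_cong[of _ _ h]) auto

lemma scrambled_net_mean_bound:
  fixes g :: "('s::finite \<Rightarrow> nat list) \<Rightarrow> real" and a :: "nat \<Rightarrow> real^'s" and \<theta> :: real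
  assumes "scrambling M b \<pi>" and net: "tms_net b t m a"
    and gain: "\<And>v \<kappa>. v \<noteq> {} \<Longrightarrow> gain b (b ^ m) a v \<kappa> \<le> G" and G: "G \<ge> 0"
    and C1: "\<And>R. (\<Sum>l\<in>{l \<in> (UNIV :: 's set) \<rightarrow>\<^sub>E {..K}. R < (\<Sum>j\<in>UNIV. l j)}. (\<theta>\<^sup>2) ^ (\<Sum>j\<in>UNIV. l j))
       \<le> C1 * real (R + 2) ^ (CARD('s) - 1) * (\<theta>\<^sup>2) ^ R"
    and K: "K > 0" and B0: "B \<ge> 0" and \<theta>: "\<theta> \<ge> 0"
    and B: "\<And>l x y. l \<noteq> (\<lambda>_. 0) \<Longrightarrow> (\<And>j. l j \<le> K) \<Longrightarrow> x \<in> UNIV \<rightarrow>\<^sub>E words b K \<Longrightarrow> y \<in> UNIV \<rightarrow>\<^sub>E words b K \<Longrightarrow>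
       (\<And>j. take (l j - 1) (x j) = take (l j - 1) (y j)) \<Longrightarrow>
       \<bar>mixed_diff {j. l j \<noteq> 0} x y g\<bar> \<le> B * \<theta> ^ (\<Sum>j\<in>UNIV. l j)"
  shows "\<exists>c. prob_space.expectation M (\<lambda>\<omega>.
      ((1 / real (b ^ m)) * (\<Sum>i=1..b ^ m. g (\<lambda>j. scrambled_word b K (\<lambda>w. \<pi> (j, w) \<omega>) (a i $ j))) - c)\<^sup>2)
    \<le> (1 / real (b ^ m)) * (G * (2 ^ CARD('s) * B)\<^sup>2 * C1 * real (m - t + 2) ^ (CARD('s) - 1) * (\<theta>\<^sup>2) ^ (m - t))"
proof -
  interpret scrambling M b \<pi> by fact
  let ?n = "b ^ m" and ?s = "CARD('s)" and ?R = "m - t"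
  let ?L = "(UNIV :: 's set) \<rightarrow>\<^sub>E {..K}" and ?W = "(UNIV :: 's set) \<rightarrow>\<^sub>E words b K"
  have n: "?n > 0" using b by simp
  \<comment> \<open>The mean over all word tuples; subtracting it removes the part of level
    0.\<close>
  define c where "c = (\<Sum>x\<in>?W. g x) / real (card ?W)"
  define h where "h x = g x - c" for x
  \<comment> \<open>The gain bound that encodes the net property: 0 up to total level m - t, and the
    uniform bound \<open>G\<close> beyond.\<close>
  define G' where "G' l = (if ?R < (\<Sum>j\<in>UNIV. l j) then G else 0)" for l :: "'s \<Rightarrow> nat"
  define B' where "B' l = B * \<theta> ^ (\<Sum>j\<in>UNIV. l j)" for l :: "'s \<Rightarrow> nat"
  have range: "0 \<le> a i $ j \<and> a i $ j < 1" if "i \<in> {1..?n}" for i j by (rule tms_net_range[OF net that])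
  have fin: "finite ?W" "finite ?L" by (simp_all add: finite_PiE)
  have "card ?W > 0" using b by (simp add: card_PiE card_words)
  then have h0: "(\<Sum>x\<in>?W. h x) = 0" by (simp add: h_def c_def sum_subtractf)
  have moment: "(1 / real ?n ^ 2) * (\<Sum>i=1..?n. \<Sum>i'=1..?n. \<Sum>x\<in>?W. \<Sum>x'\<in>?W.
      (\<Prod>j\<in>UNIV. \<Prod>k<K. level_prob b (digits b K (a i $ j)) (digits b K (a i' $ j)) (x j) (x' j) k) * (h x * h x'))
    \<le> (1 / real ?n) * (\<Sum>l\<in>?L - {\<lambda>_. 0}. G' l * (2 ^ ?s * B' l)\<^sup>2)"
  proof (rule second_moment_bound[OF b n, where A = "\<lambda>i j. digits b K (a i $ j)"])
    show "(\<lambda>j. digits b K (a i $ j)) \<in> ?W" for i using b by (auto intro: digits_words)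
    show "(\<Sum>x\<in>?W. h x) = 0" by (rule h0)
    show "G' l \<ge> 0" for l using G by (simp add: G'_def)
    show "B' l \<ge> 0" for l using B0 \<theta> by (simp add: B'_def)
    show "(1 / real ?n) * (\<Sum>i=1..?n. \<Sum>i'=1..?n. \<Prod>j\<in>UNIV. gain_factor b (l j) (digits b K (a i $ j)) (digits b K (a i' $ j))) \<le> G' l"
      if l: "\<And>j. l j \<le> K" "l \<noteq> (\<lambda>_. 0)" for l
    proof (cases "?R < (\<Sum>j\<in>UNIV. l j)")
      case True
      have "{j. l j \<noteq> 0} \<noteq> {}" using l(2) by (auto simp: fun_eq_iff)
      then have "gain b ?n a {j. l j \<noteq> 0} (\<lambda>j. l j - 1) \<le> G" by (rule gain)
      then show ?thesis
        using gain_eq_gain_factor[of b ?n a l K, OF _ range l(1)] b True by (simp add: G'_def)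
    next
      case False
      then have "(\<Sum>j\<in>UNIV. l j) \<le> m - t" by simp
      from net_gain_zero[OF net b this l(2,1)] False show ?thesis by (simp add: G'_def)
    qed
    show "\<bar>mixed_diff {j. l j \<noteq> 0} x y h\<bar> \<le> B' l"
      if l: "l \<noteq> (\<lambda>_. 0)" and *: "\<And>j. l j \<le> K" "x \<in> ?W" "y \<in> ?W" "\<And>j. take (l j - 1) (x j) = take (l j - 1) (y j)" for l x y
    proof -
      have "{j. l j \<noteq> 0} \<noteq> {}" using l by (auto simp: fun_eq_iff)
      then have "mixed_diff {j. l j \<noteq> 0} x y h = mixed_diff {j. l j \<noteq> 0} x y g"
        unfolding h_def by (intro mixed_diff_minus_const) auto
      then show ?thesis unfolding B'_def using B[OF l *] by simp
    qed
  qed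
  have "(\<Sum>l\<in>?L - {\<lambda>_. 0}. G' l * (2 ^ ?s * B' l)\<^sup>2) = (\<Sum>l\<in>{l \<in> ?L. ?R < (\<Sum>j\<in>UNIV. l j)}. G' l * (2 ^ ?s * B' l)\<^sup>2)"
    by (rule sum.mono_neutral_right) (use fin in \<open>auto simp: G'_def\<close>)
  also have "\<dots> = (\<Sum>l\<in>{l \<in> ?L. ?R < (\<Sum>j\<in>UNIV. l j)}. G * (2 ^ ?s * B)\<^sup>2 * (\<theta>\<^sup>2) ^ (\<Sum>j\<in>UNIV. l j))"
    by (rule sum.cong[OF refl]) (simp add: G'_def B'_def power_mult_distrib mult.assoc flip: power_mult, simp add: mult.commute)
  also have "\<dots> = G * (2 ^ ?s * B)\<^sup>2 * (\<Sum>l\<in>{l \<in> ?L. ?R < (\<Sum>j\<in>UNIV. l j)}. (\<theta>\<^sup>2) ^ (\<Sum>j\<in>UNIV. l j))"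
    by (rule sum_distrib_left[symmetric])
  also have "\<dots> \<le> G * (2 ^ ?s * B)\<^sup>2 * (C1 * real (?R + 2) ^ (?s - 1) * (\<theta>\<^sup>2) ^ ?R)"
    using G by (intro mult_left_mono C1) auto
  finally have tail: "(\<Sum>l\<in>?L - {\<lambda>_. 0}. G' l * (2 ^ ?s * B' l)\<^sup>2) \<le> G * (2 ^ ?s * B)\<^sup>2 * C1 * real (?R + 2) ^ (?s - 1) * (\<theta>\<^sup>2) ^ ?R"
    by (simp only: mult.assoc)
  have "(1 / real ?n) * (\<Sum>i=1..?n. g (\<lambda>j. word K j \<omega> (a i $ j))) - c = (1 / real ?n) * (\<Sum>i=1..?n. h (\<lambda>j. word K j \<omega> (a i $ j)))" for \<omega>
    using n by (simp add: h_def sum_subtractf field_simps)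
  then have "expectation (\<lambda>\<omega>. ((1 / real ?n) * (\<Sum>i=1..?n. g (\<lambda>j. word K j \<omega> (a i $ j))) - c)\<^sup>2)
     = (1 / real ?n ^ 2) * (\<Sum>i=1..?n. \<Sum>i'=1..?n. \<Sum>x\<in>?W. \<Sum>x'\<in>?W.
      (\<Prod>j\<in>UNIV. \<Prod>k<K. level_prob b (digits b K (a i $ j)) (digits b K (a i' $ j)) (x j) (x' j) k) * (h x * h x'))"
    using has_bochner_integral_integral_eq[OF word_mean_second_moment[OF K, of ?n h "\<lambda>i j. a i $ j"]] by (simp only:)
  also have "\<dots> \<le> (1 / real ?n) * (G * (2 ^ ?s * B)\<^sup>2 * C1 * real (?R + 2) ^ (?s - 1) * (\<theta>\<^sup>2) ^ ?R)"
    using moment mult_left_mono[OF tail, of "1 / real ?n"] by simp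
  finally show ?thesis by blast
qed

text \<open>\<open>C\<close> is obtained before the net, the scramble, the probability space and
  \<open>m\<close>, so it is uniform in all of them.\<close>

lemma scrambled_net_variance_bound:
  fixes X :: "'s::finite \<Rightarrow> (real^'d::finite) set" and f :: "real^'d^'s \<Rightarrow> real"
  assumes split: "\<And>j. unit_split b (X j) (cell j)" and cpt: "compact (prod_region X)"
    and cont: "continuous_on (prod_region X) f" and lip: "mixed_lipschitz X f"
  obtains C where "C \<ge> 0" "\<And>m a u (M :: 'w measure). tms_net b t m a \<Longrightarrow> nested_uniform_scramble M b (b ^ m) a u \<Longrightarrow>
      (\<And>v \<kappa>. v \<noteq> {} \<Longrightarrow> gain b (b ^ m) a v \<kappa> \<le> G) \<Longrightarrow>
      prob_space.variance M (mu_hat b cell f (b ^ m) u)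
      \<le> (1 / real (b ^ m)) * (C * real (m - t + 2) ^ (CARD('s) - 1) * (b powr (- 2 / real CARD('d))) ^ (m - t))"
proof -
  let ?s = "CARD('s)" and ?XX = "prod_region X"
  define \<theta> where "\<theta> = real b powr (- 1 / real CARD('d))"
  have b: "b \<ge> 2" using split unfolding unit_split_def by blast
  have \<theta>: "0 < \<theta>" "\<theta> < 1" unfolding \<theta>_def using b by (simp, intro powr_less_one) auto
  have \<theta>2: "\<theta>\<^sup>2 = real b powr (- 2 / real CARD('d))"
    unfolding \<theta>_def using b by (simp add: powr_realpow[symmetric] powr_powr)
  define pick where "pick j = unit_split.pick (cell j)" for j
  have pickX: "pick j w \<in> X j" if "w \<in> lists {..<b}" for j w
    unfolding pick_def by (rule unit_split.pick_in_X[OF split that])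
  have words_lists: "w \<in> lists {..<b}" if "w \<in> words b K" for w K using that by (auto simp: words_def)
  define g where "g x = f (\<chi> j. pick j (x j))" for x
  obtain L where L: "L \<ge> 0" "\<And>u p q. (\<And>j. p j \<in> X j) \<Longrightarrow> (\<And>j. q j \<in> X j) \<Longrightarrow>
     \<bar>mixed_diff u p q (\<lambda>z. f (\<chi> j. z j))\<bar> \<le> L * (\<Prod>j\<in>u. dist (p j) (q j))"
    using lip unfolding mixed_lipschitz_def by metis
  have "\<exists>C\<ge>0. \<forall>x y k K. x \<in> words b K \<longrightarrow> y \<in> words b K \<longrightarrow> k \<le> K \<longrightarrow> take k x = take k y \<longrightarrow>
      dist (pick j x) (pick j y) \<le> C * \<theta> ^ k" for j
    unfolding pick_def \<theta>_def using unit_split.spherical_bound[OF split[of j]] by metis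
  then obtain Cj where Cj: "\<And>j. Cj j \<ge> 0" "\<And>j x y k K. x \<in> words b K \<Longrightarrow> y \<in> words b K \<Longrightarrow> k \<le> K \<Longrightarrow> take k x = take k y \<Longrightarrow>
      dist (pick j x) (pick j y) \<le> Cj j * \<theta> ^ k" by metis
  \<comment> \<open>Absorbs the off-by-one: sharing \<open>l j - 1\<close> letters gives only Cj *
    \<open>\<theta> ^ (l j - 1)\<close>, and \<open>Cj j \<le> E * \<theta>\<close> restores the
    missing power. The summand 1 ensures \<open>E \<ge> 1\<close>.\<close>
  define E where "E = 1 + (\<Sum>j\<in>UNIV. Cj j) / \<theta>"
  have E1: "E \<ge> 1" unfolding E_def using \<theta> Cj(1) by (simp add: sum_nonneg)
  have CE: "Cj j \<le> E * \<theta>" for j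
    unfolding E_def using \<theta> member_le_sum[of j UNIV Cj] Cj(1) by (simp add: distrib_right)
  define B where "B = L * E ^ ?s"
  have B0: "B \<ge> 0" using L(1) E1 by (simp add: B_def)
  have gB: "\<bar>mixed_diff {j. l j \<noteq> 0} x y g\<bar> \<le> B * \<theta> ^ (\<Sum>j\<in>UNIV. l j)"
    if l: "\<And>j. l j \<le> K" and xy: "x \<in> UNIV \<rightarrow>\<^sub>E words b K" "y \<in> UNIV \<rightarrow>\<^sub>E words b K"
      and tk: "\<And>j. take (l j - 1) (x j) = take (l j - 1) (y j)" for l :: "'s \<Rightarrow> nat" and K x y
  proof -
    let ?u = "{j. l j \<noteq> 0}"
    have W: "x j \<in> words b K" "y j \<in> words b K" for j using xy by auto
    have "\<bar>mixed_diff ?u x y g\<bar> = \<bar>mixed_diff ?u (\<lambda>j. pick j (x j)) (\<lambda>j. pick j (y j)) (\<lambda>z. f (\<chi> j. z j))\<bar>"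
      unfolding g_def by (subst mixed_diff_comp[where h = "\<lambda>z. f (\<chi> j. z j)" and P = pick]) simp
    also have "\<dots> \<le> L * (\<Prod>j\<in>?u. dist (pick j (x j)) (pick j (y j)))"
      by (rule L(2)[OF pickX[OF words_lists[OF W(1)]] pickX[OF words_lists[OF W(2)]]])
    also have "\<dots> \<le> L * (\<Prod>j\<in>?u. E * \<theta> ^ l j)"
    proof (intro mult_left_mono prod_mono conjI L(1))
      fix j assume j: "j \<in> ?u"
      have "l j - 1 \<le> K" using l[of j] by simp
      then have "dist (pick j (x j)) (pick j (y j)) \<le> Cj j * \<theta> ^ (l j - 1)" by (rule Cj(2)[OF W _ tk])
      also have "\<dots> \<le> (E * \<theta>) * \<theta> ^ (l j - 1)" using CE \<theta> by (intro mult_right_mono) auto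
      also have "\<dots> = E * \<theta> ^ l j" using j by (simp add: power_eq_if)
      finally show "dist (pick j (x j)) (pick j (y j)) \<le> E * \<theta> ^ l j" .
    qed simp
    \<comment> \<open>Components of level 0 are filled in with the factor \<open>E \<ge> 1\<close>,
      so that the exponent becomes the total level.\<close>
    also have "\<dots> \<le> L * (\<Prod>j\<in>UNIV. E * \<theta> ^ l j)"
    proof (intro mult_left_mono L(1))
      have "(\<Prod>j\<in>UNIV. E * \<theta> ^ l j) = (\<Prod>j\<in>UNIV - ?u. E * \<theta> ^ l j) * (\<Prod>j\<in>?u. E * \<theta> ^ l j)"
        by (rule prod.subset_diff) auto
      moreover have "1 \<le> (\<Prod>j\<in>UNIV - ?u. E * \<theta> ^ l j)" using E1 by (intro prod_ge_1) auto
      moreover have "0 \<le> (\<Prod>j\<in>?u. E * \<theta> ^ l j)" using E1 \<theta> by (intro prod_nonneg) auto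
      ultimately show "(\<Prod>j\<in>?u. E * \<theta> ^ l j) \<le> (\<Prod>j\<in>UNIV. E * \<theta> ^ l j)"
        using mult_right_mono[of 1 "\<Prod>j\<in>UNIV - ?u. E * \<theta> ^ l j" "\<Prod>j\<in>?u. E * \<theta> ^ l j"] by simp
    qed
    also have "\<dots> = B * \<theta> ^ (\<Sum>j\<in>UNIV. l j)" by (simp add: B_def prod.distrib power_sum)
    finally show ?thesis .
  qed
  have "0 < \<theta>\<^sup>2" "\<theta>\<^sup>2 < 1" using \<theta> by (auto simp: power_less_one_iff)
  from level_tail_sum[OF this, where ?'s = 's]
  obtain C1 where C1: "C1 \<ge> 0" "\<And>R K. (\<Sum>l\<in>{l \<in> (UNIV :: 's set) \<rightarrow>\<^sub>E {..K}. R < (\<Sum>j\<in>UNIV. l j)}. (\<theta>\<^sup>2) ^ (\<Sum>j\<in>UNIV. l j))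
     \<le> C1 * real (R + 2) ^ (?s - 1) * (\<theta>\<^sup>2) ^ R" by blast
  obtain F where F: "\<And>x. x \<in> ?XX \<Longrightarrow> \<bar>f x\<bar> \<le> F"
    using compact_imp_bounded[OF compact_continuous_image[OF cont cpt]] unfolding bounded_iff by auto
  let ?C = "max G 0 * (2 ^ ?s * B)\<^sup>2 * C1"
  have main: "prob_space.variance M (mu_hat b cell f (b ^ m) u)
      \<le> (1 / real (b ^ m)) * (?C * real (m - t + 2) ^ (?s - 1) * (\<theta>\<^sup>2) ^ (m - t))"
    if net: "tms_net b t m a" and scr: "nested_uniform_scramble M b (b ^ m) a u"
      and gain: "\<And>v \<kappa>. v \<noteq> {} \<Longrightarrow> gain b (b ^ m) a v \<kappa> \<le> G" for m a u and M :: "'w measure"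
  proof -
    let ?n = "b ^ m"
    have n: "?n > 0" using b by simp
    from scr obtain \<pi> :: "'s \<times> nat list \<Rightarrow> 'w \<Rightarrow> nat \<Rightarrow> nat" where ps: "prob_space M"
      and \<pi>: "prob_space.indep_vars M (\<lambda>_. count_space {p. p permutes {..<b}}) \<pi> (UNIV \<times> lists {..<b})"
        "\<forall>q\<in>UNIV \<times> lists {..<b}. distr M (count_space {p. p permutes {..<b}}) (\<pi> q)
             = uniform_count_measure {p. p permutes {..<b}}"
      and u: "\<forall>\<omega>\<in>space M. \<forall>i\<in>{1..?n}. \<forall>j. u i \<omega> $ j = scramble b (\<lambda>w. \<pi> (j, w) \<omega>) (a i $ j)"
      unfolding nested_uniform_scramble_def by (elim conjE exE)
    interpret prob_space M by (rule ps)
    have scrm: "scrambling M b \<pi>" by unfold_locales (use b \<pi> in auto)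
    interpret scrambling M b \<pi> by (rule scrm)
    define U where "U i j \<omega> = scramble b (\<lambda>w. \<pi> (j, w) \<omega>) (a i $ j)" for i j \<omega>
    have uU: "u i \<omega> $ j = U i j \<omega>" if "\<omega> \<in> space M" "i \<in> {1..?n}" for i j \<omega>
      using u that unfolding U_def by blast
    have digit_meas: "(\<lambda>\<omega>. \<pi> (j, digits b k x) \<omega> (digit b (Suc k) x)) \<in> measurable M (count_space UNIV)" for j k x
      by (rule measurable_compose[OF measurable_perm]) (use digits_lists in auto)
    have U_meas: "U i j \<in> borel_measurable M" for i j
      unfolding U_def[abs_def] scramble_def
      by (intro borel_measurable_suminf borel_measurable_divide borel_measurable_const measurable_compose[OF digit_meas]) auto
    \<comment> \<open>Two versions of the estimator at level \<open>Suc K\<close>, a positive level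
      as the pair law requires. \<open>Y\<close> reads the digits of the scrambled numbers and
      converges at every point of the space; \<open>Z\<close> reads the scrambled letters, whose
      joint law is known. They agree almost surely.\<close>
    define Y where "Y K \<omega> = (1 / real ?n) * (\<Sum>i=1..?n. g (\<lambda>j. digits b (Suc K) (U i j \<omega>)))" for K \<omega>
    define Z where "Z K \<omega> = (1 / real ?n) * (\<Sum>i=1..?n. g (\<lambda>j. word (Suc K) j \<omega> (a i $ j)))" for K \<omega>
    have Y_meas: "Y K \<in> borel_measurable M" for K
      unfolding Y_def[abs_def] digits_def
      by (intro borel_measurable_times borel_measurable_const borel_measurable_sum measurable_word_fun
          measurable_compose[OF U_meas measurable_digit])
    have Z_meas: "Z K \<in> borel_measurable M" for K
      unfolding Z_def[abs_def] scrambled_word_def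
      by (intro borel_measurable_times borel_measurable_const borel_measurable_sum measurable_word_fun digit_meas)
    have AE_YZ: "AE \<omega> in M. \<forall>K. Y K \<omega> = Z K \<omega>"
    proof -
      have "AE \<omega> in M. \<forall>i j K0. \<exists>k\<ge>K0. \<pi> (j, digits b k (a i $ j)) \<omega> (digit b (Suc k) (a i $ j)) \<noteq> b - 1"
        by (rule AE_all_countable[THEN iffD2], rule allI, rule AE_not_eventually_top)
      then show ?thesis
      proof (rule AE_mp, intro AE_I2 impI allI)
        fix \<omega> K assume \<omega>: "\<omega> \<in> space M"
          and top: "\<forall>i j K0. \<exists>k\<ge>K0. \<pi> (j, digits b k (a i $ j)) \<omega> (digit b (Suc k) (a i $ j)) \<noteq> b - 1"
        have "digits b K (U i j \<omega>) = word K j \<omega> (a i $ j)" for i j K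
          unfolding U_def scramble_def scrambled_word_def
          by (rule digits_of_expansion[OF b perm_digit_less[OF \<omega>]]) (use top in blast)
        then show "Y K \<omega> = Z K \<omega>" unfolding Y_def Z_def by simp
      qed
    qed
    have "\<exists>c. expectation (\<lambda>\<omega>. (Y K \<omega> - c)\<^sup>2) \<le> (1 / real ?n) * (?C * real (m - t + 2) ^ (?s - 1) * (\<theta>\<^sup>2) ^ (m - t))" for K
    proof -
      have "\<exists>c. expectation (\<lambda>\<omega>. (Z K \<omega> - c)\<^sup>2) \<le> (1 / real ?n) * (?C * real (m - t + 2) ^ (?s - 1) * (\<theta>\<^sup>2) ^ (m - t))"
        unfolding Z_def
      proof (rule scrambled_net_mean_bound[OF scrm net])
        show "gain b ?n a v \<kappa> \<le> max G 0" if "v \<noteq> {}" for v \<kappa> using gain[OF that, of \<kappa>] by simp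
        show "\<bar>mixed_diff {j. l j \<noteq> 0} x y g\<bar> \<le> B * \<theta> ^ (\<Sum>j\<in>UNIV. l j)"
          if "\<And>j. l j \<le> Suc K" "x \<in> UNIV \<rightarrow>\<^sub>E words b (Suc K)" "y \<in> UNIV \<rightarrow>\<^sub>E words b (Suc K)"
            "\<And>j. take (l j - 1) (x j) = take (l j - 1) (y j)" for l x y
          by (rule gB[OF that])
        show "\<theta> \<ge> 0" using \<theta> by simp
      qed (rule C1(2) B0 max.cobounded2 zero_less_Suc)+
      then obtain c where c: "expectation (\<lambda>\<omega>. (Z K \<omega> - c)\<^sup>2) \<le> (1 / real ?n) * (?C * real (m - t + 2) ^ (?s - 1) * (\<theta>\<^sup>2) ^ (m - t))"
        by blast
      have "expectation (\<lambda>\<omega>. (Y K \<omega> - c)\<^sup>2) = expectation (\<lambda>\<omega>. (Z K \<omega> - c)\<^sup>2)"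
      proof (rule integral_cong_AE)
        show "AE \<omega> in M. (Y K \<omega> - c)\<^sup>2 = (Z K \<omega> - c)\<^sup>2" using AE_YZ by eventually_elim simp
      qed (use Y_meas Z_meas in measurable)
      then show ?thesis using c by (intro exI[of _ c]) (simp only:)
    qed
    then obtain c where c: "\<And>K. expectation (\<lambda>\<omega>. (Y K \<omega> - c K)\<^sup>2) \<le> (1 / real ?n) * (?C * real (m - t + 2) ^ (?s - 1) * (\<theta>\<^sup>2) ^ (m - t))"
      by metis
    have inX: "(\<chi> j. pick j (digits b K (y j))) \<in> ?XX" for K and y :: "'s \<Rightarrow> real"
      using pickX digits_lists by simp
    show ?thesis
    proof (rule variance_le_lim[OF Y_meas _ _ c])
      fix \<omega> assume \<omega>: "\<omega> \<in> space M"
      have "(\<lambda>K. g (\<lambda>j. digits b (Suc K) (U i j \<omega>))) \<longlonglongrightarrow> f (prod_map b cell (u i \<omega>))" if i: "i \<in> {1..?n}" for i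
      proof -
        have pm: "(\<lambda>K. \<chi> j. pick j (digits b (Suc K) (U i j \<omega>))) \<longlonglongrightarrow> prod_map b cell (u i \<omega>)"
          unfolding prod_map_def uU[OF \<omega> i] pick_def
          by (intro tendsto_vec_lambda LIMSEQ_Suc unit_split.pick_digits_tendsto[OF split])
        \<comment> \<open>Continuity of \<open>f\<close> is given only on the region, so the limit
          of the representatives must be shown to lie in it; this is where closedness
          enters.\<close>
        have "prod_map b cell (u i \<omega>) \<in> ?XX"
          by (rule closed_sequentially[OF compact_imp_closed[OF cpt] inX pm])
        from continuous_on_tendsto_compose[OF cont pm this always_eventually[OF allI[OF inX]]]
        show ?thesis unfolding g_def .
      qed
      then show "(\<lambda>K. Y K \<omega>) \<longlonglongrightarrow> mu_hat b cell f ?n u \<omega>"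
        unfolding Y_def mu_hat_def by (intro tendsto_mult tendsto_const tendsto_sum) auto
      fix K
      define S where "S = (\<Sum>i=1..?n. g (\<lambda>j. digits b (Suc K) (U i j \<omega>)))"
      have "\<bar>S\<bar> \<le> (\<Sum>i=1..?n. F)"
        unfolding S_def g_def by (rule order_trans[OF sum_abs], rule sum_mono, rule F[OF inX])
      then have "\<bar>S\<bar> \<le> F * real ?n" by (simp add: mult.commute)
      moreover have "Y K \<omega> = S / real ?n" unfolding Y_def S_def by simp
      ultimately show "\<bar>Y K \<omega>\<bar> \<le> F" using n by (simp only: abs_divide abs_of_nat pos_divide_le_eq of_nat_0_less_iff)
    qed
  qed
  have "?C \<ge> 0" using C1(1) by simp
  then show ?thesis by (rule that[OF _ main[unfolded \<theta>2]])
qed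


section \<open>Compactness of the region and the asymptotic rate\<close>

lemma bounded_prod_region:
  fixes X :: "'s::finite \<Rightarrow> (real^'d::finite) set"
  assumes "\<And>j. bounded (X j)"
  shows "bounded (prod_region X)"
proof -
  have "\<exists>B. \<forall>j. \<forall>x\<in>X j. norm x \<le> B j" using assms unfolding bounded_iff by metis
  then obtain B where B: "\<And>j x. x \<in> X j \<Longrightarrow> norm x \<le> B j" by blast
  have "norm x \<le> (\<Sum>j\<in>UNIV. B j)" if "x \<in> prod_region X" for x
  proof -
    have "norm x \<le> (\<Sum>j\<in>UNIV. norm (x $ j))" unfolding norm_vec_def by (rule L2_set_le_sum) simp
    also have "\<dots> \<le> (\<Sum>j\<in>UNIV. B j)" using that by (intro sum_mono B) (simp add: prod_region_def)
    finally show ?thesis .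
  qed
  then show ?thesis unfolding bounded_iff by blast
qed

lemma closed_prod_region:
  fixes X :: "'s::finite \<Rightarrow> (real^'d::finite) set"
  assumes "\<And>j. closed (X j)"
  shows "closed (prod_region X)"
proof -
  have "prod_region X = (\<Inter>j. (\<lambda>x. x $ j) -` X j)" by (auto simp: prod_region_def)
  then show ?thesis using assms by (auto intro!: closed_INT closed_vimage continuous_intros)
qed

lemma smooth_continuous_on:
  assumes "smooth R f"
  shows "continuous_on R f"
  using assms unfolding smooth_def
proof (elim exE conjE)
  fix D assume D: "\<forall>x\<in>R. D {} x = f x" "\<forall>v\<subseteq>Basis. continuous_on R (D v)"
  have "continuous_on R (D {})" using D(2) by simp
  then show ?thesis using D(1) by (metis continuous_on_cong)
qed

lemma C_class_on_continuous_on: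
  assumes "C_class_on N R f"
  shows "continuous_on R f"
  using assms unfolding C_class_on_def
proof (elim exE conjE)
  fix D assume D: "\<forall>x\<in>R. D (\<lambda>_. 0) x = f x" "\<forall>\<alpha>\<in>multi_indices N. continuous_on R (D \<alpha>)"
  have "continuous_on R (D (\<lambda>_. 0))" using D(2) by (simp add: multi_indices_def)
  then show ?thesis using D(1) by (metis continuous_on_cong)
qed

lemma scrambled_net_variance_bigo:
  fixes X :: "'s::finite \<Rightarrow> (real^'d::finite) set" and f :: "real^'d^'s \<Rightarrow> real"
    and M :: "nat \<Rightarrow> 'w measure"
  assumes split: "\<And>j. unit_split b (X j) (cell j)" and cpt: "compact (prod_region X)"
    and cont: "continuous_on (prod_region X) f" and lip: "mixed_lipschitz X f"
    and net: "\<And>m. m \<ge> t \<Longrightarrow> tms_net b t m (a m)"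
    and scr: "\<And>m. m \<ge> t \<Longrightarrow> nested_uniform_scramble (M m) b (b ^ m) (a m) (u m)"
    and gain: "\<And>m v \<kappa>. m \<ge> t \<Longrightarrow> v \<noteq> {} \<Longrightarrow> gain b (b ^ m) (a m) v \<kappa> \<le> G"
  shows "(\<lambda>m. prob_space.variance (M m) (mu_hat b cell f (b ^ m) (u m)))
              \<in> O(\<lambda>m. ln (real (b ^ m)) ^ (CARD('s) - 1) / real (b ^ m) powr (1 + 2 / real CARD('d)))"
proof -
  let ?p = "CARD('s) - 1" and ?e = "2 / real CARD('d)"
  have b: "b \<ge> 2" using split unfolding unit_split_def by blast
  then have lnb: "ln (real b) > 0" by simp
  obtain C where C0: "C \<ge> 0" and C: "\<And>m a u (M :: 'w measure). tms_net b t m a \<Longrightarrow> nested_uniform_scramble M b (b ^ m) a u \<Longrightarrow>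
      (\<And>v \<kappa>. v \<noteq> {} \<Longrightarrow> gain b (b ^ m) a v \<kappa> \<le> G) \<Longrightarrow>
      prob_space.variance M (mu_hat b cell f (b ^ m) u)
      \<le> (1 / real (b ^ m)) * (C * real (m - t + 2) ^ ?p * (b powr (- 2 / real CARD('d))) ^ (m - t))"
    using scrambled_net_variance_bound[OF split cpt cont lip, of t G, where ?'w = 'w] by blast
  \<comment> \<open>The factor 3 / ln b converts m - t + 2 into the logarithm of n, and the power
    with exponent \<open>t\<close> is the cost of having m - t in place of m.\<close>
  let ?c = "C * (3 / ln (real b)) ^ ?p * (b powr ?e) ^ t"
  have "norm (prob_space.variance (M m) (mu_hat b cell f (b ^ m) (u m)))
      \<le> ?c * norm (ln (real (b ^ m)) ^ ?p / real (b ^ m) powr (1 + ?e))" if m: "m \<ge> max t 1" for m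
  proof -
    have mt: "m \<ge> t" using m by simp
    have ln: "ln (real (b ^ m)) = real m * ln (real b)" using b by (simp add: ln_realpow)
    have "(b powr (- 2 / real CARD('d))) ^ (m - t) = b powr (- ?e * (real m - real t))"
      using b mt by (simp add: powr_realpow[symmetric] powr_powr of_nat_diff)
    also have "\<dots> = b powr (real t * ?e) / b powr (real m * ?e)"
      by (simp add: powr_diff[symmetric] algebra_simps diff_divide_distrib)
    also have "\<dots> = (b powr ?e) ^ t / real (b ^ m) powr ?e"
      using b by (simp add: powr_realpow[symmetric] powr_powr mult.commute)
    finally have pw: "(b powr (- 2 / real CARD('d))) ^ (m - t) = (b powr ?e) ^ t / real (b ^ m) powr ?e" .
    \<comment> \<open>Uses m >= 1; at m = 0 the logarithm on the right-hand side vanishes.\<close>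
    have "real (m - t + 2) \<le> 3 * real m" using m by simp
    also have "\<dots> = (3 / ln (real b)) * ln (real (b ^ m))" unfolding ln using lnb by simp
    finally have "real (m - t + 2) ^ ?p \<le> ((3 / ln (real b)) * ln (real (b ^ m))) ^ ?p"
      by (intro power_mono) auto
    then have le: "(1 / real (b ^ m)) * (C * real (m - t + 2) ^ ?p * ((b powr ?e) ^ t / real (b ^ m) powr ?e))
       \<le> (1 / real (b ^ m)) * (C * ((3 / ln (real b)) * ln (real (b ^ m))) ^ ?p * ((b powr ?e) ^ t / real (b ^ m) powr ?e))"
      using C0 by (intro mult_left_mono mult_right_mono) auto
    have V: "prob_space.variance (M m) (mu_hat b cell f (b ^ m) (u m))
        \<le> (1 / real (b ^ m)) * (C * real (m - t + 2) ^ ?p * (b powr (- 2 / real CARD('d))) ^ (m - t))"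
      by (rule C[OF net[OF mt] scr[OF mt] gain[OF mt]])
    have "prob_space (M m)" using scr[OF mt] unfolding nested_uniform_scramble_def by (elim conjE)
    then have V0: "0 \<le> prob_space.variance (M m) (mu_hat b cell f (b ^ m) (u m))"
      by (rule prob_space.variance_positive)
    have "real (b ^ m) powr (1 + ?e) = real (b ^ m) * real (b ^ m) powr ?e"
      using b by (simp add: powr_add)
    then have eq: "(1 / real (b ^ m)) * (C * ((3 / ln (real b)) * ln (real (b ^ m))) ^ ?p * ((b powr ?e) ^ t / real (b ^ m) powr ?e))
       = ?c * (ln (real (b ^ m)) ^ ?p / real (b ^ m) powr (1 + ?e))"
      by (simp only: power_mult_distrib) (simp add: field_simps)
    have rn: "0 \<le> ln (real (b ^ m)) ^ ?p / real (b ^ m) powr (1 + ?e)"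
      unfolding ln using lnb by simp
    show ?thesis
      unfolding real_norm_def abs_of_nonneg[OF V0] abs_of_nonneg[OF rn]
      using order_trans[OF V[unfolded pw] le] unfolding eq .
  qed
  then show ?thesis
    by (intro bigoI[where c = ?c] eventually_at_top_linorderI[of "max t 1"]) blast
qed

theorem theorem7:
  fixes b t :: nat
    and X :: "'s::finite \<Rightarrow> (real^'d::finite) set"
    and cell :: "'s \<Rightarrow> nat list \<Rightarrow> (real^'d) set"
    and a :: "nat \<Rightarrow> nat \<Rightarrow> real^'s"
    and M :: "nat \<Rightarrow> 'w measure"
    and u :: "nat \<Rightarrow> nat \<Rightarrow> 'w \<Rightarrow> real^'s"
    and f :: "real^'d^'s \<Rightarrow> real"
    and G :: real
  assumes "b \<ge> 2"
    and "\<And>j. bounded (X j)"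
    and "\<And>j. measure lborel (X j) = 1"
    and "\<And>j. recursive_split b (X j) (cell j)"
    and "\<And>j. convergent_split b (cell j)"
    and "\<And>j. spherical_split b (cell j)"
    and "\<And>m. m \<ge> t \<Longrightarrow> tms_net b t m (a m)"
    and "\<And>m. m \<ge> t \<Longrightarrow> nested_uniform_scramble (M m) b (b ^ m) (a m) (u m)"
    and "\<And>m v \<kappa>. m \<ge> t \<Longrightarrow> v \<noteq> {} \<Longrightarrow> gain b (b ^ m) (a m) v \<kappa> \<le> G"
  shows "(sobol_extensible (prod_region X) \<and> smooth (prod_region X) f \<longrightarrow>
            (\<lambda>m. prob_space.variance (M m) (mu_hat b cell f (b ^ m) (u m)))
              \<in> O(\<lambda>m. ln (real (b ^ m)) ^ (CARD('s) - 1)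
                       / real (b ^ m) powr (1 + 2 / real CARD('d))))
       \<and> ((\<forall>j. closed (X j) \<and> interior (X j) \<noteq> {} \<and> measure lborel (frontier (X j)) = 0) \<and>
          C_class_on (CARD('d) * CARD('s)) (prod_region X) f \<longrightarrow>
            (\<lambda>m. prob_space.variance (M m) (mu_hat b cell f (b ^ m) (u m)))
              \<in> O(\<lambda>m. ln (real (b ^ m)) ^ (CARD('s) - 1)
                       / real (b ^ m) powr (1 + 2 / real CARD('d))))"
proof -
  let ?R = "prod_region X"
  have split: "unit_split b (X j) (cell j)" for j
    by unfold_locales (fact assms)+
  have bdd: "bounded ?R" by (intro bounded_prod_region assms)
  note main = scrambled_net_variance_bigo[OF split _ _ _ assms(7-9)]
  show ?thesis
  proof (intro conjI impI; elim conjE)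
    assume sob: "sobol_extensible ?R" and sm: "smooth ?R f"
    \<comment> \<open>Here closedness of the region is part of being Sobol' extensible.\<close>
    have "closed ?R" using sob unfolding sobol_extensible_def by (elim conjE)
    then have cpt: "compact ?R" using bdd by (simp add: compact_eq_bounded_closed)
    show "(\<lambda>m. prob_space.variance (M m) (mu_hat b cell f (b ^ m) (u m)))
        \<in> O(\<lambda>m. ln (real (b ^ m)) ^ (CARD('s) - 1) / real (b ^ m) powr (1 + 2 / real CARD('d)))"
      by (rule main[OF cpt smooth_continuous_on[OF sm] sobol_mixed_lipschitz[OF sob sm cpt]])
  next
    assume X: "\<forall>j. closed (X j) \<and> interior (X j) \<noteq> {} \<and> measure lborel (frontier (X j)) = 0"
      and cls: "C_class_on (CARD('d) * CARD('s)) ?R f"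
    have "closed ?R" using X by (intro closed_prod_region) blast
    then have cpt: "compact ?R" using bdd by (simp add: compact_eq_bounded_closed)
    show "(\<lambda>m. prob_space.variance (M m) (mu_hat b cell f (b ^ m) (u m)))
        \<in> O(\<lambda>m. ln (real (b ^ m)) ^ (CARD('s) - 1) / real (b ^ m) powr (1 + 2 / real CARD('d)))"
      \<comment> \<open>What remains is s <= ds: one order of smoothness for each component.\<close>
      by (rule main[OF cpt C_class_on_continuous_on[OF cls] whitney_mixed_lipschitz[OF cls _ cpt]]) simp
  qed
qed

end
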